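(* Let $g$ be the fixed point of the period doubling operator and assume that $g$ is a concave function on $I=[-1,1]$. Let $\mathcal{L}_n$ ($n\ge 1$), $\mathcal{L}_{\varphi,B}$, $\mathcal{L}_{\varphi,L}$ and $\mathcal{L}_\varphi$ be the operators defined in the context. Then one can find real numbers $\lambda_n$ and vectors $v_n$ ($n\geq 1$) such that: (1) for each $n$, $\lambda_n>1$ is an eigenvalue of $\mathcal{L}_n$ with a positive eigenvector $v_n\in\mathbf{R}^{2^{n-1}}=\mathrm{span}\{k_{n1},\dots,k_{n2^{n-1}}\}$, i.e. each component of $v_n$ is positive; (2) there is a subsequence $\{n_i\}_{i=0}^\infty$ of the integers such that the limit $\lambda=\lim_{i\to\infty}\lambda_{n_i}$ exists, $\lambda>1$, and $\lambda$ is an eigenvalue of $\mathcal{L}_{\varphi,B}$ on $\mathcal{V}^b(\Lambda)$ with an eigenvector $v=\lim_{i\to\infty}v_{n_i}$ in $\mathcal{V}^b(\Lambda)$; (3) $\lambda$ is an eigenvalue of $\mathcal{L}_{\varphi,L}$ on the space $\mathcal{V}^{0,1}(\Lambda)$ of Lipschitz vector fields; (4) $\lambda$ is an eigenvalue of $\mathcal{L}_\varphi$ on the space $\mathcal{V}^\omega(J,\Omega)$ of analytic vector fields.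
   Context: Let $I=[-1,1]$ and let $g:I\to I$ be the (Feigenbaum) fixed point of the period doubling operator: $g$ is an even folding mapping with unique non-degenerate critical point $0$, analytic on a connected open set $U\subset\mathbf{C}$ containing $I$ with continuous extension to $\partial U$, with $g(0)=1$, $g^{\circ 3}(0)>-g^{\circ 2}(0)>g^{\circ 4}(0)>0>g^{\circ 2}(0)$, and $g(x)=-\alpha\, g\circ g(-\alpha^{-1}x)$ where $\alpha=-1/g(1)$. Put $J=g(I)=[g(1),1]$, $\Omega=g(U)$, $J_0=[g(1),g^{\circ 3}(1)]$, $J_1=[g^{\circ 2}(1),1]$. Define $\sigma:J_0\cup J_1\to J$ by $\sigma(x)=-\alpha x$ on $J_0$ and $\sigma(x)=-\alpha g(x)$ on $J_1$. It is expanding and has an expanding analytic extension, still denoted $\sigma$, to $\Omega_0\cup\Omega_1\supset J_0\cup J_1$, where $\Omega_0\supset J_0$, $\Omega_1\supset J_1$ are disjoint subdomains of $\Omega$, each mapped bijectively onto $\Omega$ by $\sigma$, with $\sigma|\Omega_i$ extending continuously to $\partial\Omega_i$. Let $\varphi=\sigma'$ and let $\Lambda$ be the maximal invariant set of $\sigma$ (the points of $J_0\cup J_1$ all of whose forward iterates under $\sigma$ stay in $J_0\cup J_1$). $\mathcal{V}^\omega(J,\Omega)$ is the Banach space (sup norm) of real vector fields (functions) on $J$ with a complex analytic extension to $\Omega$ extending continuously to $\partial\Omega$; $\mathcal{V}^{0,1}(\Lambda)$ is the space of real Lipschitz continuous vector fields (functions) on $\Lambda$; $\mathcal{V}^b(\Lambda)$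 is the space of bounded real vector fields (functions) on $\Lambda$. The operators $\mathcal{L}_\varphi$ on $\mathcal{V}^\omega(J,\Omega)$, $\mathcal{L}_{\varphi,L}$ on $\mathcal{V}^{0,1}(\Lambda)$ and $\mathcal{L}_{\varphi,B}$ on $\mathcal{V}^b(\Lambda)$ are all given by the formula $v\mapsto\big(x\mapsto\sum_{y\in\sigma^{-1}(x)}\varphi(y)v(y)\big)$. For $n\ge1$, $\sigma^{-n}(J)$ is a union of $2^n$ disjoint closed intervals $J_{n1},\dots,J_{n2^n}$ labelled from left to right; write $J_{n(2^{n-1}+i)}=[a_{ni},b_{ni}]$ and $\beta_{ni}=|g'(b_{ni})|$ for $i=1,\dots,2^{n-1}$. Define $\varphi_n$ on $\Lambda$ by $\varphi_n=-\alpha$ on $J_0\cap\Lambda$ and $\varphi_n=\alpha\beta_{ni}$ on $J_{n(2^{n-1}+i)}\cap\Lambda$, and $\mathcal{L}_n:\mathcal{V}^b(\Lambda)\to\mathcal{V}^b(\Lambda)$ by $(\mathcal{L}_nv)(x)=\sum_{y\in\sigma^{-1}(x)}\varphi_n(y)v(y)$. For $i=1,\dots,2^{n-1}$ let $k_{ni}$ be the function on $\Lambda$ equal to $1$ on $(J_{n(2i-1)}\cup J_{n(2i)})\cap\Lambda$ and $0$ elsewhere; $\mathbf{R}^{2^{n-1}}=\mathrm{span}\{k_{n1},\dots,k_{n2^{n-1}}\}\subset\mathcal{V}^b(\Lambda)$ is invariant under $\mathcal{L}_n$, and components of a vector are taken with respect to this basis. *)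

theory Defs
  imports "HOL-Analysis.Analysis"
begin

section \<open>The fixed point of the period doubling operator\<close>

text \<open>The fixed point is a function on $I = [-1,1]$, represented by a total function of type
  \<open>real \<Rightarrow> real\<close> whose values outside $I$ are irrelevant. Its derivative on $I$ is therefore taken
  within $I$ (one-sided at the end points).\<close>

definition derivI :: "(real \<Rightarrow> real) \<Rightarrow> real \<Rightarrow> real" where
  "derivI f x = vector_derivative f (at x within {-1..1})"

definition scal :: "(real \<Rightarrow> real) \<Rightarrow> real" where
  "scal g = - 1 / g 1"

text \<open>\<open>G\<close> is the analytic extension of \<open>g\<close> to \<open>U\<close> together with its continuous extension
  to the boundary of \<open>U\<close>.\<close>

definition period_doubling_fixed_point ::
  "(real \<Rightarrow> real) \<Rightarrow> (complex \<Rightarrow> complex) \<Rightarrow> complex set \<Rightarrow> bool" where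
  "period_doubling_fixed_point g G U \<longleftrightarrow>
     open U \<and> connected U \<and> of_real ` {-1..1::real} \<subseteq> U \<and>
     G holomorphic_on U \<and> continuous_on (closure U) G \<and>
     (\<forall>x\<in>{-1..1}. G (of_real x) = of_real (g x)) \<and>
     g ` {-1..1} \<subseteq> {-1..1} \<and>
     (\<forall>x\<in>{-1..1}. g (- x) = g x) \<and>
     (\<forall>x\<in>{-1..1}. derivI g x = 0 \<longleftrightarrow> x = 0) \<and> derivI (derivI g) 0 \<noteq> 0 \<and>
     g 0 = 1 \<and>
     (g ^^ 3) 0 > - (g ^^ 2) 0 \<and> - (g ^^ 2) 0 > (g ^^ 4) 0 \<and> (g ^^ 4) 0 > 0 \<and> 0 > (g ^^ 2) 0 \<and>
     (\<forall>x\<in>{-1..1}. g x = - scal g * g (g (- (x / scal g))))"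


section \<open>The induced expanding map\<close>

definition intJ :: "(real \<Rightarrow> real) \<Rightarrow> real set" where
  "intJ g = {g 1..1}"

definition intJ0 :: "(real \<Rightarrow> real) \<Rightarrow> real set" where
  "intJ0 g = {g 1..(g ^^ 3) 1}"

definition intJ1 :: "(real \<Rightarrow> real) \<Rightarrow> real set" where
  "intJ1 g = {(g ^^ 2) 1..1}"

text \<open>The map $\sigma$ is only meaningful on $J_0 \cup J_1$; everything below refers to this domain
  explicitly.\<close>

definition sigma :: "(real \<Rightarrow> real) \<Rightarrow> real \<Rightarrow> real" where
  "sigma g x = (if x \<in> intJ0 g then - scal g * x else - scal g * g x)"

definition phi :: "(real \<Rightarrow> real) \<Rightarrow> real \<Rightarrow> real" where
  "phi g y = vector_derivative (sigma g) (at y within (intJ0 g \<union> intJ1 g))"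

definition Lam :: "(real \<Rightarrow> real) \<Rightarrow> real set" where
  "Lam g = {x. \<forall>n. (sigma g ^^ n) x \<in> intJ0 g \<union> intJ1 g}"

text \<open>Expanding in the usual (local) metric sense; on a compact interval and for a $C^1$ map this says
  that the derivative is bounded below in modulus by a constant greater than one.\<close>

definition expanding_on :: "'a::metric_space set \<Rightarrow> ('a \<Rightarrow> 'a) \<Rightarrow> bool" where
  "expanding_on S f \<longleftrightarrow>
     (\<exists>\<nu>>1. \<exists>\<epsilon>>0. \<forall>x\<in>S. \<forall>y\<in>S. dist x y < \<epsilon> \<longrightarrow> \<nu> * dist x y \<le> dist (f x) (f y))"

text \<open>One branch of the expanding analytic extension of $\sigma$: \<open>\<Omega>'\<close> is a subdomain of \<open>\<Omega>\<close>
  containing the real interval \<open>J'\<close>, and \<open>S\<close> maps it bijectively onto \<open>\<Omega>\<close>.\<close>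

definition expanding_branch ::
  "(real \<Rightarrow> real) \<Rightarrow> real set \<Rightarrow> complex set \<Rightarrow> complex set \<Rightarrow> (complex \<Rightarrow> complex) \<Rightarrow> bool" where
  "expanding_branch g J' \<Omega> \<Omega>' S \<longleftrightarrow>
     open \<Omega>' \<and> connected \<Omega>' \<and> of_real ` J' \<subseteq> \<Omega>' \<and> \<Omega>' \<subseteq> \<Omega> \<and>
     S holomorphic_on \<Omega>' \<and> (\<forall>x\<in>J'. S (of_real x) = of_real (sigma g x)) \<and>
     bij_betw S \<Omega>' \<Omega> \<and> expanding_on \<Omega>' S \<and>
     (\<exists>F. continuous_on (closure \<Omega>') F \<and> (\<forall>z\<in>\<Omega>'. F z = S z))"

definition expanding_extension ::
  "(real \<Rightarrow> real) \<Rightarrow> complex set \<Rightarrow> complex set \<Rightarrow> complex set \<Rightarrow> (complex \<Rightarrow> complex) \<Rightarrow> bool" where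
  "expanding_extension g \<Omega> \<Omega>0 \<Omega>1 S \<longleftrightarrow>
     \<Omega>0 \<inter> \<Omega>1 = {} \<and>
     expanding_branch g (intJ0 g) \<Omega> \<Omega>0 S \<and> expanding_branch g (intJ1 g) \<Omega> \<Omega>1 S"


section \<open>Function spaces, transfer operators and eigenvectors\<close>

text \<open>A function on a set $X$ of reals is represented by any total function with the right values
  on $X$. The three spaces below only constrain values on the relevant set, and nonvanishing and
  the eigenvalue equation are likewise required on that set only. The identity lies in
  \<open>V_analytic X \<Omega>\<close>, so the supremum norm over \<open>\<Omega>\<close> is finite on that space iff \<open>\<Omega>\<close> is bounded; in
  that case it is a Banach space for \<open>X\<close> infinite and compact and \<open>\<Omega>\<close> a domain containing \<open>X\<close>.\<close>

definition V_bounded :: "real set \<Rightarrow> (real \<Rightarrow> real) set" where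
  "V_bounded X = {v. bounded (v ` X)}"

definition V_lipschitz :: "real set \<Rightarrow> (real \<Rightarrow> real) set" where
  "V_lipschitz X = {v. \<exists>C. C-lipschitz_on X v}"

definition V_analytic :: "real set \<Rightarrow> complex set \<Rightarrow> (real \<Rightarrow> real) set" where
  "V_analytic X \<Omega> = {v. \<exists>F. F holomorphic_on \<Omega> \<and> continuous_on (closure \<Omega>) F \<and>
                            (\<forall>x\<in>X. F (of_real x) = of_real (v x))}"

definition transfer_op ::
  "(real \<Rightarrow> real) \<Rightarrow> (real \<Rightarrow> real) \<Rightarrow> (real \<Rightarrow> real) \<Rightarrow> real \<Rightarrow> real" where
  "transfer_op g w v x = (\<Sum>y\<in>{y \<in> intJ0 g \<union> intJ1 g. sigma g y = x}. w y * v y)"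

definition is_eigenvector ::
  "real set \<Rightarrow> (real \<Rightarrow> real) set \<Rightarrow> ((real \<Rightarrow> real) \<Rightarrow> real \<Rightarrow> real) \<Rightarrow> real \<Rightarrow> (real \<Rightarrow> real) \<Rightarrow> bool" where
  "is_eigenvector X V L \<mu> v \<longleftrightarrow>
     v \<in> V \<and> (\<exists>x\<in>X. v x \<noteq> 0) \<and> (\<forall>x\<in>X. L v x = \<mu> * v x)"

definition is_eigenvalue ::
  "real set \<Rightarrow> (real \<Rightarrow> real) set \<Rightarrow> ((real \<Rightarrow> real) \<Rightarrow> real \<Rightarrow> real) \<Rightarrow> real \<Rightarrow> bool" where
  "is_eigenvalue X V L \<mu> \<longleftrightarrow> (\<exists>v. is_eigenvector X V L \<mu> v)"


section \<open>The finite rank approximations\<close>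

definition level_set :: "(real \<Rightarrow> real) \<Rightarrow> nat \<Rightarrow> real set" where
  "level_set g n = {x. (\<forall>k<n. (sigma g ^^ k) x \<in> intJ0 g \<union> intJ1 g) \<and> (sigma g ^^ n) x \<in> intJ g}"

text \<open>The pairwise disjoint closed intervals making up $\sigma^{-n}(J)$ are its connected
  components; \<open>level_interval g n k\<close> is the \<open>k\<close>-th one from the left, counting from 1.\<close>

definition level_interval :: "(real \<Rightarrow> real) \<Rightarrow> nat \<Rightarrow> nat \<Rightarrow> real set" where
  "level_interval g n k =
     (THE C. C \<in> components (level_set g n) \<and>
             card {C' \<in> components (level_set g n). Inf C' \<le> Inf C} = k)"

definition beta :: "(real \<Rightarrow> real) \<Rightarrow> nat \<Rightarrow> nat \<Rightarrow> real" where
  "beta g n i = \<bar>derivI g (Sup (level_interval g n (2 ^ (n - 1) + i)))\<bar>"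

definition phi_n :: "(real \<Rightarrow> real) \<Rightarrow> nat \<Rightarrow> real \<Rightarrow> real" where
  "phi_n g n y = - scal g * indicator (intJ0 g) y +
     (\<Sum>i=1..2 ^ (n - 1). scal g * beta g n i * indicator (level_interval g n (2 ^ (n - 1) + i)) y)"

definition k_vec :: "(real \<Rightarrow> real) \<Rightarrow> nat \<Rightarrow> nat \<Rightarrow> real \<Rightarrow> real" where
  "k_vec g n i = indicator ((level_interval g n (2 * i - 1) \<union> level_interval g n (2 * i)) \<inter> Lam g)"

text \<open>Membership in the span of \<open>k_vec g n 1, \<dots>, k_vec g n (2 ^ (n - 1))\<close> with all components
  positive.\<close>

definition positive_step_vector :: "(real \<Rightarrow> real) \<Rightarrow> nat \<Rightarrow> (real \<Rightarrow> real) \<Rightarrow> bool" where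
  "positive_step_vector g n v \<longleftrightarrow>
     (\<exists>c :: nat \<Rightarrow> real. (\<forall>i\<in>{1..2 ^ (n - 1)}. c i > 0) \<and>
        (\<forall>x\<in>Lam g. v x = (\<Sum>i=1..2 ^ (n - 1). c i * k_vec g n i x)))"

end

theory Submission
  imports Defs "HOL-Complex_Analysis.Complex_Analysis"
begin

text \<open>Write \<open>t = 1 / \<alpha>\<close>. Comparing second derivatives at \<open>0\<close> in the functional equation gives
  \<open>g' 1 = - \<alpha>\<close>, so the weight of the transfer operators at the fixed point \<open>1\<close> of \<open>\<sigma>\<close> is
  \<open>\<alpha>\<^sup>2\<close>. By concavity the weight is increasing on \<open>J\<^sub>1\<close> and there exceeds \<open>\<alpha>\<close>, the modulus of the
  weight on \<open>J\<^sub>0\<close>. Hence the finite rank operators preserve the cone of nonnegative increasing vectors.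
  A Perron--Frobenius argument gives an eigenvector in this cone, and evaluation at \<open>1\<close> shows that its
  eigenvalue is at least \<open>\<alpha>\<^sup>2 - \<alpha>\<close>. Concavity also forces \<open>\<alpha> > 2\<close>, so this number exceeds \<open>2\<close>.

  The bound \<open>2\<close> is what matters: along each of the two inverse branches, weight times length is
  preserved up to a distortion that tends to \<open>0\<close>, so oscillation relative to length grows at most by
  a factor close to \<open>2\<close> under the operator and decays after division by the eigenvalue. This yields bounds
  for the step eigenvectors that are uniform in \<open>n\<close>, hence a uniform limit \<open>w\<close> on the Cantor set. The same
  estimate in the complex domain shows that \<open>\<mu>\<^sup>-\<^sup>N \<Sum> \<phi>\<^sub>N(\<iota> z) w(\<iota> 1)\<close>, summed over the inverse branches
  \<open>\<iota>\<close> of \<open>\<sigma>\<^sup>N\<close>, with \<open>\<phi>\<^sub>N\<close> the product of the weights along an orbit, converges uniformly on the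
  closure of \<open>\<Omega>\<close>. The limit is analytic and extends \<open>w\<close>, which makes it an eigenfunction by the identity
  theorem and makes \<open>w\<close> Lipschitz.\<close>

section \<open>Preliminaries\<close>

text \<open>The two weights have opposite signs, so the operators do not preserve nonnegative
  functions. Monotonicity repairs this: the branch with negative weight reverses orientation, so
  along it an increasing vector is read in decreasing order, and subtracting a decreasing vector
  preserves monotonicity. An eigenvalue above 1 is all that is claimed, but it would not carry the
  limit passage. An inverse branch contracts by the reciprocal of the modulus of its weight, so in
  Lipschitz-type oscillation each of the two branches contributes a factor of about one, however
  strong the expansion is. Only an eigenvalue above 2 beats their sum, and
  \<open>\<alpha>\<^sup>2 - \<alpha> > 2\<close> is equivalent to \<open>\<alpha> > 2\<close> for
  positive \<alpha>. No uniqueness of eigenvectors is established, whence the subsequence. The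
  uniform limit lives on a Cantor set and cannot be evaluated at complex points; freezing its values
  at real base points keeps the iterates analytic.\<close>

lemma has_real_derivative_of_holomorphic:
  assumes "f holomorphic_on U" "open U" "complex_of_real x \<in> U"
  shows "((\<lambda>x. Re (f (of_real x))) has_real_derivative Re (deriv f (of_real x))) (at x)"
proof -
  have "(f has_field_derivative deriv f (of_real x)) (at (of_real x))"
    using holomorphic_derivI[OF assms] .
  then have "((\<lambda>x. f (of_real x)) has_vector_derivative deriv f (of_real x)) (at x)"
    by (rule has_vector_derivative_real_field)
  then have "((\<lambda>x. Re (f (of_real x))) has_vector_derivative Re (deriv f (of_real x))) (at x)"
    by (auto simp: has_vector_derivative_complex_iff has_real_derivative_iff_has_vector_derivative)
  then show ?thesis
    by (simp add: has_real_derivative_iff_has_vector_derivative)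
qed

text \<open>An interval accumulates at its right end point, so the identity theorem applies. Facts
  about \<open>g\<close> and \<sigma> are known on real intervals only; this carries them to complex
  domains.\<close>

lemma identity_on_interval:
  assumes "f holomorphic_on A" "h holomorphic_on A" "open A" "connected A" 
    "of_real ` {p..q::real} \<subseteq> A" "p < q" "\<And>x. x \<in> {p..q} \<Longrightarrow> f (of_real x) = h (of_real x)" "z \<in> A"
  shows "f z = h z"
proof -
  have lim: "(of_real q :: complex) islimpt of_real ` {p..q}"
    unfolding islimpt_approachable
  proof (intro allI impI)
    fix e :: real assume e: "0 < e"
    define x where "x = max p (q - e / 2)"
    have x: "p \<le> x" "x < q" "q - x < e" using assms(6) e by (auto simp: x_def)
    have "dist (of_real x) (of_real q :: complex) < e"
      using x by (simp add: dist_of_real dist_real_def)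
    then show "\<exists>x'\<in>of_real ` {p..q}. x' \<noteq> (of_real q :: complex) \<and> dist x' (of_real q) < e"
      using x by (intro bexI[of _ "of_real x"]) auto
  qed
  have "f z - h z = 0"
  proof (rule analytic_continuation[OF holomorphic_on_diff[OF assms(1,2)] assms(3,4,5) _ lim _ assms(8)])
    show "of_real q \<in> A" using assms(5,6) by auto
  qed (use assms(7) in auto)
  then show ?thesis by simp
qed

text \<open>\<open>phi\<close> is a derivative within the disconnected set
  \<open>intJ0 g \<union> intJ1 g\<close>. Such a derivative is determined only at points that are
  not isolated in the set, which the nondegenerate interval containing \<open>y\<close>
  guarantees.\<close>

lemma vector_derivative_within_interval:
  fixes f :: "real \<Rightarrow> real"
  assumes "y \<in> {p..q}" "p < q" "{p..q} \<subseteq> X" "(f has_real_derivative D) (at y within X)"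
  shows "vector_derivative f (at y within X) = D"
proof (rule vector_derivative_within)
  have "at y within {p..q} \<noteq> bot"
    using assms by (simp add: trivial_limit_within connected_imp_perfect)
  moreover have "at y within {p..q} \<le> at y within X" by (rule at_le) fact
  ultimately show "at y within X \<noteq> bot" by (metis bot.extremum_unique)
qed (use assms in \<open>simp add: has_real_derivative_iff_has_vector_derivative\<close>)

lemma expanding_deriv_ge:
  fixes f :: "complex \<Rightarrow> complex"
  assumes "open A" "f holomorphic_on A" "z \<in> A" "\<epsilon> > 0"
    and "\<And>x y. x \<in> A \<Longrightarrow> y \<in> A \<Longrightarrow> dist x y < \<epsilon> \<Longrightarrow> \<nu> * dist x y \<le> dist (f x) (f y)"
  shows "\<nu> \<le> cmod (deriv f z)"
proof -
  have "((\<lambda>w. (f w - f z) / (w - z)) \<longlongrightarrow> deriv f z) (at z)"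
    using holomorphic_derivI[OF assms(2,1,3), of UNIV] by (simp add: has_field_derivative_iff)
  then have "((\<lambda>w. cmod ((f w - f z) / (w - z))) \<longlongrightarrow> cmod (deriv f z)) (at z)" by (rule tendsto_norm)
  moreover have "\<forall>\<^sub>F w in at z. \<nu> \<le> cmod ((f w - f z) / (w - z))"
  proof -
    have "\<forall>\<^sub>F w in at z. w \<in> A \<inter> ball z \<epsilon>" 
      using assms by (intro eventually_at_in_open') auto
    then show ?thesis using eventually_neq_at_within[of z z UNIV]
    proof eventually_elim
      case (elim w)
      then have "\<nu> * dist w z \<le> dist (f w) (f z)" using assms by (intro assms(5)) (auto simp: dist_commute)
      then show ?case using elim(2) by (simp add: norm_divide dist_norm pos_le_divide_eq)
    qed
  qed
  ultimately show ?thesis by (rule tendsto_lowerbound) simp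
qed

text \<open>Finiteness makes the union of the other members closed, so a connected set that contains
  \<open>C\<close> and met this union would be split by two disjoint closed sets.\<close>

lemma components_Union_disjoint_closed:
  fixes F :: "'a::topological_space set set"
  assumes "finite F" "disjoint F" and F: "\<And>C. C \<in> F \<Longrightarrow> closed C \<and> connected C \<and> C \<noteq> {}"
  shows "components (\<Union>F) = F"
proof -
  have comp: "C \<in> components (\<Union>F)" if C: "C \<in> F" for C
    unfolding in_components_maximal
  proof (intro conjI allI impI)
    fix D assume D: "D \<noteq> {} \<and> C \<subseteq> D \<and> D \<subseteq> \<Union>F \<and> connected D"
    have "C \<inter> D = {} \<or> \<Union>(F - {C}) \<inter> D = {}"
    proof (rule connected_closedD)
      show "C \<inter> \<Union>(F - {C}) \<inter> D = {}" using \<open>disjoint F\<close> C by (auto simp: disjoint_def)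
      show "closed (\<Union>(F - {C}))" using assms by (intro closed_Union) auto
    qed (use D C F in auto)
    then show "D = C" using D F[OF C] by blast
  qed (use C F in auto)
  moreover have "C \<in> F" if C: "C \<in> components (\<Union>F)" for C
  proof -
    obtain x where "x \<in> C" using in_components_nonempty[OF C] by blast
    moreover from this obtain C' where "C' \<in> F" "x \<in> C'" using in_components_subset[OF C] by blast
    ultimately show ?thesis using components_eq[OF C comp[of C']] by blast
  qed
  ultimately show ?thesis by blast
qed

section \<open>Positive eigenvectors in the cone of increasing vectors\<close>

definition increasing_cone :: "nat \<Rightarrow> (nat \<Rightarrow> real) \<Rightarrow> bool" where
  "increasing_cone N x \<longleftrightarrow> (\<forall>i\<in>{1..N}. 0 \<le> x i) \<and> (\<forall>i j. 1 \<le> i \<longrightarrow> i \<le> j \<longrightarrow> j \<le> N \<longrightarrow> x i \<le> x j)"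

lemma increasing_cone_add:
  "increasing_cone N x \<Longrightarrow> increasing_cone N y \<Longrightarrow> increasing_cone N (\<lambda>i. x i + y i)"
  by (auto simp: increasing_cone_def intro: add_mono)

lemma increasing_cone_scale:
  "increasing_cone N x \<Longrightarrow> 0 \<le> a \<Longrightarrow> increasing_cone N (\<lambda>i. a * x i)"
  by (auto simp: increasing_cone_def intro: mult_left_mono)

lemma increasing_cone_real: "increasing_cone N real"
  by (auto simp: increasing_cone_def)

lemma increasing_cone_le_top:
  "increasing_cone N x \<Longrightarrow> i \<in> {1..N} \<Longrightarrow> x i \<le> x N"
  by (auto simp: increasing_cone_def)

lemma increasing_cone_nonneg:
  "increasing_cone N x \<Longrightarrow> i \<in> {1..N} \<Longrightarrow> 0 \<le> x i"
  by (auto simp: increasing_cone_def)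

text \<open>The vector \<open>real\<close> rises by one at each step, while the total rise of
  \<open>x\<close> is at most \<open>x N\<close>. In the order of the cone, \<open>real\<close> thus
  dominates every element after scaling; it is the direction along which the operator is perturbed
  below.\<close>

lemma increasing_cone_dominated:
  assumes x: "increasing_cone N x"
  shows "increasing_cone N (\<lambda>i. x N * real i - x i)"
proof -
  have "0 \<le> x N * real i - x i" if i: "i \<in> {1..N}" for i
  proof -
    have N: "N \<in> {1..N}" using i by auto
    have "x N * 1 \<le> x N * real i" 
      using i increasing_cone_nonneg[OF x N] by (intro mult_left_mono) auto
    then show ?thesis using increasing_cone_le_top[OF x i] by simp
  qed
  moreover have "x N * real i - x i \<le> x N * real j - x j" if i: "1 \<le> i" "i \<le> j" "j \<le> N" for i j
  proof (cases "i = j")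
    case False
    have N: "N \<in> {1..N}" using i by auto
    have "x N * 1 \<le> x N * (real j - real i)" 
      using i False increasing_cone_nonneg[OF x N] by (intro mult_left_mono) auto
    moreover have "x j \<le> x N" "0 \<le> x i"
      using increasing_cone_le_top[OF x, of j] increasing_cone_nonneg[OF x, of i] i by auto
    ultimately show ?thesis by (simp add: algebra_simps)
  qed simp
  ultimately show ?thesis by (auto simp: increasing_cone_def)
qed

lemma increasing_cone_limit:
  assumes "\<And>k. increasing_cone N (X k)" "\<And>i. i \<in> {1..N} \<Longrightarrow> (\<lambda>k. X k i) \<longlonglongrightarrow> x i"
  shows "increasing_cone N x"
  unfolding increasing_cone_def
proof (intro conjI allI impI ballI)
  fix i assume "i \<in> {1..N}"
  then show "0 \<le> x i"
    using assms by (intro LIMSEQ_le_const[OF assms(2)]) (auto simp: increasing_cone_def)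
next
  fix i j assume "1 \<le> i" "i \<le> j" "j \<le> N"
  then show "x i \<le> x j"
    using assms(1) by (intro LIMSEQ_le[OF assms(2) assms(2)]) (auto simp: increasing_cone_def)
qed

text \<open>The rank-one perturbation maps every nonzero element of the cone into its interior, which makes
  the supremum of the Collatz--Wielandt numbers an eigenvalue.\<close>

lemma perturbed_cone_eigenvector:
  fixes A :: "nat \<Rightarrow> nat \<Rightarrow> real" and N :: nat
  defines "T \<equiv> \<lambda>x j. \<Sum>i=1..N. A j i * x i"
  assumes N: "N \<ge> 1" and pos: "\<And>x. increasing_cone N x \<Longrightarrow> increasing_cone N (T x)"
    and e: "e > 0"
  shows "\<exists>\<rho> x. increasing_cone N x \<and> x N = 1 \<and> 0 \<le> \<rho> \<and> \<rho> \<le> (\<Sum>i=1..N. \<bar>A N i\<bar>) + e * real N \<and>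
    (\<forall>j\<in>{1..N}. T x j + e * real j = \<rho> * x j)"
proof -
  have T_lin: "T (\<lambda>i. a * x i + c * y i) j = a * T x j + c * T y j" for a c x y j
    by (simp add: T_def sum_distrib_left flip: sum.distrib) (simp add: algebra_simps)
  have T_lim: "(\<lambda>k. T (X k) j) \<longlonglongrightarrow> T x j" if "\<And>i. i \<in> {1..N} \<Longrightarrow> (\<lambda>k. X k i) \<longlonglongrightarrow> x i" for X x j
    unfolding T_def by (intro tendsto_intros that)
  define B where "B = (\<Sum>i=1..N. \<bar>A N i\<bar>) + e * real N"
  \<comment> \<open>This bound stays bounded as \<open>e\<close> tends to 0, as the later
    compactness argument requires.\<close>
  have T_bound: "T x N + e * real N \<le> B" if x: "increasing_cone N x" "x N = 1" for x
  proof -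
    have "A N i * x i \<le> \<bar>A N i\<bar>" if "i \<in> {1..N}" for i
    proof -
      have "0 \<le> x i" "x i \<le> 1" using increasing_cone_le_top[OF x(1) that] increasing_cone_nonneg[OF x(1) that] x(2) by auto
      then have "\<bar>A N i * x i\<bar> \<le> \<bar>A N i\<bar> * 1" unfolding abs_mult by (intro mult_left_mono) auto
      then show ?thesis by linarith
    qed
    then show ?thesis by (auto simp: T_def B_def intro: sum_mono)
  qed
  \<comment> \<open>Because \<open>x N = 1\<close>, the summand \<open>e * real j\<close> is the
    rank-one map sending \<open>x\<close> to \<open>e * x N * real\<close>. The admissible
    \<open>s\<close> are the Collatz-Wielandt numbers of the perturbed operator.\<close>
  define P where "P s x \<longleftrightarrow> increasing_cone N x \<and> x N = 1 \<and> increasing_cone N (\<lambda>j. T x j + e * real j - s * x j)" for s x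
  define S where "S = {s. \<exists>x. P s x}"
  have P_le: "s \<le> B" if "P s x" for s x
  proof -
    have "0 \<le> T x N + e * real N - s * x N"
      using that N by (intro increasing_cone_nonneg[where x = "\<lambda>j. T x j + e * real j - s * x j"]) (auto simp: P_def)
    then show ?thesis using T_bound[of x] that by (auto simp: P_def)
  qed
  have one: "increasing_cone N (\<lambda>_. 1)" by (auto simp: increasing_cone_def)
  have "P 0 (\<lambda>_. 1)"
    using one e by (auto simp: P_def intro!: increasing_cone_add pos increasing_cone_scale increasing_cone_real)
  then have S0: "0 \<in> S" by (auto simp: S_def)
  have bdd: "bdd_above S" using P_le by (auto simp: S_def intro!: bdd_aboveI[of _ B])
  define \<rho> where "\<rho> = Sup S"
  have \<rho>0: "0 \<le> \<rho>" unfolding \<rho>_def by (rule cSup_upper[OF S0 bdd])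
  have \<rho>B: "\<rho> \<le> B" unfolding \<rho>_def using S0 P_le by (intro cSup_least) (auto simp: S_def)
  \<comment> \<open>The supremum is attained: near-maximisers are normalised, hence bounded in each
    coordinate, and the cone is closed.\<close>
  have "\<exists>s x. P s x \<and> \<rho> - 1 / real (Suc k) < s" for k
  proof -
    have "\<exists>s\<in>S. \<rho> - 1 / real (Suc k) < s"
      unfolding \<rho>_def using S0 by (intro less_cSupD) auto
    then show ?thesis by (auto simp: S_def)
  qed
  then obtain s X where PX: "\<And>k. P (s k) (X k)" and s: "\<And>k. \<rho> - 1 / real (Suc k) < s k" by metis
  have "s k \<le> \<rho>" for k unfolding \<rho>_def using PX by (intro cSup_upper[OF _ bdd]) (auto simp: S_def)
  moreover have "(\<lambda>k. \<rho> - 1 / real (Suc k)) \<longlonglongrightarrow> \<rho> - 0"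
    by (intro tendsto_intros LIMSEQ_inverse_real_of_nat[unfolded inverse_eq_divide])
  ultimately have s_lim: "s \<longlonglongrightarrow> \<rho>"
    using s by (intro tendsto_sandwich[of "\<lambda>k. \<rho> - 1 / real (Suc k)" s _ "\<lambda>_. \<rho>"]) (auto intro!: always_eventually less_imp_le)
  have "norm (X k i) \<le> 1" if "i \<in> {1..N}" for k i
    using increasing_cone_le_top[of N "X k" i] increasing_cone_nonneg[of N "X k" i] PX[of k] that by (auto simp: P_def)
  then obtain r where r: "strict_mono (r :: nat \<Rightarrow> nat)" "\<And>i. i \<in> {1..N} \<Longrightarrow> \<exists>l. (\<lambda>k. X (r k) i) \<longlonglongrightarrow> l"
    by (rule function_convergent_subsequence[of "{1..N}" X 1, rotated]) (auto simp: countable_finite)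
  then obtain x where x: "\<And>i. i \<in> {1..N} \<Longrightarrow> (\<lambda>k. X (r k) i) \<longlonglongrightarrow> x i" by metis
  have sr: "(\<lambda>k. s (r k)) \<longlonglongrightarrow> \<rho>" using LIMSEQ_subseq_LIMSEQ[OF s_lim r(1)] by (simp add: o_def)
  have Kx: "increasing_cone N x" 
    by (rule increasing_cone_limit[OF _ x]) (use PX in \<open>auto simp: P_def\<close>)
  have xN: "x N = 1" 
    using x[of N] N PX by (simp add: P_def LIMSEQ_const_iff)
  define y where "y = (\<lambda>j. T x j + e * real j)"
  define z where "z = (\<lambda>j. y j - \<rho> * x j)"
  have Kz: "increasing_cone N z"
    unfolding z_def y_def
    by (rule increasing_cone_limit[of N "\<lambda>k j. T (X (r k)) j + e * real j - s (r k) * X (r k) j"])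
       (use PX x in \<open>auto simp: P_def intro!: tendsto_intros T_lim sr\<close>)
  have Ky: "increasing_cone N y"
    unfolding y_def using e by (intro increasing_cone_add pos Kx increasing_cone_scale increasing_cone_real) auto
  have "z j = 0" if j: "j \<in> {1..N}" for j
  proof (rule ccontr)
    assume "z j \<noteq> 0"
    then have zN: "z N > 0" using increasing_cone_le_top[OF Kz j] increasing_cone_nonneg[OF Kz j] by simp
    have "0 \<le> T x N" using increasing_cone_nonneg[OF pos[OF Kx], of N] N by simp
    moreover have "0 < e * real N" using e N by simp
    ultimately have yN: "y N > 0" by (simp add: y_def)
    \<comment> \<open>A nonzero defect \<open>z\<close> makes \<rho> improvable. The test vector
      \<open>x'\<close> is the normalised image of \<open>x\<close> under the perturbed operator;
      its defect contains \<open>e * z N * real\<close>. With \<open>e * z N = \<eta> * y N\<close>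
      this absorbs \<open>\<eta> * y\<close> by \<open>increasing_cone_dominated\<close>.\<close>
    define \<eta> where "\<eta> = e * z N / y N"
    have \<eta>: "\<eta> > 0" using e zN yN by (simp add: \<eta>_def)
    define x' where "x' = (\<lambda>j. (1 / y N) * y j)"
    have Tx': "T x' i + e * real i - (\<rho> + \<eta>) * x' i = 1 / y N * (T z i + \<eta> * (y N * real i - y i))" for i
    proof -
      have "T y i = T (\<lambda>j. 1 * z j + \<rho> * x j) i" by (simp add: z_def)
      also have "\<dots> = T z i + \<rho> * T x i" unfolding T_lin by simp
      finally have Ty: "T y i = T z i + \<rho> * T x i" .
      have "T x' i = 1 / y N * T y i"
        using T_lin[of "1 / y N" y 0 y i] by (simp add: x'_def)
      then have "y N * (T x' i + e * real i - (\<rho> + \<eta>) * x' i) = T y i + e * y N * real i - (\<rho> + \<eta>) * y i"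
        using yN by (simp add: x'_def field_simps)
      also have "\<dots> = T z i + \<rho> * T x i + e * (z N + \<rho>) * real i - \<rho> * (T x i + e * real i) - \<eta> * y i"
        by (simp add: Ty z_def xN) (simp add: y_def algebra_simps)
      also have "\<dots> = T z i + (e * z N) * real i - \<eta> * y i" by (simp add: algebra_simps)
      also have "e * z N = \<eta> * y N" using yN by (simp add: \<eta>_def)
      finally show ?thesis using yN by (simp add: field_simps)
    qed
    have "P (\<rho> + \<eta>) x'"
      unfolding P_def Tx'
    proof (intro conjI)
      show "increasing_cone N x'" "x' N = 1"
        using increasing_cone_scale[OF Ky, of "1 / y N"] yN by (simp_all add: x'_def)
      show "increasing_cone N (\<lambda>i. 1 / y N * (T z i + \<eta> * (y N * real i - y i)))"
        using yN \<eta> by (intro increasing_cone_scale increasing_cone_add pos Kz increasing_cone_dominated Ky) auto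
    qed
    then have "\<rho> + \<eta> \<le> \<rho>" 
      unfolding \<rho>_def by (intro cSup_upper[OF _ bdd]) (auto simp: S_def \<rho>_def)
    with \<eta> show False by simp
  qed
  then have "\<forall>j\<in>{1..N}. T x j + e * real j = \<rho> * x j" by (auto simp: z_def y_def)
  with Kx xN \<rho>0 \<rho>B show ?thesis unfolding B_def by blast
qed

text \<open>The perturbation is removed by letting \<open>e k\<close> tend to 0. Eigenvalues and
  eigenvectors stay bounded, and the normalisation at the largest entry keeps the limit from
  vanishing.\<close>

theorem cone_eigenvector:
  fixes A :: "nat \<Rightarrow> nat \<Rightarrow> real" and N :: nat
  defines "T \<equiv> \<lambda>x j. \<Sum>i=1..N. A j i * x i"
  assumes N: "N \<ge> 1" and pos: "\<And>x. increasing_cone N x \<Longrightarrow> increasing_cone N (T x)"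
  obtains \<rho> x where "increasing_cone N x" "x N = 1" "\<And>j. j \<in> {1..N} \<Longrightarrow> T x j = \<rho> * x j"
proof -
  define e where "e k = 1 / real (Suc k)" for k
  have e: "e k > 0" "e k \<le> 1" for k by (auto simp: e_def)
  define B where "B = (\<Sum>i=1..N. \<bar>A N i\<bar>) + real N"
  have "\<forall>k. \<exists>\<rho> x. increasing_cone N x \<and> x N = 1 \<and> \<bar>\<rho>\<bar> \<le> B \<and> (\<forall>j\<in>{1..N}. T x j + e k * real j = \<rho> * x j)"
  proof
    fix k
    obtain \<rho> x where "increasing_cone N x" "x N = 1" "0 \<le> \<rho>" "\<rho> \<le> (\<Sum>i=1..N. \<bar>A N i\<bar>) + e k * real N"
      "\<forall>j\<in>{1..N}. T x j + e k * real j = \<rho> * x j"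
      using perturbed_cone_eigenvector[OF N pos[unfolded T_def] e(1)[of k]] unfolding T_def by blast
    moreover have "e k * real N \<le> 1 * real N" using e[of k] by (intro mult_right_mono) auto
    ultimately show "\<exists>\<rho> x. increasing_cone N x \<and> x N = 1 \<and> \<bar>\<rho>\<bar> \<le> B \<and> (\<forall>j\<in>{1..N}. T x j + e k * real j = \<rho> * x j)"
      unfolding B_def by (intro exI[of _ \<rho>] exI[of _ x]) auto
  qed
  from choice[OF this] obtain R where
    "\<forall>k. \<exists>x. increasing_cone N x \<and> x N = 1 \<and> \<bar>R k\<bar> \<le> B \<and> (\<forall>j\<in>{1..N}. T x j + e k * real j = R k * x j)" ..
  from choice[OF this] obtain X where
    "\<forall>k. increasing_cone N (X k) \<and> X k N = 1 \<and> \<bar>R k\<bar> \<le> B \<and> (\<forall>j\<in>{1..N}. T (X k) j + e k * real j = R k * X k j)" ..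
  then have X: "\<And>k. increasing_cone N (X k)" "\<And>k. X k N = 1" and R: "\<And>k. \<bar>R k\<bar> \<le> B" 
    and eig: "\<And>k j. j \<in> {1..N} \<Longrightarrow> T (X k) j + e k * real j = R k * X k j"
    by simp_all
  \<comment> \<open>Slot 0 is free and stores the eigenvalue, so that one subsequence serves
    eigenvalue and eigenvector.\<close>
  define Y where "Y k i = (if i = 0 then R k else X k i)" for k i
  have "norm (Y k i) \<le> B + 1" if "i \<in> {0..N}" for k i
  proof (cases "i = 0")
    case True
    then show ?thesis using R[of k] by (simp add: Y_def)
  next
    case False
    have "B \<ge> 0" using R[of k] by linarith
    then show ?thesis
      using increasing_cone_le_top[of N "X k" i] increasing_cone_nonneg[of N "X k" i] X[of k] that False by (auto simp: Y_def)
  qed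
  then obtain r where r: "strict_mono (r :: nat \<Rightarrow> nat)" "\<And>i. i \<in> {0..N} \<Longrightarrow> \<exists>l. (\<lambda>k. Y (r k) i) \<longlonglongrightarrow> l"
    by (rule function_convergent_subsequence[of "{0..N}" Y "B + 1", rotated]) (auto simp: countable_finite)
  then obtain x where x: "\<And>i. i \<in> {0..N} \<Longrightarrow> (\<lambda>k. Y (r k) i) \<longlonglongrightarrow> x i" by metis
  have R_lim: "(\<lambda>k. R (r k)) \<longlonglongrightarrow> x 0" using x[of 0] by (simp add: Y_def)
  have X_lim: "(\<lambda>k. X (r k) i) \<longlonglongrightarrow> x i" if "i \<in> {1..N}" for i using x[of i] that by (simp add: Y_def)
  have e0: "e \<longlonglongrightarrow> 0" unfolding e_def by (rule LIMSEQ_inverse_real_of_nat[unfolded inverse_eq_divide])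
  have e_lim: "(\<lambda>k. e (r k)) \<longlonglongrightarrow> 0" by (rule LIMSEQ_subseq_LIMSEQ[OF e0 r(1), unfolded o_def])
  have "increasing_cone N x" 
    by (rule increasing_cone_limit[of N "\<lambda>k. X (r k)", OF X(1) X_lim])
  moreover have "x N = 1" using X_lim[of N] N unfolding X(2) by (simp add: LIMSEQ_const_iff)
  moreover have "T x j = x 0 * x j" if j: "j \<in> {1..N}" for j
  proof -
    have "(\<lambda>k. T (X (r k)) j + e (r k) * real j) \<longlonglongrightarrow> T x j + 0 * real j"
      unfolding T_def by (intro tendsto_intros X_lim e_lim)
    then have "(\<lambda>k. R (r k) * X (r k) j) \<longlonglongrightarrow> T x j" by (simp add: eig[OF j])
    moreover have "(\<lambda>k. R (r k) * X (r k) j) \<longlonglongrightarrow> x 0 * x j"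
      by (intro tendsto_intros X_lim R_lim j)
    ultimately show ?thesis by (rule LIMSEQ_unique)
  qed
  ultimately show ?thesis by (rule that)
qed

section \<open>The real dynamics\<close>

subsection \<open>The fixed point\<close>

locale feigenbaum =
  fixes g :: "real \<Rightarrow> real" and G :: "complex \<Rightarrow> complex" and U :: "complex set"
  assumes fp: "period_doubling_fixed_point g G U" and conc: "concave_on {-1..1} g"
begin

text \<open>Since \<open>U\<close> is open, a derivative taken from \<open>G\<close> is
  differentiable on both sides of the end points of \<open>I\<close>. Here \<open>t\<close> is
  \<open>1 / \<alpha>\<close>, and \<open>b\<close> is both \<open>g t\<close> and the left end of
  \<open>J\<^sub>1\<close>.\<close>

definition dg :: "real \<Rightarrow> real" where "dg x = Re (deriv G (of_real x))"
definition t :: real where "t = - g 1"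
definition b :: real where "b = g (g 1)"

lemma open_U: "open U" and U_sub: "\<And>x. x \<in> {-1..1} \<Longrightarrow> of_real x \<in> U"
  and hol_G: "G holomorphic_on U" and G_eq: "\<And>x. x \<in> {-1..1} \<Longrightarrow> G (of_real x) = of_real (g x)"
  using fp unfolding period_doubling_fixed_point_def by blast+

lemma g_range: "x \<in> {-1..1} \<Longrightarrow> g x \<in> {-1..1}"
  and g_even: "x \<in> {-1..1} \<Longrightarrow> g (- x) = g x"
  and g_0: "g 0 = 1"
  using fp unfolding period_doubling_fixed_point_def by blast+

lemma orders: "t < b" "g b < t" "0 < g b" "0 < t"
proof -
  have 1: "(g ^^ 3) 0 = b" "(g ^^ 2) 0 = - t" "(g ^^ 4) 0 = g b"
    by (simp_all add: numeral_eq_Suc g_0 b_def t_def)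
  have "(g ^^ 3) 0 > - (g ^^ 2) 0 \<and> - (g ^^ 2) 0 > (g ^^ 4) 0 \<and> (g ^^ 4) 0 > 0 \<and> 0 > (g ^^ 2) 0"
    using fp unfolding period_doubling_fixed_point_def by blast
  then show "t < b" "g b < t" "0 < g b" "0 < t"
    unfolding 1 by auto
qed

lemma b_le_1: "b \<le> 1"
  using g_range[of 1] g_range[of "g 1"] by (auto simp: b_def)

lemma t_less_1: "t < 1" using orders b_le_1 by simp

lemma scal_eq: "scal g = 1 / t" by (simp add: scal_def t_def)

lemma scaled_in_I: "x \<in> {-1..1} \<Longrightarrow> t * x \<in> {-1..1}"
proof -
  assume x: "x \<in> {-1..1}"
  have "\<bar>t * x\<bar> \<le> 1 * 1" unfolding abs_mult
    using x t_less_1 orders(4) by (intro mult_mono) auto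
  then show ?thesis by (auto simp: abs_le_iff)
qed

lemma functional_eq: 
  assumes x: "x \<in> {-1..1}" shows "t * g x = - g (g (t * x))"
proof -
  have "g x = - scal g * g (g (- (x / scal g)))"
    using fp x unfolding period_doubling_fixed_point_def by blast
  also have "\<dots> = - (1 / t) * g (g (- (t * x)))" by (simp add: scal_eq mult.commute)
  also have "g (- (t * x)) = g (t * x)" using g_even scaled_in_I[OF x] by blast
  finally show ?thesis using orders(4) by (simp add: field_simps)
qed

lemma g_t: "g t = b" "g (- t) = b"
  using g_even[of t] t_less_1 orders by (auto simp: b_def t_def)

lemma g_b: "g b = t\<^sup>2"
proof -
  have "t * g 1 = - g b" using functional_eq[of 1] g_t by simp
  then show ?thesis by (simp add: t_def power2_eq_square)
qed

lemma has_dg: "x \<in> {-1..1} \<Longrightarrow> (g has_real_derivative dg x) (at x within {-1..1})"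
proof -
  assume x: "x \<in> {-1..1}"
  have "((\<lambda>x. Re (G (of_real x))) has_real_derivative dg x) (at x within {-1..1})"
    using has_real_derivative_of_holomorphic[OF hol_G open_U U_sub[OF x]]
    unfolding dg_def by (rule has_field_derivative_at_within)
  then show ?thesis
    by (rule has_field_derivative_transform_within[OF _ zero_less_one x]) (simp add: G_eq)
qed

lemma derivI_unique: 
  assumes "x \<in> {-1..1}" "(f has_real_derivative D) (at x within {-1..1})"
  shows "derivI f x = D"
  unfolding derivI_def
  using vector_derivative_within_cbox[of "-1" 1 x f D] assms
  by (simp add: has_real_derivative_iff_has_vector_derivative)

lemma derivI_g: "x \<in> {-1..1} \<Longrightarrow> derivI g x = dg x"
  by (simp add: derivI_unique has_dg)

lemma dg_eq_0_iff: 
  assumes "x \<in> {-1..1}" shows "dg x = 0 \<longleftrightarrow> x = 0"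
proof -
  have "derivI g x = 0 \<longleftrightarrow> x = 0"
    using fp assms unfolding period_doubling_fixed_point_def by blast
  then show ?thesis unfolding derivI_g[OF assms] .
qed

lemma has_ddg: "x \<in> {-1..1} \<Longrightarrow> (dg has_real_derivative Re (deriv (deriv G) (of_real x))) (at x)"
  using has_real_derivative_of_holomorphic[OF holomorphic_deriv[OF hol_G open_U] open_U U_sub]
  unfolding dg_def .

lemma ddg_0: "Re (deriv (deriv G) 0) \<noteq> 0"
proof -
  have "(derivI g has_real_derivative Re (deriv (deriv G) 0)) (at 0 within {-1..1})"
    by (rule has_field_derivative_transform_within[OF has_field_derivative_at_within[OF has_ddg[of 0, simplified]] zero_less_one])
      (auto simp: derivI_g)
  then have "derivI (derivI g) 0 = Re (deriv (deriv G) 0)"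
    by (intro derivI_unique) auto
  moreover have "derivI (derivI g) 0 \<noteq> 0"
    using fp unfolding period_doubling_fixed_point_def by blast
  ultimately show ?thesis by simp
qed

lemma cont_dg: "continuous_on {-1..1} dg"
  by (intro continuous_at_imp_continuous_on ballI DERIV_isCont[OF has_ddg])

lemma cont_g: "continuous_on {-1..1} g"
  by (rule DERIV_continuous_on[OF has_dg])

lemma dg_lipschitz: "\<exists>C>0. \<forall>x\<in>{-1..1}. \<forall>y\<in>{-1..1}. \<bar>dg x - dg y\<bar> \<le> C * \<bar>x - y\<bar>"
proof -
  have "continuous_on {-1..1::real} (\<lambda>x. deriv (deriv G) (of_real x))"
    by (rule continuous_on_compose2[of U]) (auto intro!: continuous_intros 
        holomorphic_on_imp_continuous_on holomorphic_deriv hol_G open_U U_sub)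
  then have "compact ((\<lambda>x. deriv (deriv G) (of_real x)) ` {-1..1::real})"
    by (intro compact_continuous_image) auto
  then obtain C where C: "C > 0" "\<And>x. x \<in> {-1..1::real} \<Longrightarrow> cmod (deriv (deriv G) (of_real x)) \<le> C"
    by (auto dest!: compact_imp_bounded simp: bounded_pos)
  have "\<bar>dg x - dg y\<bar> \<le> C * \<bar>x - y\<bar>" if "x \<in> {-1..1}" "y \<in> {-1..1}" for x y
  proof -
    have "norm (dg x - dg y) \<le> C * norm (x - y)"
      using that by (intro field_differentiable_bound[of "{-1..1}" dg "\<lambda>x. Re (deriv (deriv G) (of_real x))"])
       (auto intro!: has_field_derivative_at_within[OF has_ddg] order_trans[OF abs_Re_le_cmod C(2)])
    then show ?thesis by simp
  qed
  with C(1) show ?thesis by blast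
qed

section \<open>Consequences of concavity\<close>

lemma tangent: 
  assumes x: "x \<in> {-1..1}" and y: "y \<in> {-1..1}"
  shows "g y \<le> g x + dg x * (y - x)"
proof -
  have *: "g y \<le> g x + dg x * (y - x)" if x: "x \<in> {-1<..<1}" for x
  proof -
    have "(- g y) - (- g x) \<ge> (- dg x) * (y - x)"
      by (rule convex_on_imp_above_tangent[of "{-1..1}" "\<lambda>x. - g x" x y "- dg x"])
        (use x y conc in \<open>auto simp: concave_on_def intro!: derivative_eq_intros has_dg\<close>)
    then show ?thesis by (simp add: algebra_simps)
  qed
  \<comment> \<open>The end points are reached by continuity of \<open>dg\<close>; the tangent at 1
    enters the bound on \<open>t\<close>.\<close>
  have c: "closure {-1<..<1::real} = {-1..1}" by simp
  have "g y - g x - dg x * (y - x) \<le> 0"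
  proof (rule continuous_le_on_closure[where f = "\<lambda>x. g y - g x - dg x * (y - x)"])
    show "continuous_on (closure {-1<..<1}) (\<lambda>x. g y - g x - dg x * (y - x))"
      unfolding c by (intro continuous_intros cont_dg cont_g)
    show "x \<in> closure {-1<..<1}" unfolding c by (rule x)
  qed (use * in \<open>auto simp: algebra_simps\<close>)
  then show ?thesis by simp
qed

lemma dg_antimono: 
  assumes "x \<in> {-1..1}" "y \<in> {-1..1}" "x \<le> y" shows "dg y \<le> dg x"
proof (cases "x = y")
  case False
  have "(dg y - dg x) * (y - x) \<le> 0"
    using tangent[OF assms(1,2)] tangent[OF assms(2,1)] by (simp add: algebra_simps)
  with False assms(3) show ?thesis by (simp add: mult_le_0_iff)
qed simp

lemma dg_neg: "0 < x \<Longrightarrow> x \<le> 1 \<Longrightarrow> dg x < 0"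
  using dg_antimono[of 0 x] dg_eq_0_iff[of 0] dg_eq_0_iff[of x] by fastforce

lemma dg_functional: 
  assumes x: "x \<in> {-1<..<1}" 
  shows "dg x = - dg (g (t * x)) * dg (t * x)"
proof -
  have tx: "t * x \<in> {-1..1}" using scaled_in_I x by auto
  have "((\<lambda>y. t * y) has_real_derivative t) (at x within {-1..1})"
    by (auto intro!: derivative_eq_intros)
  then have 1: "((\<lambda>x. g (t * x)) has_real_derivative dg (t * x) * t) (at x within {-1..1})"
    by (rule DERIV_image_chain[rotated, unfolded o_def])
       (rule has_field_derivative_subset[OF has_dg[OF tx]], use scaled_in_I in auto)
  have 2: "((\<lambda>x. g (g (t * x))) has_real_derivative dg (g (t * x)) * (dg (t * x) * t)) (at x within {-1..1})"
    by (rule DERIV_image_chain[OF _ 1, unfolded o_def])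
       (rule has_field_derivative_subset[OF has_dg[OF g_range[OF tx]]], use scaled_in_I g_range in force)
  have "((\<lambda>x. - g (g (t * x)) / t) has_real_derivative - (dg (g (t * x)) * (dg (t * x) * t)) / t) (at x within {-1..1})"
    using 2 orders(4) by (auto intro!: derivative_eq_intros)
  then have "(g has_real_derivative - (dg (g (t * x)) * (dg (t * x) * t)) / t) (at x within {-1..1})"
    by (rule has_field_derivative_transform_within[OF _ zero_less_one]) (use x functional_eq orders(4) in \<open>auto simp: field_simps\<close>)
  from derivI_unique[OF _ this] derivI_g[of x] x orders(4) show ?thesis
    by auto
qed

text \<open>Comparing second derivatives at \<open>0\<close> in \<open>t * g x = - g (g (t * x))\<close>.\<close>

lemma dg_1: "dg 1 = - 1 / t"
proof -
  define c where "c = Re (deriv (deriv G) 0)"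
  have dg0: "dg 0 = 0" using dg_eq_0_iff[of 0] by simp
  have lim: "((\<lambda>h. dg h / h) \<longlongrightarrow> c) (at 0)"
    using has_ddg[of 0] by (simp add: DERIV_def dg0 c_def)
  have lim_t: "((\<lambda>h. dg (t * h) / (t * h)) \<longlongrightarrow> c) (at 0)"
  proof (rule filterlim_compose[OF lim])
    show "filterlim ((*) t) (at 0) (at 0)"
      using orders(4) by (auto simp: filterlim_at eventually_at_filter intro!: tendsto_eq_intros)
  qed
  have "((\<lambda>h. dg (g (t * h))) \<longlongrightarrow> dg (g (t * 0))) (at 0 within {-1..1})"
  proof -
    have "continuous_on {-1..1} (\<lambda>h. dg (g (t * h)))"
      using scaled_in_I g_range
      by (intro continuous_on_compose2[OF cont_dg] continuous_on_compose2[OF cont_g] continuous_intros) auto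
    then show ?thesis unfolding continuous_on_def by (rule bspec) simp
  qed
  then have lim1: "((\<lambda>h. dg (g (t * h))) \<longlongrightarrow> dg 1) (at 0)"
    by (simp add: g_0 at_within_Icc_at)
  have "((\<lambda>h. - dg (g (t * h)) * (dg (t * h) / (t * h)) * t) \<longlongrightarrow> - dg 1 * c * t) (at 0)"
    by (intro tendsto_intros lim1 lim_t)
  moreover have "\<forall>\<^sub>F h in at 0. - dg (g (t * h)) * (dg (t * h) / (t * h)) * t = dg h / h"
  proof -
    have "\<forall>\<^sub>F h in at (0::real). h \<in> {-1<..<1}" 
      by (rule eventually_at_in_open') auto
    then show ?thesis
      by eventually_elim (use orders(4) in \<open>auto simp: dg_functional\<close>)
  qed
  ultimately have "((\<lambda>h. dg h / h) \<longlongrightarrow> - dg 1 * c * t) (at 0)"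
    by (rule Lim_transform_eventually)
  with lim have "c = - dg 1 * c * t"
    by (rule tendsto_unique[OF at_neq_bot])
  then have "c * (1 + dg 1 * t) = 0" by (simp add: algebra_simps)
  moreover have "c \<noteq> 0" using ddg_0 by (simp add: c_def)
  ultimately have "dg 1 * t = - 1" by simp
  then show ?thesis using orders(4) by (simp add: field_simps)
qed

text \<open>At \<open>x = 1\<close> the differentiated functional equation reads
  \<open>dg b * dg t = 1 / t\<close>. As \<open>t < b\<close>, the factor \<open>dg b\<close> has
  the larger modulus, so its square is at least \<open>1 / t > 1\<close>. This makes the weight on
  \<open>J\<^sub>1\<close> exceed \<alpha>.\<close>

lemma dg_b_less: "dg b < -1"
proof -
  have c: "continuous_on {-1..1} (\<lambda>x. dg x + dg (g (t * x)) * dg (t * x))"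
    using scaled_in_I g_range
    by (intro continuous_intros continuous_on_compose2[OF cont_dg] continuous_on_compose2[OF cont_g]) auto
  have "dg 1 + dg (g (t * 1)) * dg (t * 1) = 0"
    by (rule continuous_constant_on_closure[of "{-1<..<1}" _ 0]) (use c dg_functional in auto)
  then have e: "dg b * dg t = 1 / t" by (simp add: g_t dg_1)
  have le: "dg b \<le> dg t" using orders b_le_1 by (intro dg_antimono) auto
  have neg: "dg t < 0" "dg b < 0" using orders b_le_1 dg_neg by auto
  have "dg b * dg t \<le> dg b * dg b" using le neg by (intro mult_left_mono_neg) auto
  with e have sq: "1 / t \<le> (dg b)\<^sup>2" by (simp add: power2_eq_square)
  have "1 < 1 / t" using orders t_less_1 by simp
  then have "1 < (dg b)\<^sup>2" using sq by simp
  then have "1 < \<bar>dg b\<bar>" using abs_square_le_1[of "dg b"] by linarith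
  then show "dg b < -1" using neg by simp
qed

text \<open>Concavity forces \<open>\<alpha> = 1 / t > 2\<close>; the golden-ratio bound obtained from the tangent at \<open>1\<close> alone
  would only give \<open>\<alpha>\<^sup>2 - \<alpha> \<ge> 1\<close>.\<close>

lemma t_less_half: "t < 1/2"
proof -
  define x where "x = b - t"
  define y where "y = 1 - b"
  have x: "x > 0" using orders by (simp add: x_def)
  have t: "0 < t" "t < 1" using orders t_less_1 by auto
  \<comment> \<open>The tangent at 1 has the known slope \<open>- 1 / t\<close>; evaluated at
    \<open>b\<close>, it bounds the length of \<open>J\<^sub>1\<close> from below.\<close>
  have y1: "t\<^sup>2 + t ^ 3 \<le> y"
  proof -
    have "t\<^sup>2 \<le> - t + y / t"
      using tangent[of 1 b] b_le_1 orders g_b dg_1 by (simp add: t_def y_def field_simps)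
    then have "t\<^sup>2 * t \<le> (- t + y / t) * t" using t by (intro mult_right_mono) auto
    also have "\<dots> = - (t * t) + y" using t by (simp add: field_simps)
    finally show ?thesis by (simp add: power2_eq_square power3_eq_cube)
  qed
  \<comment> \<open>The tangent at \<open>b\<close> is used twice, evaluated at 1 and at
    \<open>t\<close>; its unknown slope is then eliminated.\<close>
  have q1: "- dg b * y \<le> t + t\<^sup>2"
    using tangent[of b 1] b_le_1 orders g_b by (simp add: y_def t_def algebra_simps)
  have q2: "b - t\<^sup>2 \<le> - dg b * x"
    using tangent[of b t] b_le_1 orders g_b g_t by (simp add: x_def algebra_simps)
  have y0: "0 \<le> y" using y1 t by (auto intro: order_trans[rotated])
  have "(x + t - t\<^sup>2) * y \<le> (- dg b * x) * y"
    using q2 y0 by (intro mult_right_mono) (auto simp: x_def)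
  also have "\<dots> \<le> (t + t\<^sup>2) * x"
    using mult_right_mono[OF q1, of x] x by (simp add: algebra_simps)
  finally have 1: "(t - t\<^sup>2) * y \<le> (t + t\<^sup>2 - y) * x" by (simp add: algebra_simps)
  also have "\<dots> \<le> (t - t ^ 3) * x" using y1 x by (intro mult_right_mono) auto
  also have "\<dots> = (t - t\<^sup>2) * ((1 + t) * x)" by (simp add: algebra_simps power2_eq_square power3_eq_cube)
  finally have "y \<le> (1 + t) * x" 
    using t by (subst (asm) mult_le_cancel_left_pos) (auto simp: power2_eq_square)
  then have "(1 + t) * t\<^sup>2 \<le> (1 + t) * x" using y1 by (simp add: algebra_simps power2_eq_square power3_eq_cube)
  then have "t\<^sup>2 \<le> x" using t by simp
  moreover have "x + y = 1 - t" by (simp add: x_def y_def)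
  \<comment> \<open>The gap \<open>b - t\<close> is at least \<open>t\<^sup>2\<close> and
    \<open>1 - b\<close> at least \<open>t\<^sup>2 + t ^ 3\<close>. Together they fill
    \<open>1 - t\<close>, which is impossible from \<open>t = 1/2\<close> on.\<close>
  ultimately have key: "t + 2 * t\<^sup>2 + t ^ 3 \<le> 1" using y1 by linarith
  show ?thesis
  proof (rule ccontr)
    assume "\<not> ?thesis"
    then have "(1/2)\<^sup>2 \<le> t\<^sup>2" "t \<ge> 1/2" by (auto intro!: power_mono)
    then show False using key zero_less_power[OF t(1), of 3] by (simp add: power2_eq_square)
  qed
qed

subsection \<open>Inverse branches\<close>

text \<open>\<open>ph\<close> is the formula for the weight on \<open>J\<^sub>1\<close>, identified
  with \<open>phi\<close> in \<open>phi_J1\<close>; \<open>y1\<close> is the inverse of \<sigma>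
  onto \<open>J\<^sub>1\<close>.\<close>

definition ph :: "real \<Rightarrow> real" where "ph y = - dg y / t"
definition y1 :: "real \<Rightarrow> real" where "y1 x = inv_into {b..1} g (- t * x)"

lemma t_pos: "0 < t" and b_pos: "0 < b" and t_sq_less_b: "t\<^sup>2 < b" and t_sq_pos: "0 < t\<^sup>2"
  and b_less_1: "b < 1" and t_sq_less_t: "t\<^sup>2 < t" 
proof -
  show "0 < t" "0 < b" "t\<^sup>2 < b" "0 < t\<^sup>2" "t\<^sup>2 < t" using orders g_b by auto
  show "b < 1"
  proof (rule ccontr)
    assume "\<not> b < 1"
    then have "b = 1" using b_le_1 by simp
    then have "g b = - t" by (simp add: t_def)
    with orders show False by simp
  qed
qed

lemma intervals: "intJ g = {-t..1}" "intJ0 g = {-t..t\<^sup>2}" "intJ1 g = {b..1}"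
  by (simp_all add: intJ_def intJ0_def intJ1_def numeral_eq_Suc t_def[symmetric] b_def[symmetric])
    (simp_all add: t_def b_def[symmetric] g_b[unfolded t_def power2_eq_square])

lemma sigma_J0: "x \<in> {-t..t\<^sup>2} \<Longrightarrow> sigma g x = - x / t"
  and sigma_J1: "x \<in> {b..1} \<Longrightarrow> sigma g x = - g x / t"
  using t_sq_less_b by (auto simp: sigma_def scal_eq intervals)

lemma g_decreasing: "b \<le> x \<Longrightarrow> x < y \<Longrightarrow> y \<le> 1 \<Longrightarrow> \<exists>z\<in>{x..y}. g x - g y = - dg z * (y - x)"
proof -
  assume a: "b \<le> x" "x < y" "y \<le> 1"
  have "\<exists>z\<in>{x<..<y}. g y - g x = dg z * (y - x)"
  proof (rule mvt_simple[OF a(2)])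
    fix z assume "x \<le> z" "z \<le> y"
    then have z: "z \<in> {-1..1}" using a b_pos by auto
    have "(g has_real_derivative dg z) (at z within {x..y})"
      by (rule has_field_derivative_subset[OF has_dg[OF z]]) (use a b_pos in auto)
    then show "(g has_derivative (*) (dg z)) (at z within {x..y})"
      by (simp add: has_field_derivative_def)
  qed
  then obtain z where "z \<in> {x<..<y}" "g y - g x = dg z * (y - x)" by blast
  then show ?thesis by (intro bexI[of _ z]) (auto simp: algebra_simps)
qed

lemma dg_le_b: "b \<le> y \<Longrightarrow> y \<le> 1 \<Longrightarrow> dg y \<le> dg b"
  using b_pos b_le_1 by (intro dg_antimono) auto

lemma g_strict: "b \<le> x \<Longrightarrow> x < y \<Longrightarrow> y \<le> 1 \<Longrightarrow> g y < g x"
proof -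
  assume a: "b \<le> x" "x < y" "y \<le> 1"
  then obtain z where z: "z \<in> {x..y}" "g x - g y = - dg z * (y - x)" using g_decreasing by blast
  have "dg z < 0" using dg_le_b[of z] dg_b_less a z by auto
  then have "0 < - dg z * (y - x)" using a by (intro mult_pos_pos) auto
  then show ?thesis using z by simp
qed

lemma bij_g: "bij_betw g {b..1} {-t..t\<^sup>2}"
proof -
  have inj: "inj_on g {b..1}" using g_strict by (force intro!: linorder_inj_onI)
  have "g ` {b..1} = {-t..t\<^sup>2}"
  proof (intro equalityI subsetI)
    fix y assume "y \<in> g ` {b..1}"
    then obtain x where x: "b \<le> x" "x \<le> 1" "y = g x" by auto
    then show "y \<in> {-t..t\<^sup>2}"
      using g_strict[of b x] g_strict[of x 1] g_b by (cases "x = b"; cases "x = 1") (auto simp: t_def)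
  next
    fix y assume y: "y \<in> {-t..t\<^sup>2}"
    have "\<exists>x. b \<le> x \<and> x \<le> 1 \<and> g x = y"
      using y g_b b_le_1 b_pos
      by (intro IVT2' continuous_on_subset[OF cont_g]) (auto simp: t_def)
    then show "y \<in> g ` {b..1}" by auto
  qed
  with inj show ?thesis by (simp add: bij_betw_def)
qed

lemma scaled_J: "x \<in> {-t..1} \<Longrightarrow> - t * x \<in> {-t..t\<^sup>2}"
proof -
  assume "x \<in> {-t..1}"
  then have "t * x \<le> t * 1" "t * - t \<le> t * x" using t_pos by (intro mult_left_mono; simp)+
  then show ?thesis by (simp add: power2_eq_square minus_le_iff)
qed

lemma y1_in: "x \<in> {-t..1} \<Longrightarrow> y1 x \<in> {b..1}"
  and g_y1: "x \<in> {-t..1} \<Longrightarrow> g (y1 x) = - t * x"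
  using inv_into_into[of "-t*x" g "{b..1}"] f_inv_into_f[of "-t*x" g "{b..1}"] bij_g scaled_J
  by (simp_all add: y1_def bij_betw_def)

lemma y1_g: "y \<in> {b..1} \<Longrightarrow> y1 (- g y / t) = y"
  using t_pos bij_g by (simp add: y1_def bij_betw_def)

lemma sigma_y0: "x \<in> {-t..1} \<Longrightarrow> sigma g (- t * x) = x"
  using sigma_J0[OF scaled_J] t_pos by simp

lemma sigma_y1: "x \<in> {-t..1} \<Longrightarrow> sigma g (y1 x) = x"
  using sigma_J1[OF y1_in] g_y1 t_pos by simp

lemma preimages:
  assumes x: "x \<in> {-t..1}"
  shows "{y \<in> intJ0 g \<union> intJ1 g. sigma g y = x} = {- t * x, y1 x}"
proof (intro equalityI subsetI)
  fix y assume y: "y \<in> {y \<in> intJ0 g \<union> intJ1 g. sigma g y = x}"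
  then consider "y \<in> {-t..t\<^sup>2}" | "y \<in> {b..1}" by (auto simp: intervals)
  then show "y \<in> {- t * x, y1 x}"
  proof cases
    case 1 with y t_pos show ?thesis by (auto simp: sigma_J0)
  next
    case 2 with y y1_g[OF 2] show ?thesis by (auto simp: sigma_J1)
  qed
qed (use scaled_J[OF x] y1_in[OF x] sigma_y0[OF x] sigma_y1[OF x] in \<open>auto simp: intervals\<close>)

lemma transfer_op_eq:
  assumes x: "x \<in> {-t..1}"
  shows "transfer_op g w v x = w (- t * x) * v (- t * x) + w (y1 x) * v (y1 x)"
proof -
  have "- t * x \<noteq> y1 x" using scaled_J[OF x] y1_in[OF x] t_sq_less_b by auto
  then show ?thesis unfolding transfer_op_def preimages[OF x] by simp
qed

lemma y1_ends: "y1 1 = 1" "y1 (- t) = b"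
  using y1_g[of 1] y1_g[of b] b_le_1 t_pos g_b by (auto simp: t_def power2_eq_square)

lemma ph_mono: "b \<le> x \<Longrightarrow> x \<le> y \<Longrightarrow> y \<le> 1 \<Longrightarrow> ph x \<le> ph y"
  using dg_antimono[of x y] b_pos t_pos by (simp add: ph_def divide_right_mono)

lemma ph_1: "ph 1 = 1 / t\<^sup>2" by (simp add: ph_def dg_1 power2_eq_square)

lemma ph_b: "1 / t < ph b"
  using divide_strict_right_mono[of 1 "- dg b" t] dg_b_less t_pos by (simp add: ph_def)

lemma ph_ge: "b \<le> y \<Longrightarrow> y \<le> 1 \<Longrightarrow> 1 / t < ph y"
  using ph_b ph_mono[of b y] by simp

lemma ph_le: "b \<le> y \<Longrightarrow> y \<le> 1 \<Longrightarrow> ph y \<le> 1 / t\<^sup>2"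
  using ph_1 ph_mono[of y 1] by simp

text \<open>The weight at some intermediate point times the length of the image gives back the
  length exactly. The distortion estimates compare other points with this one.\<close>

lemma y1_mvt:
  assumes "- t \<le> x" "x < x'" "x' \<le> 1"
  shows "y1 x < y1 x'" "\<exists>z\<in>{y1 x..y1 x'}. x' - x = ph z * (y1 x' - y1 x)"
proof -
  have in': "y1 x \<in> {b..1}" "y1 x' \<in> {b..1}" and g: "g (y1 x) = - t * x" "g (y1 x') = - t * x'" 
    using assms y1_in g_y1 by auto
  have lt: "t * x < t * x'" using assms t_pos by simp
  show *: "y1 x < y1 x'"
  proof (rule ccontr)
    assume "\<not> ?thesis"
    then consider "y1 x = y1 x'" | "y1 x' < y1 x" by linarith
    then show False
      using g_strict[of "y1 x'" "y1 x"] in' g lt by cases auto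
  qed
  obtain z where z: "z \<in> {y1 x..y1 x'}" "g (y1 x) - g (y1 x') = - dg z * (y1 x' - y1 x)"
    using g_decreasing[OF _ *] in' by auto
  then have "t * (x' - x) = - dg z * (y1 x' - y1 x)" using g by (simp add: algebra_simps)
  then have "x' - x = ph z * (y1 x' - y1 x)" using t_pos by (simp add: ph_def field_simps)
  with z show "\<exists>z\<in>{y1 x..y1 x'}. x' - x = ph z * (y1 x' - y1 x)" by blast
qed

lemma y1_mono: "- t \<le> x \<Longrightarrow> x \<le> x' \<Longrightarrow> x' \<le> 1 \<Longrightarrow> y1 x \<le> y1 x'"
  using y1_mvt(1)[of x x'] by (cases "x = x'") auto

text \<open>On \<open>J\<^sub>1\<close> the weight exceeds \<open>1 / t\<close>, so this branch
  contracts at least as strongly as multiplication by \<open>- t\<close>; one factor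
  \<open>t\<close> per level serves both.\<close>

lemma y1_contracts:
  assumes "- t \<le> x" "x \<le> x'" "x' \<le> 1"
  shows "y1 x' - y1 x \<le> t * (x' - x)"
proof (cases "x = x'")
  case False
  then have "x < x'" using assms by simp
  then obtain z where z: "z \<in> {y1 x..y1 x'}" "x' - x = ph z * (y1 x' - y1 x)" 
    and lt: "y1 x < y1 x'" using y1_mvt assms by blast
  have "1 / t < ph z" using z y1_in[of x] y1_in[of x'] assms by (intro ph_ge) auto
  then have "1 / t * (y1 x' - y1 x) \<le> x' - x" unfolding z using lt by (intro mult_right_mono) auto
  then show ?thesis using t_pos by (simp add: field_simps)
qed simp

lemma phi_J0:
  assumes y: "y \<in> {-t..t\<^sup>2}" shows "phi g y = - 1 / t"
  unfolding phi_def intervals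
proof (rule vector_derivative_within_interval[OF y])
  have "((\<lambda>x. - x / t) has_real_derivative - 1 / t) (at y within {-t..t\<^sup>2} \<union> {b..1})"
    using t_pos by (auto intro!: derivative_eq_intros)
  \<comment> \<open>\<open>b - t\<^sup>2\<close> is the gap between the two intervals: closer to
    \<open>y\<close> than that, only \<open>J\<^sub>0\<close> contributes points of the
    domain.\<close>
  then show "(sigma g has_real_derivative - 1 / t) (at y within {-t..t\<^sup>2} \<union> {b..1})"
    by (rule has_field_derivative_transform_within[where d = "b - t\<^sup>2"])
      (use y t_sq_less_b in \<open>auto simp: sigma_J0 dist_real_def\<close>)
  show "- t < t\<^sup>2" using t_pos t_sq_pos by linarith
qed auto

lemma phi_J1:
  assumes y: "y \<in> {b..1}" shows "phi g y = ph y"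
  unfolding phi_def intervals
proof (rule vector_derivative_within_interval[OF y])
  have "(g has_real_derivative dg y) (at y within {-t..t\<^sup>2} \<union> {b..1})"
    by (rule has_field_derivative_subset[OF has_dg])
      (use y b_pos t_less_1 b_less_1 t_sq_less_b in auto)
  then have "((\<lambda>x. - g x / t) has_real_derivative ph y) (at y within {-t..t\<^sup>2} \<union> {b..1})"
    using t_pos by (auto intro!: derivative_eq_intros simp: ph_def)
  then show "(sigma g has_real_derivative ph y) (at y within {-t..t\<^sup>2} \<union> {b..1})"
    by (rule has_field_derivative_transform_within[where d = "b - t\<^sup>2"])
      (use y t_sq_less_b in \<open>auto simp: sigma_J1 dist_real_def\<close>)
qed (use b_less_1 in auto)

lemma ph_lipschitz: "\<exists>C>0. \<forall>x\<in>{b..1}. \<forall>y\<in>{b..1}. \<bar>ph x - ph y\<bar> \<le> C * \<bar>x - y\<bar>"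
proof -
  obtain C where C: "C > 0" "\<forall>x\<in>{-1..1}. \<forall>y\<in>{-1..1}. \<bar>dg x - dg y\<bar> \<le> C * \<bar>x - y\<bar>"
    using dg_lipschitz by blast
  have "\<bar>ph x - ph y\<bar> \<le> C / t * \<bar>x - y\<bar>" if "x \<in> {b..1}" "y \<in> {b..1}" for x y
  proof -
    have "\<bar>dg x - dg y\<bar> \<le> C * \<bar>x - y\<bar>" using C(2) that b_pos by auto
    moreover have "ph x - ph y = - (dg x - dg y) / t" by (simp add: ph_def diff_divide_distrib)
    ultimately show ?thesis using t_pos by (simp add: abs_divide divide_right_mono)
  qed
  then show ?thesis using C(1) t_pos by (intro exI[of _ "C / t"]) auto
qed

subsection \<open>Cylinders\<close>

text \<open>The branch onto \<open>J\<^sub>0\<close> reverses orientation, so it carries the intervals of level \<open>n\<close> to level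
  \<open>n + 1\<close> in reverse order.\<close>

primrec ends :: "nat \<Rightarrow> nat \<Rightarrow> real \<times> real" where
  "ends 0 k = (- t, 1)"
| "ends (Suc n) k = (if k \<le> 2 ^ n
     then (- t * snd (ends n (2 ^ n + 1 - k)), - t * fst (ends n (2 ^ n + 1 - k)))
     else (y1 (fst (ends n (k - 2 ^ n))), y1 (snd (ends n (k - 2 ^ n)))))"

definition lo :: "nat \<Rightarrow> nat \<Rightarrow> real" where "lo n k = fst (ends n k)"
definition hi :: "nat \<Rightarrow> nat \<Rightarrow> real" where "hi n k = snd (ends n k)"
definition cyl :: "nat \<Rightarrow> nat \<Rightarrow> real set" where "cyl n k = {lo n k..hi n k}"

lemma ends_0: "lo 0 k = - t" "hi 0 k = 1"
  and ends_left: "k \<le> 2 ^ n \<Longrightarrow> lo (Suc n) k = - t * hi n (2 ^ n + 1 - k)"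
    "k \<le> 2 ^ n \<Longrightarrow> hi (Suc n) k = - t * lo n (2 ^ n + 1 - k)"
  and ends_right: "2 ^ n < k \<Longrightarrow> lo (Suc n) k = y1 (lo n (k - 2 ^ n))"
    "2 ^ n < k \<Longrightarrow> hi (Suc n) k = y1 (hi n (k - 2 ^ n))"
  by (simp_all add: lo_def hi_def)

lemma idx_left: "1 \<le> k \<Longrightarrow> k \<le> 2 ^ n \<Longrightarrow> (2::nat) ^ n + 1 - k \<in> {1..2 ^ n}"
  and idx_right: "(2::nat) ^ n < k \<Longrightarrow> k \<le> 2 ^ Suc n \<Longrightarrow> k - 2 ^ n \<in> {1..2 ^ n}"
  by auto

lemma ends_bounds: "k \<in> {1..2 ^ n} \<Longrightarrow> - t \<le> lo n k \<and> lo n k < hi n k \<and> hi n k \<le> 1"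
proof (induction n arbitrary: k)
  case 0
  then show ?case using t_pos by (simp add: ends_0)
next
  case (Suc n)
  show ?case
  proof (cases "k \<le> 2 ^ n")
    case True
    then have IH: "- t \<le> lo n (2 ^ n + 1 - k)" "lo n (2 ^ n + 1 - k) < hi n (2 ^ n + 1 - k)" "hi n (2 ^ n + 1 - k) \<le> 1"
      using Suc.IH[OF idx_left[OF _ True]] Suc.prems by auto
    then show ?thesis
      using True t_pos scaled_J[of "lo n (2 ^ n + 1 - k)"] scaled_J[of "hi n (2 ^ n + 1 - k)"] t_sq_less_t t_less_1
      by (auto simp: ends_left)
  next
    case False
    then have IH: "- t \<le> lo n (k - 2 ^ n)" "lo n (k - 2 ^ n) < hi n (k - 2 ^ n)" "hi n (k - 2 ^ n) \<le> 1"
      using Suc.IH[OF idx_right[of n k]] Suc.prems by auto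
    then show ?thesis
      using False t_pos y1_in[of "lo n (k - 2 ^ n)"] y1_in[of "hi n (k - 2 ^ n)"] b_pos y1_mvt(1)
      by (auto simp: ends_right)
  qed
qed

lemma cyl_subset: "k \<in> {1..2 ^ n} \<Longrightarrow> cyl n k \<subseteq> {-t..1}"
  using ends_bounds[of k n] by (auto simp: cyl_def)

lemma cyl_child_left: "k \<in> {1..2 ^ n} \<Longrightarrow> x \<in> cyl n k \<Longrightarrow> - t * x \<in> cyl (Suc n) (2 ^ n + 1 - k)"
  using t_pos by (auto simp: cyl_def ends_left)

lemma cyl_child_right: "k \<in> {1..2 ^ n} \<Longrightarrow> x \<in> cyl n k \<Longrightarrow> y1 x \<in> cyl (Suc n) (2 ^ n + k)"
  using ends_bounds[of k n] by (auto simp: cyl_def ends_right intro!: y1_mono)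

lemma cyl_left:
  assumes "1 \<le> k" "k \<le> 2 ^ n" "y \<in> cyl (Suc n) k"
  shows "y \<in> {-t..t\<^sup>2}" "sigma g y \<in> cyl n (2 ^ n + 1 - k)"
proof -
  have b: "- t \<le> lo n (2 ^ n + 1 - k)" "lo n (2 ^ n + 1 - k) < hi n (2 ^ n + 1 - k)" "hi n (2 ^ n + 1 - k) \<le> 1"
    using ends_bounds[OF idx_left[OF assms(1,2)]] by auto
  have y: "- t * hi n (2 ^ n + 1 - k) \<le> y" "y \<le> - t * lo n (2 ^ n + 1 - k)"
    using assms by (auto simp: cyl_def ends_left)
  show in0: "y \<in> {-t..t\<^sup>2}"
    using y scaled_J[of "lo n (2 ^ n + 1 - k)"] scaled_J[of "hi n (2 ^ n + 1 - k)"] b by auto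
  have "- y / t \<le> hi n (2 ^ n + 1 - k)" "lo n (2 ^ n + 1 - k) \<le> - y / t"
    using y t_pos by (simp_all only: pos_divide_le_eq pos_le_divide_eq) (simp_all add: algebra_simps)
  then show "sigma g y \<in> cyl n (2 ^ n + 1 - k)" by (simp add: sigma_J0[OF in0] cyl_def)
qed

lemma sigma_mono_J1: 
  assumes "x \<in> {b..1}" "y \<in> {b..1}" "x \<le> y" shows "sigma g x \<le> sigma g y"
  using g_strict[of x y] assms t_pos by (cases "x = y") (auto simp: sigma_J1 divide_right_mono)

lemma cyl_right:
  assumes "2 ^ n < k" "k \<le> 2 ^ Suc n" "y \<in> cyl (Suc n) k"
  shows "y \<in> {b..1}" "sigma g y \<in> cyl n (k - 2 ^ n)"
proof -
  define p where "p = lo n (k - 2 ^ n)"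
  define q where "q = hi n (k - 2 ^ n)"
  have pq: "p \<in> {-t..1}" "q \<in> {-t..1}"
    using ends_bounds[OF idx_right[OF assms(1,2)]] by (auto simp: p_def q_def)
  have y: "y1 p \<le> y" "y \<le> y1 q"
    using assms by (auto simp: cyl_def ends_right p_def q_def)
  show in1: "y \<in> {b..1}" using y y1_in[OF pq(1)] y1_in[OF pq(2)] by auto
  have "sigma g (y1 p) \<le> sigma g y" "sigma g y \<le> sigma g (y1 q)"
    using y y1_in[OF pq(1)] y1_in[OF pq(2)] in1 by (auto intro!: sigma_mono_J1)
  then show "sigma g y \<in> cyl n (k - 2 ^ n)"
    using sigma_y1 pq by (simp add: cyl_def p_def q_def)
qed

lemma cyl_ordered: "1 \<le> j \<Longrightarrow> j < k \<Longrightarrow> k \<le> 2 ^ n \<Longrightarrow> hi n j < lo n k"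
proof (induction n arbitrary: j k)
  case 0
  then show ?case by simp
next
  case (Suc n)
  consider "k \<le> 2 ^ n" | "j \<le> 2 ^ n" "2 ^ n < k" | "2 ^ n < j" by linarith
  then show ?case
  proof cases
    case 1
    then show ?thesis using Suc t_pos by (auto simp: ends_left)
  next
    case 2
    have "lo n (2 ^ n + 1 - j) \<in> {-t..1}" using ends_bounds[OF idx_left[of j n]] Suc.prems 2 by auto
    moreover have "lo n (k - 2 ^ n) \<in> {-t..1}" using ends_bounds[OF idx_right[of n k]] Suc.prems 2 by auto
    ultimately show ?thesis using 2 scaled_J y1_in t_sq_less_b by (fastforce simp: ends_left ends_right)
  next
    case 3
    have "- t \<le> hi n (j - 2 ^ n)" "lo n (k - 2 ^ n) \<le> 1" 
      using ends_bounds[OF idx_right[of n j]] ends_bounds[OF idx_right[of n k]] Suc.prems 3 by auto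
    then show ?thesis using 3 Suc.prems Suc.IH[of "j - 2 ^ n" "k - 2 ^ n"] by (auto simp: ends_right intro!: y1_mvt(1))
  qed
qed

lemma cyl_unique:
  assumes "j \<in> {1..2 ^ n}" "k \<in> {1..2 ^ n}" "x \<in> cyl n j" "x \<in> cyl n k"
  shows "j = k"
  using cyl_ordered[of j k n] cyl_ordered[of k j n] assms by (cases j k rule: linorder_cases) (auto simp: cyl_def)

text \<open>\<open>ends\<close> adds a branch at the outside, whereas refinement happens at the
  inside; hence an induction that transports the inclusion through the outer branch. Halving of
  indices commutes with the reversal on the left half and the shift on the right half.\<close>

lemma cyl_parent: "j \<in> {1..2 ^ Suc n} \<Longrightarrow> cyl (Suc n) j \<subseteq> cyl n ((j + 1) div 2)"
proof (induction n arbitrary: j)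
  case 0
  then show ?case using cyl_subset[of j 1] by (simp add: cyl_def ends_0)
next
  case (Suc n)
  show ?case
  proof (cases "j \<le> 2 ^ Suc n")
    case True
    have "cyl (Suc n) (2 ^ Suc n + 1 - j) \<subseteq> cyl n ((2 ^ Suc n + 1 - j + 1) div 2)"
      using Suc.prems True by (intro Suc.IH) auto
    moreover have "(2 ^ Suc n + 1 - j + 1) div 2 = 2 ^ n + 1 - (j + 1) div 2" 
      using Suc.prems True by auto
    moreover have "lo (Suc n) (2 ^ Suc n + 1 - j) < hi (Suc n) (2 ^ Suc n + 1 - j)"
      using ends_bounds[OF idx_left[OF _ True]] Suc.prems by auto
    ultimately have "lo n (2 ^ n + 1 - (j + 1) div 2) \<le> lo (Suc n) (2 ^ Suc n + 1 - j)" 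
      "hi (Suc n) (2 ^ Suc n + 1 - j) \<le> hi n (2 ^ n + 1 - (j + 1) div 2)"
      by (auto simp: cyl_def)
    then have "t * lo n (2 ^ n + 1 - (j + 1) div 2) \<le> t * lo (Suc n) (2 ^ Suc n + 1 - j)" 
      "t * hi (Suc n) (2 ^ Suc n + 1 - j) \<le> t * hi n (2 ^ n + 1 - (j + 1) div 2)"
      using t_pos by auto
    moreover have "(j + 1) div 2 \<le> 2 ^ n" using True by auto
    ultimately show ?thesis unfolding cyl_def ends_left[OF True] ends_left[OF \<open>(j + 1) div 2 \<le> 2 ^ n\<close>] by auto
  next
    case False
    have "cyl (Suc n) (j - 2 ^ Suc n) \<subseteq> cyl n ((j - 2 ^ Suc n + 1) div 2)"
      using Suc.prems False by (intro Suc.IH) auto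
    moreover have "(j - 2 ^ Suc n + 1) div 2 = (j + 1) div 2 - 2 ^ n" 
      using Suc.prems False by auto
    moreover have le: "- t \<le> lo (Suc n) (j - 2 ^ Suc n)" "lo (Suc n) (j - 2 ^ Suc n) < hi (Suc n) (j - 2 ^ Suc n)" "hi (Suc n) (j - 2 ^ Suc n) \<le> 1"
      using ends_bounds[OF idx_right[of "Suc n" j]] Suc.prems False by auto
    ultimately have le': "lo n ((j + 1) div 2 - 2 ^ n) \<le> lo (Suc n) (j - 2 ^ Suc n)" 
      "hi (Suc n) (j - 2 ^ Suc n) \<le> hi n ((j + 1) div 2 - 2 ^ n)"
      by (auto simp: cyl_def)
    have "- t \<le> lo n ((j + 1) div 2 - 2 ^ n)" "hi n ((j + 1) div 2 - 2 ^ n) \<le> 1"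
      using ends_bounds[OF idx_right[of n "(j + 1) div 2"]] Suc.prems False by auto
    then have "y1 (lo n ((j + 1) div 2 - 2 ^ n)) \<le> y1 (lo (Suc n) (j - 2 ^ Suc n))" 
      "y1 (hi (Suc n) (j - 2 ^ Suc n)) \<le> y1 (hi n ((j + 1) div 2 - 2 ^ n))"
      using le le' by (auto intro!: y1_mono)
    moreover have "2 ^ n < (j + 1) div 2" "2 ^ Suc n < j" using False by auto
    ultimately show ?thesis
      unfolding cyl_def ends_right[OF \<open>2 ^ Suc n < j\<close>] ends_right[OF \<open>2 ^ n < (j + 1) div 2\<close>] by auto
  qed
qed

section \<open>Connected components of the preimages of \<open>J\<close>\<close>

lemma level_set_0: "level_set g 0 = {-t..1}"
  by (auto simp: level_set_def intervals)

lemma level_set_Suc: "x \<in> level_set g (Suc n) \<longleftrightarrow> x \<in> {-t..t\<^sup>2} \<union> {b..1} \<and> sigma g x \<in> level_set g n"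
proof -
  have "(\<forall>k<Suc n. P k) \<longleftrightarrow> P 0 \<and> (\<forall>k<n. P (Suc k))" for P
    by (metis Suc_less_eq not0_implies_Suc zero_less_Suc)
  from this[of "\<lambda>k. (sigma g ^^ k) x \<in> {-t..t\<^sup>2} \<union> {b..1}"] show ?thesis 
    unfolding level_set_def intervals by (simp add: funpow_Suc_right del: funpow.simps(2))
qed

lemma level_set_eq: "level_set g n = (\<Union>k\<in>{1..2 ^ n}. cyl n k)"
proof (induction n)
  case 0
  then show ?case by (simp add: level_set_0 cyl_def ends_0)
next
  case (Suc n)
  show ?case
  proof (intro equalityI subsetI)
    fix x assume "x \<in> level_set g (Suc n)"
    then obtain k where x: "x \<in> {-t..t\<^sup>2} \<union> {b..1}" and k: "k \<in> {1..2 ^ n}" "sigma g x \<in> cyl n k"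
      by (auto simp: level_set_Suc Suc.IH)
    show "x \<in> (\<Union>k\<in>{1..2 ^ Suc n}. cyl (Suc n) k)"
    proof (cases "x \<in> {-t..t\<^sup>2}")
      case True
      then have "x = - t * sigma g x" using t_pos by (simp add: sigma_J0)
      then have "x \<in> cyl (Suc n) (2 ^ n + 1 - k)" using cyl_child_left[OF k] by simp
      moreover have "2 ^ n + 1 - k \<in> {1..2 ^ Suc n}" using k by auto
      ultimately show ?thesis by blast
    next
      case False
      then have "x \<in> {b..1}" using x by blast
      then have "x = y1 (sigma g x)" using y1_g[of x] by (simp add: sigma_J1)
      then have "x \<in> cyl (Suc n) (2 ^ n + k)" using cyl_child_right[OF k] by simp
      moreover have "2 ^ n + k \<in> {1..2 ^ Suc n}" using k by auto
      ultimately show ?thesis by blast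
    qed
  next
    fix x assume "x \<in> (\<Union>k\<in>{1..2 ^ Suc n}. cyl (Suc n) k)"
    then obtain k where k: "1 \<le> k" "k \<le> 2 ^ Suc n" "x \<in> cyl (Suc n) k" by auto
    show "x \<in> level_set g (Suc n)"
    proof (cases "k \<le> 2 ^ n")
      case True
      then have "2 ^ n + 1 - k \<in> {1..2 ^ n}" using k by auto
      with cyl_left[OF k(1) True k(3)] show ?thesis by (auto simp: level_set_Suc Suc.IH)
    next
      case False
      then have "k - 2 ^ n \<in> {1..2 ^ n}" using k by auto
      with False cyl_right[OF _ k(2,3)] show ?thesis by (auto simp: level_set_Suc Suc.IH)
    qed
  qed
qed

lemma components_level_set: "components (level_set g n) = cyl n ` {1..2 ^ n}"
  unfolding level_set_eq
proof (rule components_Union_disjoint_closed)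
  show "disjoint (cyl n ` {1..2 ^ n})"
    unfolding disjoint_def using cyl_unique by blast
  fix C assume "C \<in> cyl n ` {1..2 ^ n}"
  then obtain k where "k \<in> {1..2 ^ n}" "C = cyl n k" by blast
  then show "closed C \<and> connected C \<and> C \<noteq> {}"
    using ends_bounds[of k n] by (auto simp: cyl_def)
qed auto

lemma Inf_Sup_cyl: "k \<in> {1..2 ^ n} \<Longrightarrow> Inf (cyl n k) = lo n k" "k \<in> {1..2 ^ n} \<Longrightarrow> Sup (cyl n k) = hi n k"
  using ends_bounds[of k n] by (auto simp: cyl_def)

lemma lo_strict_mono: "j \<in> {1..2 ^ n} \<Longrightarrow> k \<in> {1..2 ^ n} \<Longrightarrow> lo n j \<le> lo n k \<longleftrightarrow> j \<le> k"
  using cyl_ordered[of j k n] cyl_ordered[of k j n] ends_bounds[of j n] ends_bounds[of k n]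
  by (cases j k rule: linorder_cases) auto

lemma inj_cyl: "inj_on (cyl n) {1..2 ^ n}"
proof (rule inj_onI)
  fix j k assume jk: "j \<in> {1..2 ^ n}" "k \<in> {1..2 ^ n}" "cyl n j = cyl n k"
  then have "lo n j \<in> cyl n j" using ends_bounds[OF jk(1)] by (simp add: cyl_def)
  then show "j = k" using cyl_unique[OF jk(1,2)] jk(3) by simp
qed

lemma level_interval_eq:
  assumes k: "k \<in> {1..2 ^ n}"
  shows "level_interval g n k = cyl n k"
proof -
  have card: "card {C' \<in> components (level_set g n). Inf C' \<le> Inf (cyl n j)} = j" if j: "j \<in> {1..2 ^ n}" for j
  proof -
    have "{C' \<in> components (level_set g n). Inf C' \<le> Inf (cyl n j)} = cyl n ` {1..j}"
      using j by (auto simp: components_level_set Inf_Sup_cyl lo_strict_mono)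
    moreover have "inj_on (cyl n) {1..j}" by (rule inj_on_subset[OF inj_cyl]) (use j in auto)
    ultimately show ?thesis by (simp add: card_image)
  qed
  show ?thesis
    unfolding level_interval_def
  proof (rule the_equality)
    show "cyl n k \<in> components (level_set g n) \<and> card {C' \<in> components (level_set g n). Inf C' \<le> Inf (cyl n k)} = k"
      using card[OF k] k by (auto simp: components_level_set)
  next
    fix C assume C: "C \<in> components (level_set g n) \<and> card {C' \<in> components (level_set g n). Inf C' \<le> Inf C} = k"
    then obtain j where "j \<in> {1..2 ^ n}" "C = cyl n j" by (auto simp: components_level_set)
    with C card[of j] show "C = cyl n k" by auto
  qed
qed

section \<open>The Cantor set and its coding by level intervals\<close>

lemma Lam_subset: "Lam g \<subseteq> {-t..1}"
proof
  fix x assume "x \<in> Lam g"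
  then have "(sigma g ^^ 0) x \<in> intJ0 g \<union> intJ1 g" unfolding Lam_def by blast
  then show "x \<in> {-t..1}" using t_sq_less_t t_less_1 t_pos b_pos by (auto simp: intervals)
qed

lemma Lam_sigma: "x \<in> Lam g \<longleftrightarrow> x \<in> {-t..t\<^sup>2} \<union> {b..1} \<and> sigma g x \<in> Lam g"
proof -
  have "(\<forall>n. P n) \<longleftrightarrow> P 0 \<and> (\<forall>n. P (Suc n))" for P :: "nat \<Rightarrow> bool" by (metis nat.exhaust)
  from this[of "\<lambda>n. (sigma g ^^ n) x \<in> {-t..t\<^sup>2} \<union> {b..1}"] show ?thesis 
    unfolding Lam_def intervals by (simp add: funpow_Suc_right del: funpow.simps(2))
qed

lemma Lam_y0: "x \<in> Lam g \<Longrightarrow> - t * x \<in> Lam g"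
  using Lam_subset scaled_J sigma_y0 by (subst Lam_sigma) auto

lemma Lam_y1: "x \<in> Lam g \<Longrightarrow> y1 x \<in> Lam g"
  using Lam_subset y1_in sigma_y1 by (subst Lam_sigma) auto

lemma one_in_Lam: "1 \<in> Lam g"
proof -
  have "sigma g 1 = 1" using sigma_J1[of 1] b_le_1 t_pos by (simp add: t_def)
  then have "(sigma g ^^ n) 1 = 1" for n by (induction n) auto
  then show ?thesis using b_le_1 by (auto simp: Lam_def intervals)
qed

lemma Lam_level_set: "Lam g \<subseteq> level_set g n"
proof
  show "x \<in> level_set g n" if "x \<in> Lam g" for x
    using that
  proof (induction n arbitrary: x)
    case 0 then show ?case using Lam_subset by (auto simp: level_set_0)
  next
    case (Suc n) then show ?case using Lam_sigma level_set_Suc by blast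
  qed
qed

lemma Lam_cyl: "x \<in> Lam g \<Longrightarrow> \<exists>k\<in>{1..2 ^ n}. x \<in> cyl n k"
  using Lam_level_set[of n] by (auto simp: level_set_eq)

text \<open>Every point of \<open>Lam g\<close> lies in an interval of each level, so none is in the
  gap between the two children of an interval. On the Cantor set the basis vectors of level
  \<open>n\<close> are thus indicators of intervals of level \<open>n - 1\<close>.\<close>

lemma k_vec_eq:
  assumes n: "n \<ge> 1" and i: "i \<in> {1..2 ^ (n - 1)}" and x: "x \<in> Lam g"
  shows "k_vec g n i x = indicator (cyl (n - 1) i) x"
proof -
  obtain m where m: "n = Suc m" using n by (cases n) auto
  have idx: "2 * i - 1 \<in> {1..2 ^ n}" "2 * i \<in> {1..2 ^ n}" using i by (auto simp: m)
  have "x \<in> cyl n (2 * i - 1) \<union> cyl n (2 * i) \<longleftrightarrow> x \<in> cyl m i"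
  proof
    assume "x \<in> cyl n (2 * i - 1) \<union> cyl n (2 * i)"
    moreover have "(2 * i - 1 + 1) div 2 = i" "(2 * i + 1) div 2 = i" using i by auto
    ultimately show "x \<in> cyl m i"
      using cyl_parent[of "2 * i - 1" m] cyl_parent[of "2 * i" m] idx by (auto simp: m simp del: power_Suc)
  next
    assume xi: "x \<in> cyl m i"
    obtain k where k: "k \<in> {1..2 ^ n}" "x \<in> cyl n k" using Lam_cyl[OF x] by blast
    then have "x \<in> cyl m ((k + 1) div 2)" using cyl_parent[of k m] by (auto simp: m)
    moreover have "(k + 1) div 2 \<in> {1..2 ^ m}" using k by (auto simp: m)
    ultimately have "(k + 1) div 2 = i" using cyl_unique xi i by (simp add: m)
    then have "k = 2 * i - 1 \<or> k = 2 * i" using k by presburger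
    then show "x \<in> cyl n (2 * i - 1) \<union> cyl n (2 * i)" using k by auto
  qed
  then show ?thesis
    using x level_interval_eq[OF idx(1)] level_interval_eq[OF idx(2)] by (auto simp: k_vec_def indicator_def m)
qed

lemma cyl_length: "k \<in> {1..2 ^ n} \<Longrightarrow> hi n k - lo n k \<le> t ^ n * (1 + t)"
proof (induction n arbitrary: k)
  case 0
  then show ?case by (simp add: ends_0)
next
  case (Suc n)
  show ?case
  proof (cases "k \<le> 2 ^ n")
    case True
    then have "hi n (2 ^ n + 1 - k) - lo n (2 ^ n + 1 - k) \<le> t ^ n * (1 + t)"
      using Suc.IH[OF idx_left[OF _ True]] Suc.prems by auto
    from mult_left_mono[OF this, of t] show ?thesis using True t_pos by (simp add: ends_left algebra_simps)
  next
    case False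
    then have IH: "hi n (k - 2 ^ n) - lo n (k - 2 ^ n) \<le> t ^ n * (1 + t)"
      and "- t \<le> lo n (k - 2 ^ n)" "lo n (k - 2 ^ n) \<le> hi n (k - 2 ^ n)" "hi n (k - 2 ^ n) \<le> 1"
      using Suc.IH[OF idx_right[of n k]] ends_bounds[OF idx_right[of n k]] Suc.prems by auto
    then have "hi (Suc n) k - lo (Suc n) k \<le> t * (hi n (k - 2 ^ n) - lo n (k - 2 ^ n))"
      using False y1_contracts by (simp add: ends_right)
    with mult_left_mono[OF IH, of t] show ?thesis using t_pos by (simp add: algebra_simps)
  qed
qed

subsection \<open>Eigenvectors of the finite rank approximations\<close>

lemma cyl_nested:
  assumes "M \<le> n" "j \<in> {1..2 ^ n}" "x \<in> cyl n j" "k \<in> {1..2 ^ M}" "x \<in> cyl M k"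
  shows "cyl n j \<subseteq> cyl M k"
  using assms
proof (induction n arbitrary: j rule: dec_induct)
  case base
  then show ?case using cyl_unique by blast
next
  case (step n)
  have "cyl (Suc n) j \<subseteq> cyl n ((j + 1) div 2)" using step.prems by (intro cyl_parent)
  moreover have "(j + 1) div 2 \<in> {1..2 ^ n}" using step.prems by auto
  ultimately show ?case using step.IH[of "(j + 1) div 2"] step.prems by blast
qed

lemma hi_last: "hi n (2 ^ n) = 1"
  by (induction n) (simp_all add: ends_0 ends_right y1_ends)

lemma J1_ends: "k \<in> {1..2 ^ n} \<Longrightarrow> hi (Suc n) (2 ^ n + k) \<in> {b..1}"
  using ends_bounds[of k n] y1_in[of "hi n k"] by (auto simp: ends_right)

lemma scal_beta:
  assumes n: "n \<ge> 1" and i: "i \<in> {1..2 ^ (n - 1)}"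
  shows "scal g * beta g n i = ph (hi n (2 ^ (n - 1) + i))"
proof -
  obtain m where m: "n = Suc m" using n by (cases n) auto
  have idx: "2 ^ m + i \<in> {1..2 ^ n}" using i by (auto simp: m)
  have h: "hi n (2 ^ m + i) \<in> {b..1}" using J1_ends[of i m] i by (simp add: m)
  then have "derivI g (hi n (2 ^ m + i)) = dg (hi n (2 ^ m + i))" using b_pos by (intro derivI_g) auto
  moreover have "dg (hi n (2 ^ m + i)) < 0" using h b_pos by (intro dg_neg) auto
  ultimately show ?thesis
    using level_interval_eq[OF idx] Inf_Sup_cyl(2)[OF idx] by (simp add: beta_def m scal_eq ph_def)
qed

lemma phi_n_J0:
  assumes n: "n \<ge> 1" and y: "y \<in> {-t..t\<^sup>2}"
  shows "phi_n g n y = - 1 / t"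
proof -
  obtain m where m: "n = Suc m" using n by (cases n) auto
  have "indicator (level_interval g n (2 ^ m + i)) y = (0::real)" if i: "i \<in> {1..2 ^ m}" for i
  proof -
    have idx: "2 ^ m + i \<in> {1..2 ^ n}" using i by (auto simp: m)
    have "y \<notin> cyl n (2 ^ m + i)"
      using cyl_right(1)[of m "2 ^ m + i" y] i y t_sq_less_b by (auto simp: m)
    then show ?thesis by (simp add: level_interval_eq[OF idx])
  qed
  then have "(\<Sum>i=1..2 ^ m. scal g * beta g n i * indicator (level_interval g n (2 ^ m + i)) y) = 0"
    by (intro sum.neutral) auto
  then show ?thesis using y by (simp add: phi_n_def m intervals scal_eq)
qed

lemma phi_n_J1:
  assumes n: "n \<ge> 1" and i: "i \<in> {1..2 ^ (n - 1)}" and y: "y \<in> cyl n (2 ^ (n - 1) + i)"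
  shows "phi_n g n y = ph (hi n (2 ^ (n - 1) + i))"
proof -
  obtain m where m: "n = Suc m" using n by (cases n) auto
  have yb: "y \<in> {b..1}" using cyl_right(1)[of m "2 ^ m + i" y] i y by (auto simp: m)
  have ind: "indicator (level_interval g n (2 ^ m + j)) y = (if j = i then 1 else 0 :: real)" if j: "j \<in> {1..2 ^ m}" for j
  proof -
    have idx: "2 ^ m + j \<in> {1..2 ^ n}" "2 ^ m + i \<in> {1..2 ^ n}" using i j by (auto simp: m)
    have "y \<in> cyl n (2 ^ m + i)" using y by (simp add: m)
    then have "y \<in> cyl n (2 ^ m + j) \<longleftrightarrow> j = i" using cyl_unique[OF idx, of y] by auto
    then show ?thesis unfolding level_interval_eq[OF idx(1)] by (simp add: indicator_def)
  qed
  have "(\<Sum>j=1..2 ^ m. scal g * beta g n j * indicator (level_interval g n (2 ^ m + j)) y) =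
    (\<Sum>j=1..2 ^ m. if j = i then scal g * beta g n i else 0)"
    by (intro sum.cong) (auto simp: ind)
  also have "\<dots> = scal g * beta g n i" using i by (simp add: m)
  finally have "phi_n g n y = scal g * beta g n i" 
    using yb t_sq_less_b by (simp add: phi_n_def m intervals scal_eq)
  then show ?thesis using scal_beta[OF n i] by simp
qed

definition rate :: real where "rate = 1 / t\<^sup>2 - 1 / t"

text \<open>Over the denominator \<open>t\<^sup>2\<close> the claim is
  \<open>(2 * t - 1) * (t + 1) < 0\<close>, so it amounts to \<open>t < 1/2\<close>.\<close>

lemma rate_gt_2: "2 < rate"
proof -
  have "2 * t\<^sup>2 + t < 1"
    using t_less_half t_pos power_strict_mono[of t "1/2" 2] by (simp add: power2_eq_square)
  then show ?thesis using t_pos by (simp add: rate_def field_simps power2_eq_square)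
qed

text \<open>For \<open>x\<close> in the \<open>j\<close>-th interval of level \<open>n - 1\<close> the two preimages lie in the intervals
  \<open>N + 1 - j\<close> and \<open>N + j\<close> of level \<open>n\<close>, and the \<open>k\<close>-th interval of level \<open>n\<close> lies in the interval
  \<open>(k + 1) div 2\<close> of level \<open>n - 1\<close>.\<close>

lemma finite_eigenvector:
  assumes n: "n \<ge> 1"
  defines "N \<equiv> 2 ^ (n - 1)"
  obtains \<rho> c where "increasing_cone N c" "c N = 1" "\<And>i. i \<in> {1..N} \<Longrightarrow> 0 < c i" "rate \<le> \<rho>" "\<rho> \<le> 1 / t\<^sup>2"
    "\<And>j. j \<in> {1..N} \<Longrightarrow> - c ((N + 2 - j) div 2) / t + ph (hi n (N + j)) * c ((N + j + 1) div 2) = \<rho> * c j"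
proof -
  obtain m where m: "n = Suc m" using n by (cases n) auto
  define p where "p j = (N + 2 - j) div 2" for j
  define q where "q j = (N + j + 1) div 2" for j
  define bt where "bt j = ph (hi n (N + j))" for j
  have N1: "N \<ge> 1" by (simp add: N_def)
  have Neven: "N = 1 \<or> even N" by (cases "n - 1") (auto simp: N_def)
  have p: "p j \<in> {1..N}" and q: "q j \<in> {1..N}" and pq: "p j \<le> q j" if "j \<in> {1..N}" for j
    using that Neven by (auto simp: p_def q_def elim!: evenE)
  have pmono: "p j \<le> p i" and qmono: "q i \<le> q j" if "i \<le> j" for i j
    using that by (auto simp: p_def q_def intro!: div_le_mono)
  have hi1: "hi n (N + j) \<in> {b..1}" if "j \<in> {1..N}" for j
    using J1_ends[of j m] that by (simp add: N_def m)
  have bt_pos: "1 / t < bt j" if "j \<in> {1..N}" for j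
    using ph_ge hi1[OF that] by (simp add: bt_def)
  have bt0: "0 < bt j" if "j \<in> {1..N}" for j using bt_pos[OF that] t_pos by (auto intro: order.strict_trans[rotated])
  have bt_mono: "bt i \<le> bt j" if "1 \<le> i" "i \<le> j" "j \<le> N" for i j
  proof (cases "i = j")
    case False
    have idx: "N + j \<in> {1..2 ^ n}" using that by (auto simp: N_def m)
    have "hi n (N + i) < lo n (N + j)" using that False by (intro cyl_ordered) (auto simp: N_def m)
    also have "\<dots> < hi n (N + j)" using ends_bounds[OF idx] by simp
    finally show ?thesis unfolding bt_def using hi1[of i] hi1[of j] that by (intro ph_mono) auto
  qed simp
  \<comment> \<open>\<open>p j\<close> and \<open>q j\<close> may coincide, as they do for
    \<open>N = 1\<close>; the two entries must then add up.\<close>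
  define A where "A j i = (if i = p j then - 1 / t else 0) + (if i = q j then bt j else 0)" for j i
  have T: "(\<Sum>i=1..N. A j i * x i) = - x (p j) / t + bt j * x (q j)" if "j \<in> {1..N}" for x j
  proof -
    have "(\<Sum>i=1..N. A j i * x i) = (\<Sum>i=1..N. if i = p j then - x i / t else 0) + (\<Sum>i=1..N. if i = q j then bt j * x i else 0)"
      unfolding sum.distrib[symmetric] A_def by (intro sum.cong) (auto simp: left_diff_distrib)
    also have "\<dots> = - x (p j) / t + bt j * x (q j)" using p[OF that] q[OF that] by (simp only: sum.delta finite_atLeastAtMost if_True)
    finally show ?thesis .
  qed
  \<comment> \<open>Since \<open>p\<close> is decreasing, the term with negative weight increases
    with \<open>j\<close>. Nonnegativity uses \<open>p j \<le> q j\<close> and that the positive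
    weight is larger than \<open>1 / t\<close>.\<close>
  have pos: "increasing_cone N (\<lambda>j. \<Sum>i=1..N. A j i * x i)" if x: "increasing_cone N x" for x
    unfolding increasing_cone_def
  proof (intro conjI ballI allI impI)
    fix j assume j: "j \<in> {1..N}"
    have "x (p j) \<le> x (q j)" using x p[OF j] q[OF j] pq[OF j] by (auto simp: increasing_cone_def)
    then have "1 / t * x (p j) \<le> 1 / t * x (q j)" using t_pos by (intro mult_left_mono) auto
    also have "\<dots> \<le> bt j * x (q j)" 
      using bt_pos[OF j] increasing_cone_nonneg[OF x q[OF j]] by (intro mult_right_mono) auto
    finally show "0 \<le> (\<Sum>i=1..N. A j i * x i)" unfolding T[OF j] by simp
  next
    fix i j assume ij: "1 \<le> i" "i \<le> j" "j \<le> N"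
    then have i: "i \<in> {1..N}" and j: "j \<in> {1..N}" by auto
    have "x (p j) \<le> x (p i)" using x p[OF i] p[OF j] pmono[OF ij(2)] by (auto simp: increasing_cone_def)
    then have "- x (p i) / t \<le> - x (p j) / t" using t_pos by (intro divide_right_mono) auto
    moreover have "x (q i) \<le> x (q j)" using x q[OF i] q[OF j] qmono[OF ij(2)] by (auto simp: increasing_cone_def)
    then have "bt i * x (q i) \<le> bt j * x (q j)"
      using bt_mono[OF ij] bt0[OF j] increasing_cone_nonneg[OF x q[OF i]] by (intro mult_mono) auto
    ultimately show "(\<Sum>k=1..N. A i k * x k) \<le> (\<Sum>k=1..N. A j k * x k)" unfolding T[OF i] T[OF j] by simp
  qed
  obtain \<rho> c where c: "increasing_cone N c" "c N = 1" and eig: "\<And>j. j \<in> {1..N} \<Longrightarrow> (\<Sum>i=1..N. A j i * c i) = \<rho> * c j"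
    using cone_eigenvector[OF N1 pos] by blast
  have eig': "- c (p j) / t + bt j * c (q j) = \<rho> * c j" if "j \<in> {1..N}" for j
    using eig[OF that] unfolding T[OF that] .
  \<comment> \<open>At the last index the right preimage stays in the last interval, whose right end
    is the fixed point 1 with weight \<open>1 / t\<^sup>2\<close>. As
    \<open>0 \<le> c 1 \<le> 1\<close>, this row pins \<rho> between the stated bounds.\<close>
  have pN: "p N = 1" "q N = N" unfolding p_def q_def using N1 by linarith+
  have "N + N = 2 ^ n" by (simp add: N_def m)
  then have "bt N = 1 / t\<^sup>2" unfolding bt_def by (simp only: hi_last ph_1)
  then have \<rho>: "\<rho> = 1 / t\<^sup>2 - c 1 / t" using eig'[of N] N1 unfolding c(2) pN by simp
  have c1: "0 \<le> c 1" "c 1 \<le> 1" using increasing_cone_nonneg[OF c(1), of 1] increasing_cone_le_top[OF c(1), of 1] N1 unfolding c(2) by simp_all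
  have \<rho>1: "rate \<le> \<rho>" using c1 t_pos by (simp add: \<rho> rate_def divide_right_mono)
  have \<rho>2: "\<rho> \<le> 1 / t\<^sup>2" using c1 t_pos by (simp add: \<rho>)
  \<comment> \<open>Positivity spreads downwards from \<open>c N = 1\<close>, because
    \<open>q i > i\<close> for \<open>i < N\<close> and the right branch strictly outweighs the left
    one.\<close>
  have "0 < c i" if "i \<in> {1..N}" for i
    using that
  proof (induction "N - i" arbitrary: i rule: less_induct)
    case less
    show ?case
    proof (cases "i = N")
      case False
      then have "i < q i" "i < N" using less.prems unfolding q_def by auto
      then have "q i \<in> {1..N}" "N - q i < N - i" using q[OF less.prems] by auto
      then have cq: "0 < c (q i)" using less.hyps by blast
      have "c (p i) \<le> c (q i)" using c(1) p[OF less.prems] q[OF less.prems] pq[OF less.prems] by (auto simp: increasing_cone_def)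
      then have "c (p i) / t \<le> 1 / t * c (q i)" using t_pos by (simp add: divide_right_mono)
      also have "\<dots> < bt i * c (q i)" using bt_pos[OF less.prems] cq by (intro mult_strict_right_mono)
      finally have "0 < \<rho> * c i" using eig'[OF less.prems] by simp
      then show ?thesis using \<rho>1 rate_gt_2 by (simp add: zero_less_mult_iff)
    qed (simp add: c)
  qed
  then show ?thesis using that[of c \<rho>] c \<rho>1 \<rho>2 eig' unfolding p_def q_def bt_def by blast
qed

text \<open>Collected here is what the compactness argument needs: bounds independent of
  \<open>n\<close>, the normalisation \<open>v 1 = 1\<close> against a vanishing limit, and
  constancy on intervals of level \<open>n - 1\<close>, where the oscillation estimate
  starts.\<close>

definition step_eigen :: "nat \<Rightarrow> real \<Rightarrow> (real \<Rightarrow> real) \<Rightarrow> bool" where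
  "step_eigen n \<rho> v \<longleftrightarrow> rate \<le> \<rho> \<and> \<rho> \<le> 1 / t\<^sup>2 \<and> (\<forall>x\<in>Lam g. 0 \<le> v x \<and> v x \<le> 1) \<and> v 1 = 1 \<and>
     positive_step_vector g n v \<and>
     (\<forall>i\<in>{1..2 ^ (n - 1)}. \<forall>x\<in>Lam g \<inter> cyl (n - 1) i. \<forall>x'\<in>Lam g \<inter> cyl (n - 1) i. v x = v x') \<and>
     (\<forall>x\<in>Lam g. - v (- t * x) / t + phi_n g n (y1 x) * v (y1 x) = \<rho> * v x)"

lemma step_eigen_exists:
  assumes n: "n \<ge> 1"
  shows "\<exists>\<rho> v. step_eigen n \<rho> v"
proof -
  obtain m where m: "n = Suc m" using n by (cases n) auto
  define N where "N = (2::nat) ^ m"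
  obtain \<rho> c where c: "increasing_cone N c" "c N = 1" "\<And>i. i \<in> {1..N} \<Longrightarrow> 0 < c i" 
    and \<rho>: "rate \<le> \<rho>" "\<rho> \<le> 1 / t\<^sup>2"
    and eig: "\<And>j. j \<in> {1..N} \<Longrightarrow> - c ((N + 2 - j) div 2) / t + ph (hi n (N + j)) * c ((N + j + 1) div 2) = \<rho> * c j"
    using finite_eigenvector[OF n] unfolding m N_def diff_Suc_1 by metis
  define v where "v x = (\<Sum>i=1..2 ^ (n - 1). c i * k_vec g n i x)" for x
  have v: "v x = c i" if "x \<in> Lam g" "x \<in> cyl m i" "i \<in> {1..N}" for x i
  proof -
    have "v x = (\<Sum>j=1..N. if j = i then c i else 0)"
      unfolding v_def
    proof (rule sum.cong)
      fix j assume j: "j \<in> {1..N}"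
      have "k_vec g n j x = indicator (cyl m j) x"
        using k_vec_eq[OF n _ that(1), of j] j by (simp add: m N_def)
      moreover have "x \<in> cyl m j \<longleftrightarrow> j = i"
        using cyl_unique[of i m j x] that(2,3) j unfolding N_def by blast
      ultimately show "c j * k_vec g n j x = (if j = i then c i else 0)"
        by (simp add: indicator_def)
    qed (simp add: N_def m)
    also have "\<dots> = c i" using that(3) by (simp only: sum.delta finite_atLeastAtMost if_True)
    finally show ?thesis .
  qed
  have cell: "\<exists>i\<in>{1..N}. x \<in> cyl m i" if "x \<in> Lam g" for x using Lam_cyl[OF that, of m] by (simp add: N_def)
  have N1: "N \<in> {1..N}" by (simp add: N_def)
  have "1 \<in> cyl m N" using ends_bounds[of N m] hi_last[of m] by (simp add: cyl_def N_def)
  then have v1: "v 1 = 1" using v[OF one_in_Lam _ N1] c(2) by simp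
  have vb: "0 \<le> v x \<and> v x \<le> 1" if x: "x \<in> Lam g" for x
  proof -
    obtain i where i: "i \<in> {1..N}" "x \<in> cyl m i" using cell[OF x] by blast
    then show ?thesis using v[OF x i(2,1)] c(3)[OF i(1)] increasing_cone_le_top[OF c(1) i(1)] c(2) by simp
  qed
  have pv: "positive_step_vector g n v"
    unfolding positive_step_vector_def v_def m diff_Suc_1 N_def[symmetric] using c(3) by (intro exI[of _ c]) blast
  have eg: "- v (- t * x) / t + phi_n g n (y1 x) * v (y1 x) = \<rho> * v x" if x: "x \<in> Lam g" for x
  proof -
    obtain i where i: "i \<in> {1..N}" "x \<in> cyl m i" using cell[OF x] by blast
    have i': "i \<in> {1..2 ^ m}" using i by (simp add: N_def)
    have y0: "- t * x \<in> cyl n (N + 1 - i)" and y1: "y1 x \<in> cyl n (N + i)"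
      using cyl_child_left[OF i' i(2)] cyl_child_right[OF i' i(2)] by (simp_all add: m N_def)
    have idx: "N + 1 - i \<in> {1..2 ^ Suc m}" "N + i \<in> {1..2 ^ Suc m}" using i by (auto simp: N_def)
    have "N + 1 - i + 1 = N + 2 - i" using i by auto
    then have "- t * x \<in> cyl m ((N + 2 - i) div 2)"
      using cyl_parent[OF idx(1)] y0 unfolding m by auto
    moreover have "(N + 2 - i) div 2 \<in> {1..N}" using i by auto
    ultimately have 0: "v (- t * x) = c ((N + 2 - i) div 2)" by (intro v Lam_y0 x)
    have "y1 x \<in> cyl m ((N + i + 1) div 2)"
      using cyl_parent[OF idx(2)] y1 unfolding m by auto
    moreover have "(N + i + 1) div 2 \<in> {1..N}" using i by auto
    ultimately have 1: "v (y1 x) = c ((N + i + 1) div 2)" by (intro v Lam_y1 x)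
    have "phi_n g n (y1 x) = ph (hi n (N + i))" using phi_n_J1[OF n, of i "y1 x"] i' y1 by (simp add: m N_def)
    then show ?thesis using eig[OF i(1)] unfolding 0 1 v[OF x i(2,1)] by simp
  qed
  have const: "\<forall>i\<in>{1..2 ^ (n - 1)}. \<forall>x\<in>Lam g \<inter> cyl (n - 1) i. \<forall>x'\<in>Lam g \<inter> cyl (n - 1) i. v x = v x'"
  proof (intro ballI)
    fix i x x' assume i: "i \<in> {1..2 ^ (n - 1)}" and x: "x \<in> Lam g \<inter> cyl (n - 1) i" "x' \<in> Lam g \<inter> cyl (n - 1) i"
    then have "i \<in> {1..N}" "x \<in> cyl m i" "x' \<in> cyl m i" by (simp_all add: m N_def)
    then show "v x = v x'" using v[of x i] v[of x' i] x by simp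
  qed
  have "step_eigen n \<rho> v"
    unfolding step_eigen_def by (intro conjI \<rho> v1 pv const ballI[OF vb] ballI[OF eg])
  then show ?thesis by blast
qed

lemma step_eigen_vector:
  assumes n: "n \<ge> 1" and s: "step_eigen n \<rho> v"
  shows "is_eigenvector (Lam g) (V_bounded (Lam g)) (transfer_op g (phi_n g n)) \<rho> v"
  unfolding is_eigenvector_def
proof (intro conjI ballI)
  have "bounded (v ` Lam g)" unfolding bounded_iff using s by (intro exI[of _ 1]) (auto simp: step_eigen_def)
  then show "v \<in> V_bounded (Lam g)" by (simp add: V_bounded_def)
  show "\<exists>x\<in>Lam g. v x \<noteq> 0" using s one_in_Lam by (intro bexI[of _ 1]) (auto simp: step_eigen_def)
  fix x assume x: "x \<in> Lam g"
  then have "x \<in> {-t..1}" using Lam_subset by blast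
  then show "transfer_op g (phi_n g n) v x = \<rho> * v x"
    using s x by (simp add: transfer_op_eq phi_n_J0[OF n scaled_J, simplified] step_eigen_def)
qed

subsection \<open>Compactness\<close>

text \<open>\<open>y1_mvt\<close> gives equality at one intermediate point. Moving to another point
  \<open>r\<close> of the image changes the weight by at most \<open>C\<close> times the image
  length, which is small at deep levels; as the image is no longer than the interval, the error is a
  small fraction of its length.\<close>

lemma weight_times_length:
  assumes \<eta>: "\<eta> > 0"
  shows "\<exists>m. \<forall>M\<ge>m. \<forall>i\<in>{1..2 ^ M}. \<forall>r\<in>{y1 (lo M i)..y1 (hi M i)}.
    ph r * (y1 (hi M i) - y1 (lo M i)) \<le> (1 + \<eta>) * (hi M i - lo M i)"
proof -
  obtain C where C: "C > 0" "\<And>x y. x \<in> {b..1} \<Longrightarrow> y \<in> {b..1} \<Longrightarrow> \<bar>ph x - ph y\<bar> \<le> C * \<bar>x - y\<bar>"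
    using ph_lipschitz by blast
  have "(\<lambda>M. C * (t ^ M * (1 + t))) \<longlonglongrightarrow> C * (0 * (1 + t))"
    using t_pos t_less_1 by (intro tendsto_intros LIMSEQ_power_zero) auto
  then have "\<forall>\<^sub>F M in sequentially. C * (t ^ M * (1 + t)) < \<eta>"
    using \<eta> by (intro order_tendstoD) auto
  then obtain m where m: "\<And>M. m \<le> M \<Longrightarrow> C * (t ^ M * (1 + t)) < \<eta>" by (auto simp: eventually_sequentially)
  have "ph r * (y1 (hi M i) - y1 (lo M i)) \<le> (1 + \<eta>) * (hi M i - lo M i)"
    if M: "m \<le> M" and i: "i \<in> {1..2 ^ M}" and r: "r \<in> {y1 (lo M i)..y1 (hi M i)}" for M i r
  proof -
    have eb: "- t \<le> lo M i" "lo M i < hi M i" "hi M i \<le> 1" using ends_bounds[OF i] by auto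
    define l where "l = hi M i - lo M i"
    define l1 where "l1 = y1 (hi M i) - y1 (lo M i)"
    obtain z where z: "z \<in> {y1 (lo M i)..y1 (hi M i)}" "l = ph z * l1" and lt: "y1 (lo M i) < y1 (hi M i)"
      using y1_mvt[OF eb] by (auto simp: l_def l1_def)
    have sub: "{y1 (lo M i)..y1 (hi M i)} \<subseteq> {b..1}" using y1_in[of "lo M i"] y1_in[of "hi M i"] eb by auto
    have "l1 \<le> t * l" unfolding l1_def l_def using eb by (intro y1_contracts) auto
    also have "\<dots> \<le> 1 * l" using eb t_less_1 by (intro mult_right_mono) (auto simp: l_def)
    finally have l1: "l1 \<le> l" "0 < l1" using lt by (auto simp: l1_def)
    have "l1 \<le> t ^ M * (1 + t)" using l1 cyl_length[OF i] by (simp add: l_def)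
    then have "C * l1 \<le> C * (t ^ M * (1 + t))" using C(1) by (intro mult_left_mono) auto
    then have Cl1: "C * l1 \<le> \<eta>" using m[OF M] by simp
    have "\<bar>ph r - ph z\<bar> \<le> C * \<bar>r - z\<bar>" using r z(1) sub by (intro C(2)) auto
    also have "\<dots> \<le> C * l1" using r z(1) C(1) by (intro mult_left_mono) (auto simp: l1_def)
    finally have "ph r * l1 \<le> (ph z + C * l1) * l1" using l1(2) by (intro mult_right_mono) auto
    also have "\<dots> = l + (C * l1) * l1" by (simp add: z(2) algebra_simps)
    also have "\<dots> \<le> l + \<eta> * l" using Cl1 l1 \<eta> C(1) by (intro add_left_mono mult_mono) auto
    finally show ?thesis by (simp add: algebra_simps l_def l1_def)
  qed
  then show ?thesis by blast
qed

text \<open>Away from the first few levels the oscillation over a cylinder is multiplied by at most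
  \<open>(2 + \<eta>) / \<rho> < 1\<close> when passing to the parent, because weight times length is preserved up to distortion.\<close>

lemma uniform_oscillation:
  "\<exists>K>0. \<exists>m0. \<forall>n \<rho> v. n \<ge> 1 \<longrightarrow> step_eigen n \<rho> v \<longrightarrow> (\<forall>M\<ge>m0. \<forall>i\<in>{1..2 ^ M}.
     \<forall>x\<in>Lam g \<inter> cyl M i. \<forall>x'\<in>Lam g \<inter> cyl M i. \<bar>v x - v x'\<bar> \<le> K * (hi M i - lo M i))"
proof -
  obtain C where C: "C > 0" "\<And>x y. x \<in> {b..1} \<Longrightarrow> y \<in> {b..1} \<Longrightarrow> \<bar>ph x - ph y\<bar> \<le> C * \<bar>x - y\<bar>"
    using ph_lipschitz by blast
  \<comment> \<open>With \<open>rate = 2 + 2 * \<eta>\<close>, one \<eta> pays for the distortion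
    and the other for the variation of the weight; \<open>K\<close> is fixed by
    \<open>C = \<eta> * K\<close>.\<close>
  define \<eta> where "\<eta> = (rate - 2) / 2"
  have \<eta>: "\<eta> > 0" using rate_gt_2 by (simp add: \<eta>_def)
  define K where "K = C / \<eta>"
  have K: "K > 0" using C \<eta> by (simp add: K_def)
  obtain m0 where m0: "\<And>M i r. m0 \<le> M \<Longrightarrow> i \<in> {1..2 ^ M} \<Longrightarrow> r \<in> {y1 (lo M i)..y1 (hi M i)} \<Longrightarrow>
      ph r * (y1 (hi M i) - y1 (lo M i)) \<le> (1 + \<eta>) * (hi M i - lo M i)"
    using weight_times_length[OF \<eta>] by blast
  have "\<bar>v x - v x'\<bar> \<le> K * (hi M i - lo M i)"
    if n: "n \<ge> 1" and s: "step_eigen n \<rho> v" and "m0 \<le> M" "i \<in> {1..2 ^ M}" 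
     "x \<in> Lam g \<inter> cyl M i" "x' \<in> Lam g \<inter> cyl M i" for n \<rho> v M i x x'
    using that(3-)
  \<comment> \<open>Truncated subtraction puts every \<open>M \<ge> n - 1\<close> into the base
    case, where \<open>v\<close> is constant on the interval. The induction then runs from fine to
    coarse levels.\<close>
  proof (induction "n - 1 - M" arbitrary: M i x x')
    case 0
    obtain k where k: "k \<in> {1..2 ^ (n - 1)}" "x \<in> cyl (n - 1) k" using Lam_cyl 0 by blast
    then have "cyl M i \<subseteq> cyl (n - 1) k" using 0 by (intro cyl_nested[of "n - 1" M i x k]) auto
    then have "v x = v x'" using s k 0 unfolding step_eigen_def by blast
    then show ?case using ends_bounds[OF 0(3)] K by simp
  next
    case (Suc d)
    have M: "Suc M \<le> n" "d = n - 1 - Suc M" using Suc.hyps(2) by auto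
    have x: "x \<in> Lam g" "x' \<in> Lam g" "x \<in> cyl M i" "x' \<in> cyl M i" using Suc.prems by auto
    have eb: "- t \<le> lo M i" "lo M i < hi M i" "hi M i \<le> 1" using ends_bounds[OF Suc.prems(2)] by auto
    define l where "l = hi M i - lo M i"
    define l1 where "l1 = y1 (hi M i) - y1 (lo M i)"
    have l0: "0 < l" using eb by (simp add: l_def)
    have idx: "2 ^ M + 1 - i \<in> {1..2 ^ Suc M}" "2 ^ M + i \<in> {1..2 ^ Suc M}" using Suc.prems by auto
    have e0: "hi (Suc M) (2 ^ M + 1 - i) - lo (Suc M) (2 ^ M + 1 - i) = t * l"
    proof -
      have le: "2 ^ M + 1 - i \<le> 2 ^ M" and eq: "2 ^ M + 1 - (2 ^ M + 1 - i) = i" using Suc.prems by auto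
      show ?thesis unfolding ends_left[OF le] eq by (simp add: l_def algebra_simps)
    qed
    have e1: "lo (Suc M) (2 ^ M + i) = y1 (lo M i)" "hi (Suc M) (2 ^ M + i) = y1 (hi M i)"
      using Suc.prems by (simp_all add: ends_right)
    have c0: "- t * x \<in> cyl (Suc M) (2 ^ M + 1 - i)" "- t * x' \<in> cyl (Suc M) (2 ^ M + 1 - i)"
      using cyl_child_left Suc.prems(2) x by auto
    have c1: "y1 x \<in> cyl (Suc M) (2 ^ M + i)" "y1 x' \<in> cyl (Suc M) (2 ^ M + i)"
      using cyl_child_right Suc.prems(2) x by auto
    have IH0: "\<bar>v (- t * x) - v (- t * x')\<bar> \<le> K * (t * l)"
      unfolding e0[symmetric] using c0 x Suc.prems idx Lam_y0 by (intro Suc.hyps(1)[OF M(2)]) auto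
    have IH1: "\<bar>v (y1 x) - v (y1 x')\<bar> \<le> K * l1"
      unfolding l1_def e1[symmetric] using c1 x Suc.prems idx Lam_y1 by (intro Suc.hyps(1)[OF M(2)]) auto
    have lt: "y1 (lo M i) < y1 (hi M i)" using y1_mvt(1)[OF eb] .
    have sub: "{y1 (lo M i)..y1 (hi M i)} \<subseteq> {b..1}" using y1_in[of "lo M i"] y1_in[of "hi M i"] eb by auto
    have "l1 \<le> t * l" unfolding l1_def l_def using eb by (intro y1_contracts) auto
    also have "\<dots> \<le> 1 * l" using l0 t_less_1 by (intro mult_right_mono) auto
    finally have l1: "l1 \<le> l" "0 < l1" using lt by (auto simp: l1_def)
    \<comment> \<open>\<open>phi_n\<close> takes its value from the right end of an interval of
      level \<open>n\<close>. As \<open>Suc M \<le> n\<close>, this end point stays in the image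
      interval of level \<open>Suc M\<close>, so the distortion bound covers the approximate weight
      too.\<close>
    have weight: "\<exists>r\<in>{y1 (lo M i)..y1 (hi M i)}. phi_n g n y = ph r" 
      if y: "y \<in> Lam g" "y \<in> cyl (Suc M) (2 ^ M + i)" for y
    proof -
      obtain j where j: "j \<in> {1..2 ^ n}" "y \<in> cyl n j" using Lam_cyl[OF y(1)] by blast
      have nest: "cyl n j \<subseteq> cyl (Suc M) (2 ^ M + i)" using cyl_nested[OF M(1) j idx(2) y(2)] .
      obtain m where m: "n = Suc m" using n by (cases n) auto
      have "\<not> j \<le> 2 ^ m"
        using cyl_left(1)[of j m y] j sub y(2) t_sq_less_b by (auto simp: m cyl_def e1)
      then have "j - 2 ^ m \<in> {1..2 ^ (n - 1)}" "2 ^ (n - 1) + (j - 2 ^ m) = j" using j by (auto simp: m)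
      then have "phi_n g n y = ph (hi n j)" using phi_n_J1[OF n, of "j - 2 ^ m" y] j by simp
      moreover have "hi n j \<in> cyl n j" using ends_bounds[OF j(1)] by (simp add: cyl_def)
      ultimately show ?thesis using nest by (auto simp: cyl_def e1)
    qed
    obtain r where r: "r \<in> {y1 (lo M i)..y1 (hi M i)}" "phi_n g n (y1 x) = ph r" using weight c1 Lam_y1 x by blast
    obtain r' where r': "r' \<in> {y1 (lo M i)..y1 (hi M i)}" "phi_n g n (y1 x') = ph r'" using weight c1 Lam_y1 x by blast
    have near: "\<bar>ph u - ph u'\<bar> \<le> C * l1" if "u \<in> {y1 (lo M i)..y1 (hi M i)}" "u' \<in> {y1 (lo M i)..y1 (hi M i)}" for u u'
    proof -
      have "\<bar>ph u - ph u'\<bar> \<le> C * \<bar>u - u'\<bar>" using that sub by (intro C(2)) auto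
      also have "\<dots> \<le> C * l1" using that C(1) by (intro mult_left_mono) (auto simp: l1_def)
      finally show ?thesis .
    qed
    have ph0: "0 < ph r" using ph_ge[of r] r(1) sub t_pos by (auto intro: order.strict_trans[rotated])
    have dist: "ph r * l1 \<le> (1 + \<eta>) * l"
      unfolding l_def l1_def by (rule m0[OF Suc.prems(1,2) r(1)])
    have v': "0 \<le> v (y1 x')" "v (y1 x') \<le> 1" using s Lam_y1 x by (auto simp: step_eigen_def)
    have eq: "\<rho> * (v x - v x') = - (v (- t * x) - v (- t * x')) / t + ph r * (v (y1 x) - v (y1 x')) + (ph r - ph r') * v (y1 x')"
    proof -
      have "\<rho> * v x = - v (- t * x) / t + ph r * v (y1 x)" "\<rho> * v x' = - v (- t * x') / t + ph r' * v (y1 x')"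
        using s x r r' by (auto simp: step_eigen_def)
      then show ?thesis by (simp add: algebra_simps diff_divide_distrib)
    qed
    have "\<bar>\<rho> * (v x - v x')\<bar> \<le> \<bar>v (- t * x) - v (- t * x')\<bar> / t + ph r * \<bar>v (y1 x) - v (y1 x')\<bar> + \<bar>ph r - ph r'\<bar> * v (y1 x')"
    proof -
      have "\<bar>- (v (- t * x) - v (- t * x')) / t\<bar> = \<bar>v (- t * x) - v (- t * x')\<bar> / t" using t_pos by (simp add: abs_divide)
      moreover have "\<bar>ph r * (v (y1 x) - v (y1 x'))\<bar> = ph r * \<bar>v (y1 x) - v (y1 x')\<bar>" using ph0 by (simp add: abs_mult)
      moreover have "\<bar>(ph r - ph r') * v (y1 x')\<bar> = \<bar>ph r - ph r'\<bar> * v (y1 x')" using v' by (simp add: abs_mult)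
      ultimately show ?thesis unfolding eq by linarith
    qed
    also have "\<dots> \<le> K * (t * l) / t + ph r * (K * l1) + C * l1 * 1"
      using IH0 IH1 near[OF r(1) r'(1)] v' t_pos ph0 C(1) l1(2) by (intro add_mono divide_right_mono mult_left_mono mult_mono) auto
    also have "\<dots> = K * l + K * (ph r * l1) + C * l1" using t_pos by simp
    \<comment> \<open>The left branch contributes \<open>K * l\<close>, its weight
      \<open>1 / t\<close> undoing the contraction by \<open>t\<close>; the right one does so up to
      distortion, and the last term is the change of weight.\<close>
    also have "\<dots> \<le> K * l + K * ((1 + \<eta>) * l) + C * l"
      using dist K l1 C(1) by (intro add_mono mult_left_mono) auto
    also have "\<dots> = (2 + \<eta>) * K * l + \<eta> * K * l" using \<eta> by (simp add: K_def algebra_simps)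
    also have "\<dots> = rate * (K * l)" by (simp add: \<eta>_def algebra_simps add_divide_distrib) 
    also have "\<dots> \<le> \<rho> * (K * l)" using s K l0 by (intro mult_right_mono) (auto simp: step_eigen_def)
    finally have "\<rho> * \<bar>v x - v x'\<bar> \<le> \<rho> * (K * l)" 
      using s rate_gt_2 by (auto simp: abs_mult step_eigen_def)
    moreover have "0 < \<rho>" using s rate_gt_2 by (auto simp: step_eigen_def)
    ultimately show ?case by (simp add: l_def)
  qed
  then show ?thesis using K by blast
qed

lemma phi_n_tendsto:
  assumes x: "x \<in> Lam g"
  shows "(\<lambda>n. phi_n g (Suc n) (y1 x)) \<longlonglongrightarrow> ph (y1 x)"
proof -
  obtain C where C: "C > 0" "\<And>x y. x \<in> {b..1} \<Longrightarrow> y \<in> {b..1} \<Longrightarrow> \<bar>ph x - ph y\<bar> \<le> C * \<bar>x - y\<bar>"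
    using ph_lipschitz by blast
  have bound: "norm (phi_n g (Suc n) (y1 x) - ph (y1 x)) \<le> C * (t ^ Suc n * (1 + t))" for n
  proof -
    obtain i where i: "i \<in> {1..2 ^ n}" "x \<in> cyl n i" using Lam_cyl[OF x] by blast
    have y: "y1 x \<in> cyl (Suc n) (2 ^ n + i)" using cyl_child_right[OF i] .
    have idx: "2 ^ n + i \<in> {1..2 ^ Suc n}" using i by auto
    have "x \<in> {-t..1}" using x Lam_subset by blast
    then have "\<bar>ph (hi (Suc n) (2 ^ n + i)) - ph (y1 x)\<bar> \<le> C * \<bar>hi (Suc n) (2 ^ n + i) - y1 x\<bar>"
      by (intro C(2) J1_ends i y1_in)
    also have "\<dots> \<le> C * (t ^ Suc n * (1 + t))"
      using y cyl_length[OF idx] C(1) by (intro mult_left_mono) (auto simp: cyl_def)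
    finally show ?thesis using phi_n_J1[of "Suc n" i "y1 x"] i y by simp
  qed
  have "(\<lambda>n. C * (t ^ Suc n * (1 + t))) \<longlonglongrightarrow> C * (0 * (1 + t))"
    using t_pos t_less_1 by (intro tendsto_intros LIMSEQ_Suc[OF LIMSEQ_power_zero]) auto
  then have "(\<lambda>n. phi_n g (Suc n) (y1 x) - ph (y1 x)) \<longlonglongrightarrow> 0"
    by (intro Lim_null_comparison[OF always_eventually[OF allI[OF bound]]]) simp
  then show ?thesis by (simp add: LIM_zero_iff)
qed

text \<open>Oscillation is measured against the length of a common interval instead of the distance
  of the points; passing from one to the other would require lower bounds for the gaps. Lipschitz
  continuity is obtained from the analytic extension instead.\<close>

definition limit_eigen :: "real \<Rightarrow> (real \<Rightarrow> real) \<Rightarrow> bool" where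
  "limit_eigen \<mu> w \<longleftrightarrow> rate \<le> \<mu> \<and> w 1 = 1 \<and> (\<forall>x\<in>Lam g. \<bar>w x\<bar> \<le> 1) \<and>
     (\<forall>x\<in>Lam g. - w (- t * x) / t + ph (y1 x) * w (y1 x) = \<mu> * w x) \<and>
     (\<exists>K>0. \<exists>m0. \<forall>M\<ge>m0. \<forall>i\<in>{1..2 ^ M}. \<forall>x\<in>Lam g \<inter> cyl M i. \<forall>x'\<in>Lam g \<inter> cyl M i. \<bar>w x - w x'\<bar> \<le> K * (hi M i - lo M i))"

text \<open>An Arzela-Ascoli argument: a diagonal subsequence converges at one sample point per
  interval, and the oscillation bound, uniform in \<open>n\<close>, makes it uniformly Cauchy on all
  of \<open>Lam g\<close>.\<close>

lemma limit_eigen_exists: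
  obtains lam v r \<mu> w where "\<And>n. n \<ge> 1 \<Longrightarrow> step_eigen n (lam n) (v n)" "strict_mono (r :: nat \<Rightarrow> nat)" "\<And>i. r i \<ge> 1"
    "(\<lambda>i. lam (r i)) \<longlonglongrightarrow> \<mu>" "uniform_limit (Lam g) (\<lambda>i. v (r i)) w sequentially" "limit_eigen \<mu> w"
proof -
  have "\<forall>n. \<exists>\<rho> v. n \<ge> 1 \<longrightarrow> step_eigen n \<rho> v" using step_eigen_exists by blast
  from choice[OF this] obtain lam where "\<forall>n. \<exists>v. n \<ge> 1 \<longrightarrow> step_eigen n (lam n) v" ..
  from choice[OF this] obtain v where "\<forall>n. n \<ge> 1 \<longrightarrow> step_eigen n (lam n) (v n)" ..
  then have se: "step_eigen n (lam n) (v n)" if "n \<ge> 1" for n using that by blast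
  have seS: "step_eigen (Suc n) (lam (Suc n)) (v (Suc n))" for n by (rule se) simp
  obtain K m0 where K: "K > 0" and "\<forall>n \<rho> v. n \<ge> 1 \<longrightarrow> step_eigen n \<rho> v \<longrightarrow> (\<forall>M\<ge>m0. \<forall>i\<in>{1..2 ^ M}.
     \<forall>x\<in>Lam g \<inter> cyl M i. \<forall>x'\<in>Lam g \<inter> cyl M i. \<bar>v x - v x'\<bar> \<le> K * (hi M i - lo M i))"
    using uniform_oscillation by blast
  then have osc: "\<And>n \<rho> v M i x x'. \<lbrakk>n \<ge> 1; step_eigen n \<rho> v; m0 \<le> M; i \<in> {1..2 ^ M}; 
     x \<in> Lam g \<inter> cyl M i; x' \<in> Lam g \<inter> cyl M i\<rbrakk> \<Longrightarrow> \<bar>v x - v x'\<bar> \<le> K * (hi M i - lo M i)"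
    by blast
  define e where "e M i = (SOME x. x \<in> Lam g \<inter> cyl M i)" for M i
  have e: "e M i \<in> Lam g \<inter> cyl M i" if "x \<in> Lam g \<inter> cyl M i" for M i x
    unfolding e_def using that by (rule someI)
  \<comment> \<open>A countable index set for the diagonal argument: \<open>None\<close> carries the
    eigenvalue, \<open>Some (M, i)\<close> the value at the sample point of an interval that meets
    the Cantor set.\<close>
  define S where "S = insert None (Some ` {(M, i). Lam g \<inter> cyl M i \<noteq> {}})"
  define f where "f n q = (case q of None \<Rightarrow> lam (Suc n) | Some (M, i) \<Rightarrow> v (Suc n) (e M i))" for n q
  have "norm (f n q) \<le> 1 / t\<^sup>2 + 1" if q: "q \<in> S" for n q
  proof (cases q)
    case None
    then show ?thesis using seS[of n] rate_gt_2 by (simp add: f_def step_eigen_def)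
  next
    case (Some Mi)
    then obtain M i x where "q = Some (M, i)" "x \<in> Lam g \<inter> cyl M i" using q by (auto simp: S_def)
    moreover from this have "0 \<le> v (Suc n) (e M i)" "v (Suc n) (e M i) \<le> 1" 
      using e[of x M i] seS[of n] by (simp_all add: step_eigen_def)
    ultimately show ?thesis using t_pos by (simp add: f_def add_increasing)
  qed
  then obtain s where s: "strict_mono (s :: nat \<Rightarrow> nat)" and conv: "\<And>q. q \<in> S \<Longrightarrow> \<exists>l. (\<lambda>n. f (s n) q) \<longlonglongrightarrow> l"
    by (rule function_convergent_subsequence[of S f, rotated]) auto
  define r where "r n = Suc (s n)" for n
  have r: "strict_mono r" "\<And>i. r i \<ge> 1" using s by (auto simp: r_def strict_mono_def)
  obtain \<mu> where "(\<lambda>n. f (s n) None) \<longlonglongrightarrow> \<mu>" using conv[of None] by (auto simp: S_def)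
  then have \<mu>: "(\<lambda>i. lam (r i)) \<longlonglongrightarrow> \<mu>" by (simp add: f_def r_def)
  have "uniformly_Cauchy_on (Lam g) (\<lambda>i. v (r i))"
  proof (rule uniformly_Cauchy_onI)
    fix \<epsilon> :: real assume \<epsilon>: "\<epsilon> > 0"
    have "(\<lambda>M. K * (t ^ M * (1 + t))) \<longlonglongrightarrow> K * (0 * (1 + t))"
      using t_pos t_less_1 by (intro tendsto_intros LIMSEQ_power_zero) auto
    then have "\<forall>\<^sub>F M in sequentially. K * (t ^ M * (1 + t)) < \<epsilon> / 3"
      using \<epsilon> by (intro order_tendstoD) auto
    then obtain M where M: "m0 \<le> M" "K * (t ^ M * (1 + t)) < \<epsilon> / 3"
      using eventually_ge_at_top[of m0] by (metis (mono_tags, lifting) eventually_conj eventually_sequentially order_refl)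
    have "\<exists>N. \<forall>m\<ge>N. \<forall>n\<ge>N. (\<exists>x. x \<in> Lam g \<inter> cyl M i) \<longrightarrow> dist (v (r m) (e M i)) (v (r n) (e M i)) < \<epsilon> / 3" for i
    proof (cases "\<exists>x. x \<in> Lam g \<inter> cyl M i")
      case True
      then have "Some (M, i) \<in> S" by (auto simp: S_def)
      then have "Cauchy (\<lambda>n. f (s n) (Some (M, i)))" using conv by (intro convergent_Cauchy) (auto simp: convergent_def)
      then have "Cauchy (\<lambda>n. v (r n) (e M i))" by (simp add: f_def r_def)
      from metric_CauchyD[OF this, of "\<epsilon> / 3"] \<epsilon> obtain N where
        "\<forall>m\<ge>N. \<forall>n\<ge>N. dist (v (r m) (e M i)) (v (r n) (e M i)) < \<epsilon> / 3" by auto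
      then show ?thesis by blast
    qed auto
    from choice[OF allI[OF this]] obtain N where 
      "\<forall>i. \<forall>m\<ge>N i. \<forall>n\<ge>N i. (\<exists>x. x \<in> Lam g \<inter> cyl M i) \<longrightarrow> dist (v (r m) (e M i)) (v (r n) (e M i)) < \<epsilon> / 3" ..
    then have N: "\<And>i m n. m \<ge> N i \<Longrightarrow> n \<ge> N i \<Longrightarrow> (\<exists>x. x \<in> Lam g \<inter> cyl M i) \<Longrightarrow> dist (v (r m) (e M i)) (v (r n) (e M i)) < \<epsilon> / 3"
      by blast
    define N0 where "N0 = Max (N ` {1..2 ^ M})"
    show "\<exists>M. \<forall>x\<in>Lam g. \<forall>m\<ge>M. \<forall>n\<ge>M. dist (v (r m) x) (v (r n) x) < \<epsilon>"
    proof (intro exI ballI allI impI)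
      fix x m n assume x: "x \<in> Lam g" and mn: "m \<ge> N0" "n \<ge> N0"
      obtain i where i: "i \<in> {1..2 ^ M}" "x \<in> cyl M i" using Lam_cyl[OF x] by blast
      have xi: "x \<in> Lam g \<inter> cyl M i" using x i by simp
      have close: "\<bar>v (r k) x - v (r k) (e M i)\<bar> < \<epsilon> / 3" for k
      proof -
        have "\<bar>v (r k) x - v (r k) (e M i)\<bar> \<le> K * (hi M i - lo M i)"
          by (rule osc[OF _ se M(1) i(1) xi e[OF xi]]) (use r(2)[of k] in auto)
        also have "\<dots> \<le> K * (t ^ M * (1 + t))" using K cyl_length[OF i(1)] by (intro mult_left_mono) auto
        finally show ?thesis using M(2) by simp
      qed
      have "N i \<le> N0" unfolding N0_def using i(1) by (intro Max_ge) auto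
      then have "dist (v (r m) (e M i)) (v (r n) (e M i)) < \<epsilon> / 3" using mn xi by (intro N) auto
      then show "dist (v (r m) x) (v (r n) x) < \<epsilon>" 
        using close[of m] close[of n] unfolding dist_real_def by linarith
    qed
  qed
  then obtain w where w: "uniform_limit (Lam g) (\<lambda>i. v (r i)) w sequentially"
    using Cauchy_uniformly_convergent by (auto simp: uniformly_convergent_on_def)
  have wl: "(\<lambda>i. v (r i) x) \<longlonglongrightarrow> w x" if "x \<in> Lam g" for x
    using tendsto_uniform_limitI[OF w that] .
  have ser: "step_eigen (r i) (lam (r i)) (v (r i))" for i using se r(2) by blast
  have "rate \<le> \<mu>" by (rule LIMSEQ_le_const[OF \<mu>]) (use ser in \<open>auto simp: step_eigen_def\<close>)
  moreover have "w 1 = 1"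
  proof -
    have "v (r i) 1 = 1" for i using ser[of i] by (simp add: step_eigen_def)
    then show ?thesis using wl[OF one_in_Lam] by (simp add: LIMSEQ_const_iff)
  qed
  moreover have "\<bar>w x\<bar> \<le> 1" if x: "x \<in> Lam g" for x
  proof (rule LIMSEQ_le_const2[OF tendsto_rabs[OF wl[OF x]]])
    show "\<exists>N. \<forall>n\<ge>N. \<bar>v (r n) x\<bar> \<le> 1" using ser x unfolding step_eigen_def by (intro exI[of _ 0]) fastforce
  qed
  moreover have "- w (- t * x) / t + ph (y1 x) * w (y1 x) = \<mu> * w x" if x: "x \<in> Lam g" for x
  proof (rule LIMSEQ_unique)
    have eq: "- v (r i) (- t * x) / t + phi_n g (r i) (y1 x) * v (r i) (y1 x) = lam (r i) * v (r i) x" for i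
      using ser[of i] x by (simp add: step_eigen_def)
    have ph_lim: "(\<lambda>i. phi_n g (r i) (y1 x)) \<longlonglongrightarrow> ph (y1 x)"
      using LIMSEQ_subseq_LIMSEQ[OF phi_n_tendsto[OF x] s] by (simp add: r_def o_def)
    show "(\<lambda>i. lam (r i) * v (r i) x) \<longlonglongrightarrow> - w (- t * x) / t + ph (y1 x) * w (y1 x)"
      unfolding eq[symmetric] using t_pos by (intro tendsto_intros ph_lim wl Lam_y0 Lam_y1 x) auto
    show "(\<lambda>i. lam (r i) * v (r i) x) \<longlonglongrightarrow> \<mu> * w x" by (intro tendsto_intros \<mu> wl x)
  qed
  moreover have "\<bar>w x - w x'\<bar> \<le> K * (hi M i - lo M i)" 
    if "m0 \<le> M" "i \<in> {1..2 ^ M}" and x: "x \<in> Lam g \<inter> cyl M i" "x' \<in> Lam g \<inter> cyl M i" for M i x x'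
  proof (rule LIMSEQ_le_const2)
    show "(\<lambda>n. \<bar>v (r n) x - v (r n) x'\<bar>) \<longlonglongrightarrow> \<bar>w x - w x'\<bar>"
      using x by (intro tendsto_intros wl) auto
    show "\<exists>N. \<forall>n\<ge>N. \<bar>v (r n) x - v (r n) x'\<bar> \<le> K * (hi M i - lo M i)"
      using osc[OF r(2) ser that] by blast
  qed
  ultimately have "limit_eigen \<mu> w" using K unfolding limit_eigen_def by blast
  then show ?thesis using that[of lam v r \<mu> w] se r \<mu> w by blast
qed

end

section \<open>The analytic eigenfunction\<close>

text \<open>\<open>Y\<close> is the inverse of \<open>\<sigma>\<close> onto \<open>\<Omega>\<^sub>1\<close> and \<open>F\<close> the weight along it; the inverse onto \<open>\<Omega>\<^sub>0\<close> is
  multiplication by \<open>- t\<close>.\<close>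

locale analytic_branches = feigenbaum +
  fixes \<Omega> :: "complex set" and F Y :: "complex \<Rightarrow> complex"
  assumes open_\<Omega>: "open \<Omega>" and conn_\<Omega>: "connected \<Omega>" and bdd_\<Omega>: "bounded \<Omega>"
    and J_\<Omega>: "\<And>x. x \<in> {-t..1} \<Longrightarrow> of_real x \<in> \<Omega>"
    and hol_F: "F holomorphic_on \<Omega>" and cont_F: "continuous_on (closure \<Omega>) F"
    and F_real: "\<And>x. x \<in> {-t..1} \<Longrightarrow> F (of_real x) = of_real (ph (y1 x))"
    and hol_Y: "Y holomorphic_on \<Omega>" and cont_Y: "continuous_on (closure \<Omega>) Y"
    and Y_real: "\<And>x. x \<in> {-t..1} \<Longrightarrow> Y (of_real x) = of_real (y1 x)"
    and Y_\<Omega>: "\<And>z. z \<in> \<Omega> \<Longrightarrow> Y z \<in> \<Omega>" and Y0_\<Omega>: "\<And>z. z \<in> \<Omega> \<Longrightarrow> of_real (- t) * z \<in> \<Omega>"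
    and F_Y: "\<And>z. z \<in> \<Omega> \<Longrightarrow> F z * deriv Y z = 1" and F_ge: "\<And>z. z \<in> \<Omega> \<Longrightarrow> 1 \<le> cmod (F z)"
    and contr: "\<exists>\<theta><1. \<exists>\<delta>>0. \<forall>z\<in>\<Omega>. \<forall>z'\<in>\<Omega>. dist z z' < \<delta> \<longrightarrow> dist (Y z) (Y z') \<le> \<theta> * dist z z'"

text \<open>The extension of \<open>\<sigma>\<close> to the boundary of \<open>\<Omega>\<^sub>1\<close> need not be invertible there. Continuity of \<open>F\<close>
  and \<open>Y\<close> up to the boundary of \<open>\<Omega>\<close> comes instead from applying the transfer operator to the functions
  \<open>1\<close> and \<open>z\<close>, which recovers \<open>F\<close> and then \<open>F * Y\<close>.\<close>

lemma (in feigenbaum) expanding_extension_branches: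
  fixes S :: "complex \<Rightarrow> complex" and \<Omega> \<Omega>0 \<Omega>1 :: "complex set"
  assumes bdd: "bounded \<Omega>" and ext: "expanding_extension g \<Omega> \<Omega>0 \<Omega>1 S"
    and operator: "\<And>v. v \<in> V_analytic (intJ g) \<Omega> \<Longrightarrow> transfer_op g (phi g) v \<in> V_analytic (intJ g) \<Omega>"
  shows "\<exists>F Y. analytic_branches g G U \<Omega> F Y"
proof -
  have br: "expanding_branch g {-t..t\<^sup>2} \<Omega> \<Omega>0 S" "expanding_branch g {b..1} \<Omega> \<Omega>1 S"
    using ext unfolding expanding_extension_def intervals by auto
  have 0: "open \<Omega>0" "connected \<Omega>0" "of_real ` {-t..t\<^sup>2} \<subseteq> \<Omega>0" "\<Omega>0 \<subseteq> \<Omega>" "S holomorphic_on \<Omega>0" "bij_betw S \<Omega>0 \<Omega>"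
    and S0: "\<And>x. x \<in> {-t..t\<^sup>2} \<Longrightarrow> S (of_real x) = of_real (sigma g x)"
    using br(1) unfolding expanding_branch_def by auto
  have 1: "open \<Omega>1" "connected \<Omega>1" "of_real ` {b..1} \<subseteq> \<Omega>1" "\<Omega>1 \<subseteq> \<Omega>" "S holomorphic_on \<Omega>1" "bij_betw S \<Omega>1 \<Omega>"
    and S1: "\<And>x. x \<in> {b..1} \<Longrightarrow> S (of_real x) = of_real (sigma g x)" and exp: "expanding_on \<Omega>1 S"
    using br(2) unfolding expanding_branch_def by auto
  have S\<Omega>: "S ` \<Omega>0 = \<Omega>" "S ` \<Omega>1 = \<Omega>" "inj_on S \<Omega>1" using 0(6) 1(6) by (auto simp: bij_betw_def)
  \<comment> \<open>\<sigma> maps \<open>\<Omega>1\<close> injectively onto \<Omega>, so openness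
    and connectedness are inherited from \<open>\<Omega>1\<close>.\<close>
  have op: "open \<Omega>" unfolding S\<Omega>(2)[symmetric] by (rule open_mapping_thm3[OF 1(5,1) S\<Omega>(3)])
  have conn: "connected \<Omega>" unfolding S\<Omega>(2)[symmetric]
    by (intro connected_continuous_image holomorphic_on_imp_continuous_on 1)
  have y1J: "of_real (y1 x) \<in> \<Omega>1" "S (of_real (y1 x)) = of_real x" if "x \<in> {-t..1}" for x
    using y1_in[OF that] S1[OF y1_in[OF that]] sigma_y1[OF that] 1(3) by auto
  have J: "of_real x \<in> \<Omega>" if "x \<in> {-t..1}" for x
    using y1J[OF that] S\<Omega>(2) by (metis image_eqI)
  have Jsub: "of_real ` {-t..1} \<subseteq> \<Omega>" using J by blast
  have lt: "- t < 1" "- t < t\<^sup>2" using t_pos t_sq_pos by linarith+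
  \<comment> \<open>\<sigma> is linear on \<open>J\<^sub>0\<close>, hence on all of
    \<open>\<Omega>0\<close>. Its inverse there is multiplication by \<open>- t\<close>, which
    therefore maps \<Omega> into itself.\<close>
  have S_lin: "S z = - z / of_real t" if "z \<in> \<Omega>0" for z
  proof (rule identity_on_interval[OF 0(5) _ 0(1,2,3) lt(2) _ that])
    show "(\<lambda>z. - z / of_real t) holomorphic_on \<Omega>0" using t_pos by (intro holomorphic_intros) auto
    show "S (of_real x) = - of_real x / of_real t" if "x \<in> {-t..t\<^sup>2}" for x
      using S0[OF that] sigma_J0[OF that] by simp
  qed
  have Y0: "of_real (- t) * z \<in> \<Omega>" if z: "z \<in> \<Omega>" for z
  proof -
    obtain u where u: "u \<in> \<Omega>0" "z = S u" using z S\<Omega>(1) by auto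
    then have "of_real (- t) * z = u" using S_lin[OF u(1)] t_pos by simp
    then show ?thesis using u 0(4) by auto
  qed
  obtain Y where Y: "Y holomorphic_on \<Omega>" "\<And>z. z \<in> \<Omega>1 \<Longrightarrow> deriv S z * deriv Y (S z) = 1" "\<And>z. z \<in> \<Omega>1 \<Longrightarrow> Y (S z) = z"
    using holomorphic_has_inverse[OF 1(5,1) S\<Omega>(3)] unfolding S\<Omega>(2) by metis
  have Y1: "Y z \<in> \<Omega>1" "S (Y z) = z" if "z \<in> \<Omega>" for z
    using that Y(3) S\<Omega>(2) by auto
  have Y_real: "Y (of_real x) = of_real (y1 x)" if "x \<in> {-t..1}" for x
    using Y(3)[OF y1J(1)[OF that]] y1J(2)[OF that] by simp
  have dS_real: "deriv S (of_real y) = of_real (ph y)" if y: "y \<in> {b..1}" for y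
  proof (rule vector_derivative_unique_within)
    show "at y within {b..1} \<noteq> bot"
      using y b_less_1 by (simp add: trivial_limit_within connected_imp_perfect)
    have "of_real y \<in> \<Omega>1" using y 1(3) by auto
    then have "(S has_field_derivative deriv S (of_real y)) (at (of_real y))" by (rule holomorphic_derivI[OF 1(5,1)])
    then have "((\<lambda>x. S (of_real x)) has_vector_derivative deriv S (of_real y)) (at y)"
      by (rule has_vector_derivative_real_field)
    then show "((\<lambda>x. S (of_real x)) has_vector_derivative deriv S (of_real y)) (at y within {b..1})"
      by (rule has_vector_derivative_at_within)
    have "(g has_real_derivative dg y) (at y within {b..1})"
      by (rule has_field_derivative_subset[OF has_dg]) (use y b_pos in auto)
    then have "((\<lambda>x. - g x / t) has_real_derivative ph y) (at y within {b..1})"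
      using t_pos by (auto intro!: derivative_eq_intros simp: ph_def)
    then have "((\<lambda>x. of_real (- g x / t) :: complex) has_vector_derivative of_real (ph y)) (at y within {b..1})"
      by (intro has_vector_derivative_of_real) (simp add: has_real_derivative_iff_has_vector_derivative)
    then show "((\<lambda>x. S (of_real x)) has_vector_derivative of_real (ph y)) (at y within {b..1})"
      by (rule has_vector_derivative_transform[OF y, rotated]) (simp add: S1 sigma_J1)
  qed
  define f where "f z = deriv S (Y z)" for z
  have hol_f: "f holomorphic_on \<Omega>"
    unfolding f_def by (rule holomorphic_on_compose_gen[OF Y(1) holomorphic_deriv[OF 1(5,1)], unfolded o_def])
      (use Y1 in auto)
  have f_real: "f (of_real x) = of_real (ph (y1 x))" if "x \<in> {-t..1}" for x
    using dS_real[OF y1_in[OF that]] Y_real[OF that] by (simp add: f_def)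
  have f_Y: "f z * deriv Y z = 1" if "z \<in> \<Omega>" for z
    using Y(2)[OF Y1(1)[OF that]] Y1(2)[OF that] by (simp add: f_def)
  obtain \<nu> \<epsilon> where \<nu>: "\<nu> > 1" "\<epsilon> > 0" "\<And>x y. x \<in> \<Omega>1 \<Longrightarrow> y \<in> \<Omega>1 \<Longrightarrow> dist x y < \<epsilon> \<Longrightarrow> \<nu> * dist x y \<le> dist (S x) (S y)"
    using exp unfolding expanding_on_def by blast
  have f_ge: "\<nu> \<le> cmod (f z)" if "z \<in> \<Omega>" for z
    unfolding f_def by (rule expanding_deriv_ge[OF 1(1,5) Y1(1)[OF that] \<nu>(2,3)])
  have ext: "\<exists>A. A holomorphic_on \<Omega> \<and> continuous_on (closure \<Omega>) A \<and>
      (\<forall>x\<in>{-t..1}. A (of_real x) = of_real (- v (- t * x) / t + ph (y1 x) * v (y1 x)))"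
    if "v \<in> V_analytic (intJ g) \<Omega>" for v
  proof -
    have "transfer_op g (phi g) v x = - v (- t * x) / t + ph (y1 x) * v (y1 x)" if x: "x \<in> {-t..1}" for x
      unfolding transfer_op_eq[OF x] phi_J0[OF scaled_J[OF x]] phi_J1[OF y1_in[OF x]] by simp
    then show ?thesis using operator[OF that] unfolding V_analytic_def intervals by auto
  qed
  have "(\<lambda>_. 1) \<in> V_analytic (intJ g) \<Omega>"
    unfolding V_analytic_def by (auto intro!: exI[of _ "\<lambda>_. 1"])
  from ext[OF this] obtain A where A: "A holomorphic_on \<Omega>" "continuous_on (closure \<Omega>) A" 
    "\<And>x. x \<in> {-t..1} \<Longrightarrow> A (of_real x) = of_real (- 1 / t + ph (y1 x))" by auto
  have "(\<lambda>x. x) \<in> V_analytic (intJ g) \<Omega>"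
    unfolding V_analytic_def by (auto intro!: exI[of _ "\<lambda>z. z"] holomorphic_intros continuous_intros)
  from ext[OF this] obtain B where B: "B holomorphic_on \<Omega>" "continuous_on (closure \<Omega>) B" 
    "\<And>x. x \<in> {-t..1} \<Longrightarrow> B (of_real x) = of_real (- (- t * x) / t + ph (y1 x) * y1 x)" by auto
  define F where "F z = A z + of_real (1 / t)" for z
  have hol_F: "F holomorphic_on \<Omega>" unfolding F_def by (intro holomorphic_intros A)
  have F_cont: "continuous_on (closure \<Omega>) F" unfolding F_def by (intro continuous_intros A)
  have F_f: "F z = f z" if "z \<in> \<Omega>" for z
  proof (rule identity_on_interval[OF hol_F hol_f op conn Jsub lt(1) _ that])
    show "F (of_real x) = f (of_real x)" if x: "x \<in> {-t..1}" for x
      unfolding f_real[OF x] F_def A(3)[OF x] by simp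
  qed
  \<comment> \<open>Expansion bounds \<open>F\<close> away from 0 up to the boundary, so division by
    \<open>F\<close> keeps continuity there.\<close>
  have F_ge: "\<nu> \<le> cmod (F z)" if "z \<in> closure \<Omega>" for z
    by (rule continuous_ge_on_closure[OF _ that]) (use F_f f_ge F_cont in \<open>auto intro!: continuous_intros\<close>)
  then have F0: "F z \<noteq> 0" if "z \<in> closure \<Omega>" for z using that \<nu>(1) by fastforce
  \<comment> \<open>For the function \<open>z\<close> the left branch contributes
    \<open>- (- t * z) / t = z\<close>, so \<open>B z - z\<close> is \<open>F z * Y z\<close> inside
    \<Omega>.\<close>
  define Y' where "Y' z = (B z - z) / F z" for z
  have Y'_cont: "continuous_on (closure \<Omega>) Y'"
    unfolding Y'_def by (intro continuous_intros B F_cont) (use F0 in auto)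
  have Y'_Y: "Y' z = Y z" if z: "z \<in> \<Omega>" for z
  proof -
    have "B z - z = f z * Y z"
    proof (rule identity_on_interval[OF _ _ op conn Jsub lt(1) _ z])
      show "B (of_real x) - of_real x = f (of_real x) * Y (of_real x)" if x: "x \<in> {-t..1}" for x
        unfolding f_real[OF x] B(3)[OF x] Y_real[OF x] using t_pos by simp
    qed (intro holomorphic_intros B hol_f Y)+
    then show ?thesis using F_f[OF z] F0[of z] z closure_subset[of \<Omega>] by (auto simp: Y'_def)
  qed
  have hol_Y': "Y' holomorphic_on \<Omega>" by (rule holomorphic_transform[OF Y(1)]) (simp add: Y'_Y)
  have "analytic_branches g G U \<Omega> F Y'"
  proof unfold_locales
    show "1 \<le> cmod (F z)" if "z \<in> \<Omega>" for z using f_ge[OF that] F_f[OF that] \<nu>(1) by simp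
    show "F z * deriv Y' z = 1" if z: "z \<in> \<Omega>" for z
    proof -
      have "\<forall>\<^sub>F w in nhds z. Y' w = Y w"
        using eventually_nhds_in_open[OF op z] by eventually_elim (rule Y'_Y)
      then have "deriv Y' z = deriv Y z" by (rule deriv_cong_ev) simp
      then show ?thesis using f_Y[OF z] F_f[OF z] by simp
    qed
    show "F (of_real x) = of_real (ph (y1 x))" if "x \<in> {-t..1}" for x
      using F_f[OF J[OF that]] f_real[OF that] by simp
    show "Y' (of_real x) = of_real (y1 x)" if "x \<in> {-t..1}" for x
      using Y'_Y[OF J[OF that]] Y_real[OF that] by simp
    show "Y' z \<in> \<Omega>" if "z \<in> \<Omega>" for z using Y'_Y[OF that] Y1(1)[OF that] 1(4) by auto
    show "\<exists>\<theta><1. \<exists>\<delta>>0. \<forall>z\<in>\<Omega>. \<forall>z'\<in>\<Omega>. dist z z' < \<delta> \<longrightarrow> dist (Y' z) (Y' z') \<le> \<theta> * dist z z'"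
    proof -
      have "compact (closure \<Omega>)" using bdd by (simp add: compact_closure)
      \<comment> \<open>The expansion of \<sigma> is known for nearby points of
        \<open>\<Omega>1\<close>; uniform continuity ensures that nearby points of \<Omega> have
        such images.\<close>
      then have "uniformly_continuous_on (closure \<Omega>) Y'" using Y'_cont by (rule compact_uniformly_continuous[rotated])
      then obtain \<delta> where \<delta>: "\<delta> > 0" "\<And>z z'. z \<in> closure \<Omega> \<Longrightarrow> z' \<in> closure \<Omega> \<Longrightarrow> dist z' z < \<delta> \<Longrightarrow> dist (Y' z') (Y' z) < \<epsilon>"
        using \<nu>(2) unfolding uniformly_continuous_on_def by metis
      have "dist (Y' z) (Y' z') \<le> 1 / \<nu> * dist z z'" if z: "z \<in> \<Omega>" "z' \<in> \<Omega>" "dist z z' < \<delta>" for z z'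
      proof -
        have "dist (Y' z) (Y' z') < \<epsilon>" using \<delta>(2)[of z' z] z closure_subset[of \<Omega>] by blast
        then have "\<nu> * dist (Y z) (Y z') \<le> dist (S (Y z)) (S (Y z'))"
          using z Y1 by (intro \<nu>(3)) (auto simp: Y'_Y)
        then show ?thesis using z Y1(2) \<nu>(1) by (simp add: Y'_Y field_simps)
      qed
      then show ?thesis using \<delta>(1) \<nu>(1) by (intro exI[of _ "1 / \<nu>"] conjI exI[of _ \<delta>]) auto
    qed
  qed (fact op conn bdd J hol_F F_cont hol_Y' Y'_cont Y0)+
  then show ?thesis by blast
qed

section \<open>Inverse branches on the closure of \<Omega>\<close>

context analytic_branches
begin

definition Z :: "complex \<Rightarrow> complex" where "Z z = of_real (- t) * z"

lemma Z_real: "Z (of_real x) = of_real (- t * x)" by (simp add: Z_def)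

lemma dist_Z: "dist (Z z) (Z z') = t * dist z z'"
proof -
  have "Z z - Z z' = of_real (- t) * (z - z')" by (simp add: Z_def algebra_simps)
  then show ?thesis using t_pos by (simp add: dist_norm norm_mult del: of_real_minus)
qed

lemma hol_Z: "Z holomorphic_on A" and cont_Z: "continuous_on B Z"
  unfolding Z_def by (intro holomorphic_intros continuous_intros)+

lemma Z_\<Omega>: "z \<in> \<Omega> \<Longrightarrow> Z z \<in> \<Omega>" using Y0_\<Omega> by (simp add: Z_def)

lemma closure_Z: "z \<in> closure \<Omega> \<Longrightarrow> Z z \<in> closure \<Omega>"
  using image_closure_subset[OF cont_Z closed_closure, of \<Omega> \<Omega>] Z_\<Omega> closure_subset[of \<Omega>] by blast

lemma closure_Y: "z \<in> closure \<Omega> \<Longrightarrow> Y z \<in> closure \<Omega>"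
  using image_closure_subset[OF cont_Y closed_closure, of \<Omega>] Y_\<Omega> closure_subset[of \<Omega>] by blast

lemma J_closure: "x \<in> {-t..1} \<Longrightarrow> of_real x \<in> closure \<Omega>"
  using J_\<Omega> closure_subset by blast

lemma compact_closure_\<Omega>: "compact (closure \<Omega>)"
  using bdd_\<Omega> by (simp add: compact_closure)

text \<open>The strict bound on the distance persists along approximating sequences, so the estimate
  inside \<Omega> passes to the limit. The maximum with \<open>t\<close> gives one nonnegative
  factor for both branches.\<close>

lemma contraction_closure:
  "\<exists>\<theta>\<ge>0. \<theta> < 1 \<and> (\<exists>\<delta>>0. \<forall>z\<in>closure \<Omega>. \<forall>z'\<in>closure \<Omega>. dist z z' < \<delta> \<longrightarrow>
     dist (Z z) (Z z') \<le> \<theta> * dist z z' \<and> dist (Y z) (Y z') \<le> \<theta> * dist z z')"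
proof -
  obtain \<theta> \<delta> where \<theta>: "\<theta> < 1" and \<delta>: "\<delta> > 0" 
    and c: "\<And>z z'. z \<in> \<Omega> \<Longrightarrow> z' \<in> \<Omega> \<Longrightarrow> dist z z' < \<delta> \<Longrightarrow> dist (Y z) (Y z') \<le> \<theta> * dist z z'"
    using contr by blast
  define \<theta>' where "\<theta>' = max \<theta> t"
  have Yc: "dist (Y z) (Y z') \<le> \<theta> * dist z z'" if z: "z \<in> closure \<Omega>" "z' \<in> closure \<Omega>" "dist z z' < \<delta>" for z z'
  proof -
    obtain u u' where u: "\<And>n. u n \<in> \<Omega>" "u \<longlonglongrightarrow> z" and u': "\<And>n. u' n \<in> \<Omega>" "u' \<longlonglongrightarrow> z'"
      using z(1,2) unfolding closure_sequential by blast
    have Yl: "(\<lambda>n. Y (v n)) \<longlonglongrightarrow> Y y" if "\<And>n. v n \<in> \<Omega>" "v \<longlonglongrightarrow> y" "y \<in> closure \<Omega>" for v y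
      by (rule continuous_on_tendsto_compose[OF cont_Y that(2,3)]) 
         (use that(1) closure_subset[of \<Omega>] in \<open>auto intro!: always_eventually\<close>)
    have d: "(\<lambda>n. dist (u n) (u' n)) \<longlonglongrightarrow> dist z z'" by (intro tendsto_dist u u')
    show ?thesis
    proof (rule tendsto_le[OF sequentially_bot])
      show "(\<lambda>n. dist (Y (u n)) (Y (u' n))) \<longlonglongrightarrow> dist (Y z) (Y z')"
        by (intro tendsto_dist Yl u u' z)
      show "(\<lambda>n. \<theta> * dist (u n) (u' n)) \<longlonglongrightarrow> \<theta> * dist z z'" by (intro tendsto_intros d)
      show "\<forall>\<^sub>F n in sequentially. dist (Y (u n)) (Y (u' n)) \<le> \<theta> * dist (u n) (u' n)"
        using order_tendstoD(2)[OF d z(3)] by eventually_elim (intro c u u')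
    qed
  qed
  have "dist (Y z) (Y z') \<le> \<theta>' * dist z z'" if "z \<in> closure \<Omega>" "z' \<in> closure \<Omega>" "dist z z' < \<delta>" for z z'
    using Yc[OF that] mult_right_mono[of \<theta> \<theta>' "dist z z'"] by (auto simp: \<theta>'_def)
  moreover have "dist (Z z) (Z z') \<le> \<theta>' * dist z z'" for z z'
    unfolding dist_Z by (intro mult_right_mono) (auto simp: \<theta>'_def)
  moreover have "0 \<le> \<theta>'" "\<theta>' < 1" using t_pos t_less_1 \<theta> by (auto simp: \<theta>'_def)
  ultimately show ?thesis using \<delta> by (intro exI[of _ \<theta>'] conjI exI[of _ \<delta>]) auto
qed

text \<open>The largest distance between the images of \<open>z\<close> and \<open>z'\<close> under
  the same composition of \<open>k\<close> inverse branches.\<close>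

primrec spread :: "nat \<Rightarrow> complex \<Rightarrow> complex \<Rightarrow> real" where
  "spread 0 z z' = dist z z'"
| "spread (Suc k) z z' = max (spread k (Z z) (Z z')) (spread k (Y z) (Y z'))"

lemma spread_sym: "spread k z z' = spread k z' z"
  by (induction k arbitrary: z z') (simp add: dist_commute, metis spread.simps(2))

lemma spread_triangle: "spread k z z'' \<le> spread k z z' + spread k z' z''"
proof (induction k arbitrary: z z' z'')
  case 0 show ?case by (simp add: dist_triangle)
next
  case (Suc k)
  show ?case using Suc[of "Z z" "Z z''" "Z z'"] Suc[of "Y z" "Y z''" "Y z'"] by (simp add: max_def)
qed

text \<open>The branches contract only locally; connectedness and compactness of \<open>closure \<Omega>\<close> make their
  iterates contract globally.\<close>

lemma spread_uniformly_small:
  assumes r: "r > 0"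
  shows "\<exists>k. \<forall>z\<in>closure \<Omega>. spread k z 1 \<le> r"
proof -
  obtain \<theta> \<delta> where \<theta>: "0 \<le> \<theta>" "\<theta> < 1" and \<delta>: "\<delta> > 0"
    and c: "\<And>z z'. z \<in> closure \<Omega> \<Longrightarrow> z' \<in> closure \<Omega> \<Longrightarrow> dist z z' < \<delta> \<Longrightarrow>
     dist (Z z) (Z z') \<le> \<theta> * dist z z' \<and> dist (Y z) (Y z') \<le> \<theta> * dist z z'"
    using contraction_closure by blast
  have le: "\<theta> * d \<le> d" if "0 \<le> d" for d using \<theta> that by (simp add: mult_left_le_one_le)
  have loc: "spread k z z' \<le> \<theta> ^ k * dist z z'" 
    if "z \<in> closure \<Omega>" "z' \<in> closure \<Omega>" "dist z z' < \<delta>" for k z z'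
    using that
  proof (induction k arbitrary: z z')
    case (Suc k)
    have d: "dist (Z z) (Z z') \<le> \<theta> * dist z z'" "dist (Y z) (Y z') \<le> \<theta> * dist z z'"
      using c[OF Suc.prems] by auto
    then have "dist (Z z) (Z z') < \<delta>" "dist (Y z) (Y z') < \<delta>" using le[of "dist z z'"] Suc.prems(3) by auto
    then have "spread k (Z z) (Z z') \<le> \<theta> ^ k * dist (Z z) (Z z')" "spread k (Y z) (Y z') \<le> \<theta> ^ k * dist (Y z) (Y z')"
      using Suc closure_Z closure_Y by auto
    moreover have "\<theta> ^ k * dist (Z z) (Z z') \<le> \<theta> ^ k * (\<theta> * dist z z')" "\<theta> ^ k * dist (Y z) (Y z') \<le> \<theta> ^ k * (\<theta> * dist z z')"
      using d \<theta> by (auto intro!: mult_left_mono)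
    ultimately show ?case by (simp add: mult_ac)
  qed simp
  \<comment> \<open>Exponential closeness is an equivalence relation with open classes by
    \<open>loc\<close>; connectedness leaves a single class. As \<open>C\<close> depends on the
    points, a finite \<delta>-net is used afterwards for uniformity.\<close>
  define R where "R z z' \<longleftrightarrow> (\<exists>C. \<forall>k. spread k z z' \<le> \<theta> ^ k * C)" for z z'
  have one: "1 \<in> closure \<Omega>" using J_closure[of 1] t_pos by simp
  have R: "R z 1" if z: "z \<in> closure \<Omega>" for z
  proof (rule connected_equivalence_relation[OF _ z one])
    show "connected (closure \<Omega>)" using conn_\<Omega> by (rule connected_imp_connected_closure)
    show "R y x" if "R x y" for x y using that unfolding R_def by (subst spread_sym)
    show "R x z" if xy: "R x y" and yz: "R y z" for x y z
    proof -
      obtain C C' where "\<And>k. spread k x y \<le> \<theta> ^ k * C" "\<And>k. spread k y z \<le> \<theta> ^ k * C'"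
        using xy yz unfolding R_def by blast
      then have "spread k x y + spread k y z \<le> \<theta> ^ k * C + \<theta> ^ k * C'" for k by (intro add_mono)
      then have "spread k x z \<le> \<theta> ^ k * (C + C')" for k
        unfolding distrib_left by (rule order_trans[OF spread_triangle])
      then show ?thesis unfolding R_def by blast
    qed
    show "\<exists>T. openin (top_of_set (closure \<Omega>)) T \<and> a \<in> T \<and> (\<forall>x\<in>T. R a x)" if a: "a \<in> closure \<Omega>" for a
    proof (intro exI conjI ballI)
      show "openin (top_of_set (closure \<Omega>)) (closure \<Omega> \<inter> ball a \<delta>)" by (intro openin_open_Int) simp
      show "R a x" if "x \<in> closure \<Omega> \<inter> ball a \<delta>" for x
        unfolding R_def using loc[OF a, of x] that by auto
    qed (use a \<delta> in auto)
  qed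
  obtain A where A: "finite A" "A \<subseteq> closure \<Omega>" "closure \<Omega> \<subseteq> (\<Union>x\<in>A. ball x \<delta>)"
  proof -
    have "\<exists>A. finite A \<and> A \<subseteq> closure \<Omega> \<and> closure \<Omega> \<subseteq> (\<Union>x\<in>A. ball x \<delta>)"
      by (rule seq_compact_imp_totally_bounded[rule_format, OF compact_imp_seq_compact[OF compact_closure_\<Omega>] \<delta>])
    then show ?thesis using that by blast
  qed
  have "\<forall>\<^sub>F k in sequentially. \<forall>a\<in>A. spread k a 1 + \<theta> ^ k * \<delta> < r"
    unfolding eventually_ball_finite_distrib[OF A(1)]
  proof
    fix a assume "a \<in> A"
    then have "R a 1" using R A(2) by blast
    then obtain C where C: "\<And>k. spread k a 1 \<le> \<theta> ^ k * C" unfolding R_def by blast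
    have "(\<lambda>k. \<theta> ^ k * C + \<theta> ^ k * \<delta>) \<longlonglongrightarrow> 0 * C + 0 * \<delta>"
      using \<theta> by (intro tendsto_intros LIMSEQ_power_zero) auto
    then have "\<forall>\<^sub>F k in sequentially. \<theta> ^ k * C + \<theta> ^ k * \<delta> < r" using r by (intro order_tendstoD) auto
    then show "\<forall>\<^sub>F k in sequentially. spread k a 1 + \<theta> ^ k * \<delta> < r"
      by eventually_elim (use C in \<open>meson add_right_mono order.strict_trans1\<close>)
  qed
  then obtain k where k: "\<And>a. a \<in> A \<Longrightarrow> spread k a 1 + \<theta> ^ k * \<delta> < r"
    by (metis (mono_tags, lifting) eventually_sequentially order_refl)
  have "spread k z 1 \<le> r" if z: "z \<in> closure \<Omega>" for z
  proof -
    obtain a where a: "a \<in> A" "dist a z < \<delta>" using A(3) z by auto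
    have "spread k z a \<le> \<theta> ^ k * dist z a" using a A z by (intro loc) (auto simp: dist_commute)
    also have "\<dots> \<le> \<theta> ^ k * \<delta>" using a \<theta> by (intro mult_left_mono) (auto simp: dist_commute)
    finally show ?thesis using spread_triangle[of k z 1 a] k[OF a(1)] by linarith
  qed
  then show ?thesis by blast
qed

text \<open>The complex form of the weight-times-length estimate: pointwise
  \<open>cmod (F u) * cmod (deriv Y u) = 1\<close>, on a small ball \<open>F\<close> varies by a
  small relative amount because its modulus is at least 1, and convexity of the ball gives the mean
  value inequality.\<close>

lemma local_estimates:
  assumes \<eta>: "\<eta> > 0"
  shows "\<exists>r>0. \<exists>C\<ge>0. \<forall>p\<in>{-t..1}. \<forall>z. dist z (of_real p) \<le> r \<longrightarrow>
    cmod (F z - F (of_real p)) \<le> C * dist z (of_real p) \<and>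
    cmod (F z) * dist (Y z) (Y (of_real p)) \<le> (1 + \<eta>) * dist z (of_real p) \<and>
    dist (Y z) (Y (of_real p)) \<le> dist z (of_real p)"
proof -
  define J where "J = (of_real ` {-t..1} :: complex set)"
  have J: "compact J" unfolding J_def by (intro compact_continuous_image continuous_intros) auto
  obtain r0 where r0: "r0 > 0" "(\<Union>x\<in>J. cball x r0) \<subseteq> \<Omega>"
    using compact_subset_open_imp_cball_epsilon_subset[OF J open_\<Omega>] J_\<Omega> unfolding J_def by blast
  define K where "K = (\<Union>x\<in>J. \<Union>y\<in>cball 0 r0. {x + y})"
  have K: "compact K" unfolding K_def by (intro compact_sums' J) simp
  have inK: "z \<in> K" if "x \<in> J" "dist z x \<le> r0" for z x
  proof -
    have "z \<in> (\<Union>y\<in>cball 0 r0. {x + y})"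
      using that by (intro UN_I[of "z - x"]) (auto simp: dist_norm norm_minus_commute)
    then show ?thesis unfolding K_def using that(1) by blast
  qed
  have K\<Omega>: "K \<subseteq> \<Omega>" using r0(2) unfolding K_def by (force simp: dist_norm)
  have "continuous_on K (deriv F)"
    by (intro holomorphic_on_imp_continuous_on holomorphic_on_subset[OF holomorphic_deriv[OF hol_F open_\<Omega>]] K\<Omega>)
  then have "bounded (deriv F ` K)" using K by (intro compact_imp_bounded compact_continuous_image)
  then obtain C where C: "C > 0" "\<And>z. z \<in> K \<Longrightarrow> cmod (deriv F z) \<le> C"
    unfolding bounded_pos by auto
  \<comment> \<open>A ball of radius \<open>r\<close> has diameter \<open>2 * r\<close>, over which
    \<open>F\<close> changes by at most \<open>2 * C * r \<le> \<eta>\<close>.\<close>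
  define r where "r = min r0 (\<eta> / (2 * C))"
  have r: "r > 0" "r \<le> r0" "2 * C * r \<le> \<eta>" 
    using r0(1) C(1) \<eta> by (auto simp: r_def min_def field_simps)
  have "cmod (F z - F p) \<le> C * dist z p \<and> cmod (F z) * dist (Y z) (Y p) \<le> (1 + \<eta>) * dist z p \<and> dist (Y z) (Y p) \<le> dist z p"
    if p: "p \<in> J" and zp: "dist z p \<le> r" for z p
  proof -
    define B where "B = cball p r"
    have B: "u \<in> K" "u \<in> \<Omega>" if "u \<in> B" for u 
      using inK[OF p, of u] K\<Omega> that r(2) by (auto simp: B_def dist_commute)
    have zB: "z \<in> B" "p \<in> B" using zp r(1) by (auto simp: B_def dist_commute)
    have FB: "cmod (F u - F u') \<le> C * cmod (u - u')" if "u \<in> B" "u' \<in> B" for u u'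
      by (rule field_differentiable_bound[of B F "deriv F"])
        (use that B C(2) holomorphic_derivI[OF hol_F open_\<Omega>] in \<open>auto simp: B_def\<close>)
    have Y': "(Y has_field_derivative deriv Y u) (at u within B)" "cmod (deriv Y u) = 1 / cmod (F u)" "1 \<le> cmod (F u)"
      if "u \<in> B" for u
    proof -
      show "(Y has_field_derivative deriv Y u) (at u within B)" by (rule holomorphic_derivI[OF hol_Y open_\<Omega> B(2)[OF that]])
      show F1: "1 \<le> cmod (F u)" using F_ge[OF B(2)[OF that]] .
      moreover have "cmod (F u) * cmod (deriv Y u) = 1" using F_Y[OF B(2)[OF that]] by (metis norm_mult norm_one)
      ultimately show "cmod (deriv Y u) = 1 / cmod (F u)" by (subst nonzero_eq_divide_eq) (auto simp: mult.commute)
    qed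
    have 1: "cmod (Y z - Y p) \<le> 1 * cmod (z - p)"
    proof (rule field_differentiable_bound[OF _ Y'(1) _ zB])
      fix u assume u: "u \<in> B"
      have "0 < cmod (F u)" using Y'(3)[OF u] by linarith
      then show "cmod (deriv Y u) \<le> 1" unfolding Y'(2)[OF u] using Y'(3)[OF u] by simp
    qed (simp add: B_def)
    have Fz: "1 \<le> cmod (F z)" by (rule Y'(3)[OF zB(1)])
    have 2: "cmod (Y z - Y p) \<le> (1 + \<eta>) / cmod (F z) * cmod (z - p)"
    proof (rule field_differentiable_bound[OF _ Y'(1) _ zB])
      show "convex B" by (simp add: B_def)
      fix u assume u: "u \<in> B"
      have "cmod (F z) \<le> cmod (F u) + cmod (F z - F u)" by (metis norm_triangle_sub)
      also have "\<dots> \<le> cmod (F u) + C * (2 * r)"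
      proof -
        have "cmod (z - u) \<le> 2 * r"
          using u zp dist_triangle[of z u p] by (auto simp: B_def dist_norm norm_minus_commute)
        then have "C * cmod (z - u) \<le> C * (2 * r)" using C(1) by (intro mult_left_mono) auto
        then show ?thesis using FB[OF zB(1) u] by simp
      qed
      also have "\<dots> \<le> cmod (F u) + \<eta> * cmod (F u)" 
        using r(3) mult_left_mono[OF Y'(3)[OF u], of \<eta>] \<eta> by (simp only: mult_1_right mult_ac) linarith
      finally have "cmod (F z) \<le> (1 + \<eta>) * cmod (F u)" by (simp add: algebra_simps)
      moreover have "0 < cmod (F u)" "0 < cmod (F z)" using Y'(3)[OF u] Fz by linarith+
      ultimately show "cmod (deriv Y u) \<le> (1 + \<eta>) / cmod (F z)" unfolding Y'(2)[OF u] by (simp add: field_simps)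
    qed
    have "cmod (F z) * cmod (Y z - Y p) \<le> cmod (F z) * ((1 + \<eta>) / cmod (F z) * cmod (z - p))"
      using 2 by (intro mult_left_mono) auto
    also have "\<dots> = (1 + \<eta>) * cmod (z - p)" using Fz by auto
    finally show ?thesis using FB[OF zB] 1 by (simp add: dist_norm)
  qed
  then show ?thesis using r(1) C(1) unfolding J_def by (intro exI[of _ r] conjI exI[of _ C]) auto
qed

text \<open>Iterates of the transfer operator whose values at the preimages of \<open>z\<close> are frozen at the
  corresponding preimages of a base point \<open>p\<close> of the Cantor set. For fixed \<open>p\<close> they are analytic in \<open>z\<close>
  even if \<open>w\<close> is only defined on the Cantor set.\<close>

primrec frozen :: "(real \<Rightarrow> real) \<Rightarrow> nat \<Rightarrow> complex \<Rightarrow> real \<Rightarrow> complex" where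
  "frozen w 0 z p = of_real (w p)"
| "frozen w (Suc N) z p = - frozen w N (Z z) (- t * p) / of_real t + F z * frozen w N (Y z) (y1 p)"

lemma hol_frozen: "(\<lambda>z. frozen w N z p) holomorphic_on \<Omega>"
proof (induction N arbitrary: p)
  case (Suc N)
  have "(\<lambda>z. frozen w N (Z z) (- t * p)) holomorphic_on \<Omega>" "(\<lambda>z. frozen w N (Y z) (y1 p)) holomorphic_on \<Omega>"
    using holomorphic_on_compose_gen[OF hol_Z Suc] holomorphic_on_compose_gen[OF hol_Y Suc] Z_\<Omega> Y_\<Omega>
    unfolding o_def by blast+
  then show ?case using t_pos unfolding frozen.simps by (intro holomorphic_intros hol_F) auto
qed simp

lemma cont_frozen: "continuous_on (closure \<Omega>) (\<lambda>z. frozen w N z p)"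
proof (induction N arbitrary: p)
  case (Suc N)
  have "continuous_on (closure \<Omega>) (\<lambda>z. frozen w N (Z z) (- t * p))" "continuous_on (closure \<Omega>) (\<lambda>z. frozen w N (Y z) (y1 p))"
    by (rule continuous_on_compose2[OF Suc cont_Z], use closure_Z in blast)
       (rule continuous_on_compose2[OF Suc cont_Y], use closure_Y in blast)
  then show ?case using t_pos unfolding frozen.simps by (intro continuous_intros cont_F) auto
qed simp

lemma Im_frozen: "x \<in> {-t..1} \<Longrightarrow> Im (frozen w N (of_real x) p) = 0"
proof (induction N arbitrary: x p)
  case (Suc N)
  have "- t * x \<in> {-t..1}" "y1 x \<in> {-t..1}" 
    using scaled_J[OF Suc.prems] y1_in[OF Suc.prems] t_sq_less_t t_less_1 b_pos t_pos by auto
  then have "Im (frozen w N (of_real (- t * x)) (- t * p)) = 0" "Im (frozen w N (of_real (y1 x)) (y1 p)) = 0" 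
    using Suc.IH by blast+
  then show ?case unfolding frozen.simps Z_real F_real[OF Suc.prems] Y_real[OF Suc.prems] by simp
qed simp

context
  fixes \<mu> :: real and w :: "real \<Rightarrow> real"
  assumes eigen: "limit_eigen \<mu> w"
begin

definition increment :: "nat \<Rightarrow> complex \<Rightarrow> real \<Rightarrow> complex" where
  "increment N z p = frozen w (Suc N) z p / of_real \<mu> ^ Suc N - frozen w N z p / of_real \<mu> ^ N"

lemma mu_gt: "2 < \<mu>" "rate \<le> \<mu>"
  using eigen rate_gt_2 by (auto simp: limit_eigen_def)

text \<open>By linearity, differences of consecutive normalised iterates obey the recursion of the
  iterates themselves, so bounds for \<open>increment 0\<close> propagate.\<close>

lemma increment_Suc: 
  "increment (Suc N) z p = (- increment N (Z z) (- t * p) / of_real t + F z * increment N (Y z) (y1 p)) / of_real \<mu>"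
proof -
  have alg: "(- a' / \<tau> + f * b') / (m * (m * M)) - (- a / \<tau> + f * b) / (m * M) =
      (- (a' / (m * M) - a / M) / \<tau> + f * (b' / (m * M) - b / M)) / m" 
    if "m \<noteq> 0" "\<tau> \<noteq> 0" "M \<noteq> 0" for a a' b b' f m \<tau> M :: complex
    using that by (simp add: field_simps)
  have "of_real \<mu> \<noteq> (0::complex)" "of_real t \<noteq> (0::complex)" using mu_gt t_pos by auto
  then show ?thesis
    unfolding increment_def frozen.simps(2)[of w "Suc N" z p] frozen.simps(2)[of w N z p] power_Suc
    by (intro alg) auto
qed

text \<open>The eigenvalue equation at \<open>p\<close> cancels all but the change of weight from
  \<open>p\<close> to \<open>z\<close>, so near the Cantor set the first increment is of the order
  of the distance.\<close>

lemma increment_0: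
  assumes p: "p \<in> Lam g"
  shows "increment 0 z p = (F z - F (of_real p)) * of_real (w (y1 p)) / of_real \<mu>"
proof -
  have pJ: "p \<in> {-t..1}" using p Lam_subset by blast
  have "\<mu> * w p = - w (- t * p) / t + ph (y1 p) * w (y1 p)" using eigen p by (simp add: limit_eigen_def)
  then have "w p = (- w (- t * p) / t + ph (y1 p) * w (y1 p)) / \<mu>" using mu_gt by (simp add: field_simps)
  then have "(of_real (w p) :: complex) = (- of_real (w (- t * p)) / of_real t + of_real (ph (y1 p)) * of_real (w (y1 p))) / of_real \<mu>"
    by (metis (no_types, opaque_lifting) of_real_add of_real_divide of_real_minus of_real_mult)
  then show ?thesis
    unfolding increment_def frozen.simps F_real[OF pJ] by (simp add: diff_divide_distrib add_divide_distrib left_diff_distrib)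
qed

text \<open>Again \<open>rate = 2 + 2 * \<eta>\<close>. In \<kappa> the two branches contribute 1
  and \<open>1 + \<eta>\<close>, and the sum stays below \<open>rate \<le> \<mu>\<close>.\<close>

definition \<eta> :: real where "\<eta> = (rate - 2) / 2"
definition \<kappa> :: real where "\<kappa> = (2 + \<eta>) / \<mu>"

lemma \<eta>_pos: "0 < \<eta>" using rate_gt_2 by (simp add: \<eta>_def)

lemma \<kappa>: "0 < \<kappa>" "\<kappa> < 1"
  using mu_gt \<eta>_pos by (auto simp: \<kappa>_def field_simps \<eta>_def)

text \<open>Neither branch increases the distance to the base point beyond \<open>r\<close>, so the
  local estimates apply at every step. Including weights, the left branch reproduces the distance
  and the right one does so up to \<open>1 + \<eta>\<close>; division by \<mu> yields
  \<kappa>.\<close>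

lemma increment_local:
  "\<exists>r>0. \<exists>C\<ge>0. \<forall>N z. \<forall>p\<in>Lam g. dist z (of_real p) \<le> r \<longrightarrow> cmod (increment N z p) \<le> C * \<kappa> ^ N * dist z (of_real p)"
proof -
  obtain r C where r: "r > 0" and C: "C \<ge> 0" and est: "\<And>p z. p \<in> {-t..1} \<Longrightarrow> dist z (of_real p) \<le> r \<Longrightarrow>
    cmod (F z - F (of_real p)) \<le> C * dist z (of_real p) \<and>
    cmod (F z) * dist (Y z) (Y (of_real p)) \<le> (1 + \<eta>) * dist z (of_real p) \<and>
    dist (Y z) (Y (of_real p)) \<le> dist z (of_real p)"
    using local_estimates[OF \<eta>_pos] by blast
  have "cmod (increment N z p) \<le> C * \<kappa> ^ N * dist z (of_real p)" if "p \<in> Lam g" "dist z (of_real p) \<le> r" for N z p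
    using that
  proof (induction N arbitrary: z p)
    case 0
    then have pJ: "p \<in> {-t..1}" using Lam_subset by blast
    have "cmod (increment 0 z p) = cmod (F z - F (of_real p)) * (\<bar>w (y1 p)\<bar> / \<mu>)"
      unfolding increment_0[OF 0(1)] using mu_gt by (simp add: norm_mult norm_divide)
    also have "\<dots> \<le> C * dist z (of_real p) * 1"
      using est[OF pJ 0(2)] eigen Lam_y1[OF 0(1)] mu_gt C by (intro mult_mono) (auto simp: limit_eigen_def)
    finally show ?case by simp
  next
    case (Suc N)
    then have pJ: "p \<in> {-t..1}" using Lam_subset by blast
    define d where "d = dist z (of_real p)"
    have dZ: "dist (Z z) (of_real (- t * p)) = t * d" unfolding d_def Z_real[symmetric] dist_Z ..
    have dY: "dist (Y z) (of_real (y1 p)) \<le> d" "cmod (F z) * dist (Y z) (of_real (y1 p)) \<le> (1 + \<eta>) * d"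
      using est[OF pJ Suc.prems(2)] unfolding Y_real[OF pJ] d_def by auto
    have "t * d \<le> d" using t_pos t_less_1 by (simp add: d_def mult_left_le_one_le)
    then have "dist (Z z) (of_real (- t * p)) \<le> r" "dist (Y z) (of_real (y1 p)) \<le> r"
      using dZ dY(1) Suc.prems(2) by (auto simp: d_def)
    then have IH: "cmod (increment N (Z z) (- t * p)) \<le> C * \<kappa> ^ N * dist (Z z) (of_real (- t * p))"
      "cmod (increment N (Y z) (y1 p)) \<le> C * \<kappa> ^ N * dist (Y z) (of_real (y1 p))"
      using Suc.IH[OF Lam_y0[OF Suc.prems(1)]] Suc.IH[OF Lam_y1[OF Suc.prems(1)]] by blast+
    note IH = IH[unfolded dZ]
    have "cmod (increment (Suc N) z p) \<le> (cmod (increment N (Z z) (- t * p)) / t + cmod (F z) * cmod (increment N (Y z) (y1 p))) / \<mu>"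
    proof -
      have "cmod (- increment N (Z z) (- t * p) / of_real t + F z * increment N (Y z) (y1 p))
          \<le> cmod (- increment N (Z z) (- t * p) / of_real t) + cmod (F z * increment N (Y z) (y1 p))"
        by (rule norm_triangle_ineq)
      then show ?thesis unfolding increment_Suc norm_divide using mu_gt t_pos
        by (auto simp: norm_mult intro!: divide_right_mono)
    qed
    also have "\<dots> \<le> (C * \<kappa> ^ N * (t * d) / t + cmod (F z) * (C * \<kappa> ^ N * dist (Y z) (of_real (y1 p)))) / \<mu>"
      using IH mu_gt t_pos by (intro divide_right_mono add_mono mult_left_mono) auto
    also have "\<dots> = C * \<kappa> ^ N * (d + cmod (F z) * dist (Y z) (of_real (y1 p))) / \<mu>"
      using t_pos by (simp add: algebra_simps)
    also have "\<dots> \<le> C * \<kappa> ^ N * (d + (1 + \<eta>) * d) / \<mu>"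
      using dY(2) mu_gt C \<kappa> by (intro divide_right_mono mult_left_mono add_left_mono) auto
    also have "\<dots> = C * \<kappa> ^ Suc N * d" by (simp add: \<kappa>_def algebra_simps)
    finally show ?case by (simp add: d_def)
  qed
  with r C show ?thesis by blast
qed

text \<open>After \<open>k\<close> steps all corresponding images of \<open>z\<close> and 1 are
  within the radius of the local bound. These steps cost only a fixed factor, \<open>A\<close> being
  a crude bound for the normalised operator.\<close>

lemma increment_global:
  "\<exists>k C. \<forall>N. \<forall>z\<in>closure \<Omega>. cmod (increment (N + k) z 1) \<le> C * \<kappa> ^ N"
proof -
  obtain r C where r: "r > 0" and C: "C \<ge> 0" 
    and loc: "\<And>N z p. p \<in> Lam g \<Longrightarrow> dist z (of_real p) \<le> r \<Longrightarrow> cmod (increment N z p) \<le> C * \<kappa> ^ N * dist z (of_real p)"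
    using increment_local by blast
  have "bounded (F ` closure \<Omega>)"
    by (intro compact_imp_bounded compact_continuous_image cont_F compact_closure_\<Omega>)
  then obtain B where B: "B > 0" "\<And>z. z \<in> closure \<Omega> \<Longrightarrow> cmod (F z) \<le> B" unfolding bounded_pos by auto
  define A where "A = (1 / t + B) / \<mu>"
  have A0: "A \<ge> 0" using t_pos B(1) mu_gt by (auto simp: A_def)
  have it: "cmod (increment (N + k) z p) \<le> A ^ k * (C * \<kappa> ^ N * r)" 
    if "z \<in> closure \<Omega>" "p \<in> Lam g" "spread k z (of_real p) \<le> r" for N k z p
    using that
  proof (induction k arbitrary: z p)
    case 0
    then have "cmod (increment N z p) \<le> C * \<kappa> ^ N * dist z (of_real p)" by (intro loc) auto
    also have "\<dots> \<le> C * \<kappa> ^ N * r" using 0 C \<kappa> by (intro mult_left_mono) auto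
    finally show ?case by simp
  next
    case (Suc k)
    then have pJ: "p \<in> {-t..1}" using Lam_subset by blast
    define E where "E = A ^ k * (C * \<kappa> ^ N * r)"
    have "spread k (Z z) (of_real (- t * p)) \<le> r" "spread k (Y z) (of_real (y1 p)) \<le> r"
      using Suc.prems(3) unfolding spread.simps Z_real Y_real[OF pJ] by auto
    then have IH: "cmod (increment (N + k) (Z z) (- t * p)) \<le> E" "cmod (increment (N + k) (Y z) (y1 p)) \<le> E"
      unfolding E_def using Suc.prems by (auto intro!: Suc.IH closure_Z closure_Y Lam_y1 intro: Lam_y0[simplified])
    have "cmod (- increment (N + k) (Z z) (- t * p) / of_real t + F z * increment (N + k) (Y z) (y1 p))
          \<le> cmod (- increment (N + k) (Z z) (- t * p) / of_real t) + cmod (F z * increment (N + k) (Y z) (y1 p))"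
      by (rule norm_triangle_ineq)
    also have "\<dots> = cmod (increment (N + k) (Z z) (- t * p)) / t + cmod (F z) * cmod (increment (N + k) (Y z) (y1 p))"
      using t_pos by (simp add: norm_mult norm_divide)
    also have "\<dots> \<le> E / t + B * E"
      using IH B Suc.prems(1) t_pos by (intro add_mono divide_right_mono mult_mono) auto
    finally have "cmod (increment (N + Suc k) z p) \<le> (E / t + B * E) / \<mu>"
      unfolding add_Suc_right increment_Suc norm_divide using mu_gt by (auto intro!: divide_right_mono)
    also have "\<dots> = A * E" by (simp add: A_def algebra_simps add_divide_distrib)
    finally show ?case by (simp add: E_def)
  qed
  obtain k where k: "\<And>z. z \<in> closure \<Omega> \<Longrightarrow> spread k z 1 \<le> r" using spread_uniformly_small[OF r] by blast
  have "cmod (increment (N + k) z 1) \<le> (A ^ k * C * r) * \<kappa> ^ N" if "z \<in> closure \<Omega>" for N z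
    using it[OF that one_in_Lam, of k N] k[OF that] by (simp add: mult_ac)
  then show ?thesis by blast
qed

lemma frozen_limit:
  "\<exists>\<Phi>. uniform_limit (closure \<Omega>) (\<lambda>N z. frozen w N z 1 / of_real \<mu> ^ N) \<Phi> sequentially"
proof -
  obtain k C where kC: "\<And>N z. z \<in> closure \<Omega> \<Longrightarrow> cmod (increment (N + k) z 1) \<le> C * \<kappa> ^ N"
    using increment_global by blast
  define a where "a N z = frozen w N z 1 / of_real \<mu> ^ N" for N z
  have a: "a (n + k) z = a k z + (\<Sum>i<n. increment (i + k) z 1)" for n z
    by (induction n) (simp_all add: increment_def a_def del: frozen.simps power_Suc)
  have "summable (\<lambda>N. C * \<kappa> ^ N)" using \<kappa> by (intro summable_mult summable_geometric) auto
  then have "uniform_limit (closure \<Omega>) (\<lambda>n z. \<Sum>i<n. increment (i + k) z 1) (\<lambda>z. \<Sum>i. increment (i + k) z 1) sequentially"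
    by (intro Weierstrass_m_test[OF kC])
  then have "uniform_limit (closure \<Omega>) (\<lambda>n z. a k z + (\<Sum>i<n. increment (i + k) z 1)) (\<lambda>z. a k z + (\<Sum>i. increment (i + k) z 1)) sequentially"
    by (intro uniform_limit_add uniform_limit_const)
  then have "uniform_limit (closure \<Omega>) (\<lambda>n. a (n + k)) (\<lambda>z. a k z + (\<Sum>i. increment (i + k) z 1)) sequentially"
    unfolding a .
  then have lim: "uniform_limit (closure \<Omega>) (\<lambda>n. a (n + k)) (\<lambda>z. a k z + (\<Sum>i. increment (i + k) z 1)) sequentially" .
  have "uniform_limit (closure \<Omega>) a (\<lambda>z. a k z + (\<Sum>i. increment (i + k) z 1)) sequentially"
    by (rule uniform_limitI, rule eventually_sequentially_seg[where k = k, THEN iffD1]) (rule uniform_limitD[OF lim])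
  then show ?thesis unfolding a_def by blast
qed

definition deviation :: "nat \<Rightarrow> real \<Rightarrow> real \<Rightarrow> complex" where
  "deviation N x p = frozen w N (of_real x) p / of_real \<mu> ^ N - of_real (w x)"

lemma deviation_Suc:
  assumes x: "x \<in> Lam g"
  shows "deviation (Suc N) x p = (- deviation N (- t * x) (- t * p) / of_real t + of_real (ph (y1 x)) * deviation N (y1 x) (y1 p)) / of_real \<mu>"
proof -
  have xJ: "x \<in> {-t..1}" using x Lam_subset by blast
  have alg: "(- a / \<tau> + f * b) / (m * M) - c = (- (a / M - a') / \<tau> + f * (b / M - b')) / m" 
    if "m \<noteq> 0" "\<tau> \<noteq> 0" "M \<noteq> 0" "m * c = - a' / \<tau> + f * b'" for a a' b b' c f m \<tau> M :: complex
  proof -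
    have c: "c = (- a' / \<tau> + f * b') / m" using that(1,4) by (simp add: nonzero_eq_divide_eq mult.commute)
    show ?thesis unfolding c using that(1-3) by (simp add: field_simps)
  qed
  have "\<mu> * w x = - w (- t * x) / t + ph (y1 x) * w (y1 x)" using eigen x by (simp add: limit_eigen_def)
  then have "complex_of_real (\<mu> * w x) = of_real (- w (- t * x) / t + ph (y1 x) * w (y1 x))" by (simp only:)
  then have eig: "complex_of_real \<mu> * of_real (w x) = - of_real (w (- t * x)) / of_real t + of_real (ph (y1 x)) * of_real (w (y1 x))" 
    by (simp only: of_real_add of_real_mult of_real_divide of_real_minus)
  have "of_real \<mu> \<noteq> (0::complex)" "of_real t \<noteq> (0::complex)" using mu_gt t_pos by auto
  then show ?thesis
    unfolding deviation_def frozen.simps(2) power_Suc F_real[OF xJ] Y_real[OF xJ] Z_real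
    by (intro alg eig) auto
qed

lemma deviation_Suc_le:
  assumes x: "x \<in> Lam g" and a: "cmod (deviation N (- t * x) (- t * p)) \<le> a" and c: "cmod (deviation N (y1 x) (y1 p)) \<le> c"
  shows "cmod (deviation (Suc N) x p) \<le> (a / t + ph (y1 x) * c) / \<mu>"
proof -
  have "0 < ph (y1 x)" using ph_ge[of "y1 x"] y1_in[of x] x Lam_subset t_pos by (force intro: order.strict_trans[rotated])
  then have "cmod (- deviation N (- t * x) (- t * p) / of_real t) + cmod (of_real (ph (y1 x)) * deviation N (y1 x) (y1 p)) \<le> a / t + ph (y1 x) * c"
    unfolding norm_mult norm_divide norm_minus_cancel norm_of_real abs_of_pos[OF t_pos] 
    using a c t_pos by (intro add_mono divide_right_mono mult_mono) auto
  then have "cmod (- deviation N (- t * x) (- t * p) / of_real t + of_real (ph (y1 x)) * deviation N (y1 x) (y1 p)) \<le> a / t + ph (y1 x) * c"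
    by (rule order_trans[OF norm_triangle_ineq])
  then show ?thesis unfolding deviation_Suc[OF x] norm_divide using mu_gt by (auto intro!: divide_right_mono)
qed

text \<open>Convergence alone does not identify the limit. As \<open>w\<close> solves the eigenvalue
  equation, the deviation obeys the same recursion and starts from \<open>w p - w x\<close>. Common
  intervals play the part of small balls: \<open>x\<close> and 1 share the interval of level 0, and
  after \<open>m\<close> steps their corresponding images share one of level
  \<open>m\<close>.\<close>

lemma frozen_tendsto:
  assumes x: "x \<in> Lam g"
  shows "(\<lambda>N. frozen w N (of_real x) 1 / of_real \<mu> ^ N) \<longlonglongrightarrow> of_real (w x)"
proof -
  obtain K m0 where K: "K > 0" and osc: "\<And>M i x x'. m0 \<le> M \<Longrightarrow> i \<in> {1..2 ^ M} \<Longrightarrow> x \<in> Lam g \<inter> cyl M i \<Longrightarrow> x' \<in> Lam g \<inter> cyl M i \<Longrightarrow>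
      \<bar>w x - w x'\<bar> \<le> K * (hi M i - lo M i)"
    using eigen unfolding limit_eigen_def by blast
  obtain m1 where m1: "\<And>M i r. m1 \<le> M \<Longrightarrow> i \<in> {1..2 ^ M} \<Longrightarrow> r \<in> {y1 (lo M i)..y1 (hi M i)} \<Longrightarrow>
      ph r * (y1 (hi M i) - y1 (lo M i)) \<le> (1 + \<eta>) * (hi M i - lo M i)"
    using weight_times_length[OF \<eta>_pos] by blast
  define m where "m = max m0 m1"
  have small: "cmod (deviation N x p) \<le> K * \<kappa> ^ N * (hi M i - lo M i)"
    if "m \<le> M" "i \<in> {1..2 ^ M}" "x \<in> Lam g" "x \<in> cyl M i" "p \<in> Lam g" "p \<in> cyl M i" for N M i x p
    using that
  proof (induction N arbitrary: M i x p)
    case 0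
    have "deviation 0 x p = of_real (w p - w x)" by (simp add: deviation_def)
    then have "cmod (deviation 0 x p) = \<bar>w p - w x\<bar>" by (simp only: norm_of_real)
    then show ?case using osc[of M i p x] 0 by (simp add: m_def)
  next
    case (Suc N)
    have idx: "2 ^ M + 1 - i \<in> {1..2 ^ Suc M}" "2 ^ M + i \<in> {1..2 ^ Suc M}" using Suc.prems(2) by auto
    have len: "hi (Suc M) (2 ^ M + 1 - i) - lo (Suc M) (2 ^ M + 1 - i) = t * (hi M i - lo M i)"
      "hi (Suc M) (2 ^ M + i) - lo (Suc M) (2 ^ M + i) = y1 (hi M i) - y1 (lo M i)"
    proof -
      have le: "2 ^ M + 1 - i \<le> 2 ^ M" and eq: "2 ^ M + 1 - (2 ^ M + 1 - i) = i" using Suc.prems by auto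
      show "hi (Suc M) (2 ^ M + 1 - i) - lo (Suc M) (2 ^ M + 1 - i) = t * (hi M i - lo M i)"
        unfolding ends_left[OF le] eq by (simp add: algebra_simps)
      show "hi (Suc M) (2 ^ M + i) - lo (Suc M) (2 ^ M + i) = y1 (hi M i) - y1 (lo M i)"
        using Suc.prems by (simp add: ends_right)
    qed
    have M: "m \<le> Suc M" using Suc.prems(1) by simp
    have a: "cmod (deviation N (- t * x) (- t * p)) \<le> K * \<kappa> ^ N * (t * (hi M i - lo M i))"
      unfolding len(1)[symmetric] using Suc.prems by (intro Suc.IH M idx Lam_y0 cyl_child_left)
    have c: "cmod (deviation N (y1 x) (y1 p)) \<le> K * \<kappa> ^ N * (y1 (hi M i) - y1 (lo M i))"
      unfolding len(2)[symmetric] using Suc.prems by (intro Suc.IH M idx Lam_y1 cyl_child_right)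
    have "y1 x \<in> {y1 (lo M i)..y1 (hi M i)}"
      using Suc.prems(4) ends_bounds[OF Suc.prems(2)] by (auto simp: cyl_def intro!: y1_mono)
    then have w: "ph (y1 x) * (y1 (hi M i) - y1 (lo M i)) \<le> (1 + \<eta>) * (hi M i - lo M i)"
      using Suc.prems by (intro m1) (auto simp: m_def)
    have "cmod (deviation (Suc N) x p) \<le> (K * \<kappa> ^ N * (t * (hi M i - lo M i)) / t + ph (y1 x) * (K * \<kappa> ^ N * (y1 (hi M i) - y1 (lo M i)))) / \<mu>"
      by (rule deviation_Suc_le[OF Suc.prems(3) a c])
    also have "K * \<kappa> ^ N * (t * (hi M i - lo M i)) / t = K * \<kappa> ^ N * (hi M i - lo M i)" using t_pos by simp
    also have "(K * \<kappa> ^ N * (hi M i - lo M i) + ph (y1 x) * (K * \<kappa> ^ N * (y1 (hi M i) - y1 (lo M i)))) / \<mu> =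
        K * \<kappa> ^ N * ((hi M i - lo M i) + ph (y1 x) * (y1 (hi M i) - y1 (lo M i))) / \<mu>"
      by (simp only: algebra_simps)
    also have "\<dots> \<le> K * \<kappa> ^ N * ((hi M i - lo M i) + (1 + \<eta>) * (hi M i - lo M i)) / \<mu>"
      using w K \<kappa> mu_gt by (intro divide_right_mono mult_left_mono add_left_mono) auto
    also have "\<dots> = K * \<kappa> ^ Suc N * (hi M i - lo M i)"
      by (simp add: \<kappa>_def algebra_simps)
    finally show ?case .
  qed
  \<comment> \<open>A crude bound for the normalised operator, used for the \<open>m\<close> steps
    before the intervals are short enough for \<open>small\<close>.\<close>
  define A where "A = (1 / t + 1 / t\<^sup>2) / \<mu>"
  have A: "A \<ge> 0" using t_pos mu_gt by (auto simp: A_def)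
  have it: "cmod (deviation (N + k) x p) \<le> A ^ k * (K * \<kappa> ^ N * 2)"
    if "m \<le> M + k" "i \<in> {1..2 ^ M}" "x \<in> Lam g" "x \<in> cyl M i" "p \<in> Lam g" "p \<in> cyl M i" for N k M i x p
    using that
  proof (induction k arbitrary: M i x p)
    case 0
    have "cmod (deviation N x p) \<le> K * \<kappa> ^ N * (hi M i - lo M i)" using 0 by (intro small) auto
    also have "\<dots> \<le> K * \<kappa> ^ N * 2"
      using ends_bounds[OF 0(2)] t_less_1 K \<kappa> by (intro mult_left_mono) auto
    finally show ?case by simp
  next
    case (Suc k)
    define E where "E = A ^ k * (K * \<kappa> ^ N * 2)"
    have E: "E \<ge> 0" using A K \<kappa> by (simp add: E_def)
    have idx: "2 ^ M + 1 - i \<in> {1..2 ^ Suc M}" "2 ^ M + i \<in> {1..2 ^ Suc M}" using Suc.prems(2) by auto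
    have M: "m \<le> Suc M + k" using Suc.prems(1) by simp
    have a: "cmod (deviation (N + k) (- t * x) (- t * p)) \<le> E"
      unfolding E_def using Suc.prems by (intro Suc.IH[OF M idx(1)] Lam_y0 cyl_child_left)
    have c: "cmod (deviation (N + k) (y1 x) (y1 p)) \<le> E"
      unfolding E_def using Suc.prems by (intro Suc.IH[OF M idx(2)] Lam_y1 cyl_child_right)
    have "ph (y1 x) \<le> 1 / t\<^sup>2" using y1_in[of x] Suc.prems(3) Lam_subset by (intro ph_le) auto
    then have "ph (y1 x) * E \<le> 1 / t\<^sup>2 * E" using E by (intro mult_right_mono)
    moreover have "cmod (deviation (N + Suc k) x p) \<le> (E / t + ph (y1 x) * E) / \<mu>"
      unfolding add_Suc_right by (rule deviation_Suc_le[OF Suc.prems(3) a c])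
    ultimately have "cmod (deviation (N + Suc k) x p) \<le> (E / t + 1 / t\<^sup>2 * E) / \<mu>"
      using mu_gt by (meson add_left_mono divide_right_mono order_trans less_imp_le zero_less_numeral order.strict_trans)
    also have "\<dots> = A * E" by (simp add: A_def algebra_simps add_divide_distrib)
    finally show ?case by (simp add: E_def)
  qed
  have "1 \<in> cyl 0 1" "x \<in> cyl 0 1" using Lam_subset x t_pos by (auto simp: cyl_def ends_0)
  then have bound: "norm (deviation (N + m) x 1) \<le> A ^ m * (K * \<kappa> ^ N * 2)" for N
    using it[of 0 m 1 x 1 N] x one_in_Lam by auto
  have "(\<lambda>N. A ^ m * (K * \<kappa> ^ N * 2)) \<longlonglongrightarrow> A ^ m * (K * 0 * 2)"
    using \<kappa> by (intro tendsto_intros LIMSEQ_power_zero) auto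
  then have "(\<lambda>N. deviation (N + m) x 1) \<longlonglongrightarrow> 0"
    by (intro Lim_null_comparison[OF always_eventually[OF allI[OF bound]]]) simp
  then have "(\<lambda>N. deviation N x 1) \<longlonglongrightarrow> 0" by (rule LIMSEQ_offset)
  then show ?thesis unfolding deviation_def by (simp add: LIM_zero_iff)
qed

text \<open>\<open>y1\<close> fixes 1 and contracts towards it, so the orbit of \<open>- t\<close>
  accumulates at 1 without reaching it. This lets the identity theorem work from the Cantor set
  alone.\<close>

lemma one_islimpt_Lam: "(1::complex) islimpt of_real ` Lam g"
  unfolding islimpt_approachable
proof (intro allI impI)
  fix e :: real assume e: "0 < e"
  define u where "u n = (y1 ^^ n) (- t)" for n
  have "- t \<in> Lam g" using Lam_y0[OF one_in_Lam] by simp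
  then have uL: "u n \<in> Lam g" for n by (induction n) (auto simp: u_def Lam_y1)
  have u1: "u n < 1 \<and> 1 - u n \<le> t ^ n * (1 + t)" for n
  proof (induction n)
    case 0 then show ?case using t_pos by (simp add: u_def)
  next
    case (Suc n)
    have "- t \<le> u n" using uL[of n] Lam_subset by auto
    moreover have "u (Suc n) = y1 (u n)" by (simp add: u_def)
    ultimately have "u (Suc n) < 1" "1 - u (Suc n) \<le> t * (1 - u n)"
      using y1_mvt(1)[of "u n" 1] y1_contracts[of "u n" 1] Suc y1_ends(1) by auto
    moreover have "t * (1 - u n) \<le> t * (t ^ n * (1 + t))" using Suc t_pos by (intro mult_left_mono) auto
    ultimately show ?case by (simp add: mult_ac)
  qed
  have "(\<lambda>n. t ^ n * (1 + t)) \<longlonglongrightarrow> 0 * (1 + t)"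
    using t_pos t_less_1 by (intro tendsto_intros LIMSEQ_power_zero) auto
  then have "\<forall>\<^sub>F n in sequentially. t ^ n * (1 + t) < e" using e by (intro order_tendstoD) auto
  then obtain n where n: "t ^ n * (1 + t) < e" by (metis (mono_tags, lifting) eventually_sequentially order_refl)
  have "dist (of_real (u n)) (1::complex) = \<bar>u n - 1\<bar>"
    by (metis dist_of_real dist_real_def of_real_1)
  also have "\<dots> < e" using u1[of n] n by linarith
  finally have "dist (of_real (u n)) (1::complex) < e" .
  moreover have "of_real (u n) \<noteq> (1::complex)" using u1[of n] by simp
  ultimately show "\<exists>x'\<in>of_real ` Lam g. x' \<noteq> (1::complex) \<and> dist x' 1 < e" using uL by blast
qed

theorem analytic_eigenfunction:
  "\<exists>\<Phi>. \<Phi> holomorphic_on \<Omega> \<and> continuous_on (closure \<Omega>) \<Phi> \<and> (\<forall>x\<in>Lam g. \<Phi> (of_real x) = of_real (w x)) \<and>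
    (\<forall>x\<in>{-t..1}. Im (\<Phi> (of_real x)) = 0) \<and>
    (\<forall>z\<in>\<Omega>. - \<Phi> (Z z) / of_real t + F z * \<Phi> (Y z) = of_real \<mu> * \<Phi> z)"
proof -
  obtain \<Phi> where lim: "uniform_limit (closure \<Omega>) (\<lambda>N z. frozen w N z 1 / of_real \<mu> ^ N) \<Phi> sequentially"
    using frozen_limit by blast
  have mu0: "of_real \<mu> \<noteq> (0::complex)" using mu_gt by simp
  have pt: "(\<lambda>N. frozen w N z 1 / of_real \<mu> ^ N) \<longlonglongrightarrow> \<Phi> z" if "z \<in> closure \<Omega>" for z
    using tendsto_uniform_limitI[OF lim that] .
  have cont: "continuous_on (closure \<Omega>) \<Phi>"
  proof (rule uniform_limit_theorem[OF always_eventually lim])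
    show "\<forall>N. continuous_on (closure \<Omega>) (\<lambda>z. frozen w N z 1 / of_real \<mu> ^ N)"
      using mu_gt by (intro allI continuous_intros cont_frozen) auto
  qed simp
  have hol: "\<Phi> holomorphic_on \<Omega>"
  proof (rule holomorphic_uniform_sequence[OF open_\<Omega>])
    show "(\<lambda>z. frozen w N z 1 / of_real \<mu> ^ N) holomorphic_on \<Omega>" for N
      by (intro holomorphic_intros hol_frozen) (simp add: mu0)
    fix z assume "z \<in> \<Omega>"
    then obtain d where d: "d > 0" "cball z d \<subseteq> \<Omega>" using open_\<Omega> open_contains_cball by blast
    then have "cball z d \<subseteq> closure \<Omega>" using closure_subset by blast
    with d show "\<exists>d>0. cball z d \<subseteq> \<Omega> \<and> uniform_limit (cball z d) (\<lambda>N z. frozen w N z 1 / of_real \<mu> ^ N) \<Phi> sequentially"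
      using uniform_limit_on_subset[OF lim] by blast
  qed
  have on_Lam: "\<Phi> (of_real x) = of_real (w x)" if x: "x \<in> Lam g" for x
  proof (rule LIMSEQ_unique[OF pt frozen_tendsto[OF x]])
    show "of_real x \<in> closure \<Omega>" using x Lam_subset J_closure by blast
  qed
  have real: "Im (\<Phi> (of_real x)) = 0" if x: "x \<in> {-t..1}" for x
  proof (rule LIMSEQ_unique[OF tendsto_Im[OF pt[OF J_closure[OF x]]]])
    have "Im (frozen w N (of_real x) 1 / of_real \<mu> ^ N) = 0" for N
      unfolding of_real_power[symmetric] Im_divide_of_real Im_frozen[OF x] by simp
    then show "(\<lambda>N. Im (frozen w N (of_real x) 1 / of_real \<mu> ^ N)) \<longlonglongrightarrow> 0" by (simp only: tendsto_const)
  qed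
  define Q where "Q z = - \<Phi> (Z z) / of_real t + F z * \<Phi> (Y z) - of_real \<mu> * \<Phi> z" for z
  have "(\<lambda>z. \<Phi> (Z z)) holomorphic_on \<Omega>" "(\<lambda>z. \<Phi> (Y z)) holomorphic_on \<Omega>"
    using holomorphic_on_compose_gen[OF hol_Z hol] holomorphic_on_compose_gen[OF hol_Y hol] Z_\<Omega> Y_\<Omega>
    unfolding o_def by blast+
  then have hol_Q: "Q holomorphic_on \<Omega>" 
    unfolding Q_def using t_pos by (intro holomorphic_intros hol hol_F) auto
  have "Q z = 0" if z: "z \<in> \<Omega>" for z
  proof (rule analytic_continuation[OF hol_Q open_\<Omega> conn_\<Omega> _ _ one_islimpt_Lam _ z])
    show "of_real ` Lam g \<subseteq> \<Omega>" using Lam_subset J_\<Omega> by blast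
    show "1 \<in> \<Omega>" using J_\<Omega>[of 1] t_pos by simp
    fix z assume "z \<in> complex_of_real ` Lam g"
    then obtain x where x: "x \<in> Lam g" "z = of_real x" by blast
    have xJ: "x \<in> {-t..1}" using x Lam_subset by blast
    have "\<mu> * w x = - w (- t * x) / t + ph (y1 x) * w (y1 x)" using eigen x by (simp add: limit_eigen_def)
    then have "complex_of_real (\<mu> * w x) = of_real (- w (- t * x) / t + ph (y1 x) * w (y1 x))" by (simp only:)
    then show "Q z = 0"
      unfolding Q_def x(2) Z_real Y_real[OF xJ] F_real[OF xJ] on_Lam[OF x(1)] on_Lam[OF Lam_y0[OF x(1)]] on_Lam[OF Lam_y1[OF x(1)]]
      by (simp only: of_real_add of_real_mult of_real_divide of_real_minus) simp
  qed
  then show ?thesis using hol cont on_Lam real unfolding Q_def by (intro exI[of _ \<Phi>]) auto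
qed

end

section \<open>Eigenvectors in the three function spaces\<close>

lemma transfer_phi:
  assumes "x \<in> {-t..1}"
  shows "transfer_op g (phi g) v x = - v (- t * x) / t + ph (y1 x) * v (y1 x)"
  unfolding transfer_op_eq[OF assms] phi_J0[OF scaled_J[OF assms]] phi_J1[OF y1_in[OF assms]] by simp

lemma limit_eigen_vector:
  assumes "limit_eigen \<mu> w"
  shows "is_eigenvector (Lam g) (V_bounded (Lam g)) (transfer_op g (phi g)) \<mu> w"
    and "is_eigenvalue (Lam g) (V_lipschitz (Lam g)) (transfer_op g (phi g)) \<mu>"
    and "is_eigenvalue (intJ g) (V_analytic (intJ g) \<Omega>) (transfer_op g (phi g)) \<mu>"
proof -
  have w1: "\<exists>x\<in>Lam g. w x \<noteq> 0" using assms one_in_Lam by (intro bexI[of _ 1]) (auto simp: limit_eigen_def)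
  have w_eq: "\<forall>x\<in>Lam g. transfer_op g (phi g) w x = \<mu> * w x"
  proof
    fix x assume x: "x \<in> Lam g"
    then have "x \<in> {-t..1}" using Lam_subset by blast
    from transfer_phi[OF this] show "transfer_op g (phi g) w x = \<mu> * w x"
      using assms x by (simp add: limit_eigen_def)
  qed
  have "bounded (w ` Lam g)" unfolding bounded_iff using assms by (intro exI[of _ 1]) (auto simp: limit_eigen_def)
  then show "is_eigenvector (Lam g) (V_bounded (Lam g)) (transfer_op g (phi g)) \<mu> w"
    using w1 w_eq by (simp add: is_eigenvector_def V_bounded_def)
  obtain \<Phi> where hol: "\<Phi> holomorphic_on \<Omega>" and cont: "continuous_on (closure \<Omega>) \<Phi>" 
    and on_Lam: "\<And>x. x \<in> Lam g \<Longrightarrow> \<Phi> (of_real x) = of_real (w x)"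
    and real: "\<And>x. x \<in> {-t..1} \<Longrightarrow> Im (\<Phi> (of_real x)) = 0"
    and eq: "\<And>z. z \<in> \<Omega> \<Longrightarrow> - \<Phi> (Z z) / of_real t + F z * \<Phi> (Y z) = of_real \<mu> * \<Phi> z"
    using analytic_eigenfunction[OF assms] by blast
  define u where "u x = Re (\<Phi> (of_real x))" for x
  have \<Phi>u: "\<Phi> (of_real x) = of_real (u x)" if "x \<in> {-t..1}" for x
    using real[OF that] by (simp add: u_def complex_eq_iff)
  have uw: "u x = w x" if "x \<in> Lam g" for x using on_Lam[OF that] by (simp add: u_def)
  show "is_eigenvalue (intJ g) (V_analytic (intJ g) \<Omega>) (transfer_op g (phi g)) \<mu>"
    unfolding is_eigenvalue_def is_eigenvector_def
  proof (intro exI[of _ u] conjI ballI)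
    show "u \<in> V_analytic (intJ g) \<Omega>"
      unfolding V_analytic_def intervals using hol cont \<Phi>u by blast
    show "\<exists>x\<in>intJ g. u x \<noteq> 0"
      using uw[OF one_in_Lam] assms t_pos by (intro bexI[of _ 1]) (auto simp: intervals limit_eigen_def)
    fix x assume "x \<in> intJ g"
    then have x: "x \<in> {-t..1}" by (simp add: intervals)
    have y: "- t * x \<in> {-t..1}" "y1 x \<in> {-t..1}"
      using scaled_J[OF x] y1_in[OF x] t_sq_less_t t_less_1 b_pos t_pos by auto
    have "complex_of_real (- u (- t * x) / t + ph (y1 x) * u (y1 x)) = of_real (\<mu> * u x)"
      using eq[OF J_\<Omega>[OF x]] unfolding Z_real Y_real[OF x] F_real[OF x] \<Phi>u[OF x] \<Phi>u[OF y(1)] \<Phi>u[OF y(2)]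
      by (simp only: of_real_add of_real_mult of_real_divide of_real_minus)
    then show "transfer_op g (phi g) u x = \<mu> * u x"
      unfolding transfer_phi[OF x] of_real_eq_iff .
  qed
  \<comment> \<open>The extension is smooth on the whole interval \<open>J\<close>, gaps of the
    Cantor set included, so the mean value inequality applies to any two points of
    \<open>Lam g\<close>.\<close>
  have "continuous_on {-t..1} (\<lambda>x. deriv \<Phi> (of_real x))"
    by (rule continuous_on_compose2[of \<Omega>]) (auto intro!: continuous_intros 
        holomorphic_on_imp_continuous_on holomorphic_deriv hol open_\<Omega> J_\<Omega>)
  then have "compact ((\<lambda>x. deriv \<Phi> (of_real x)) ` {-t..1})" by (intro compact_continuous_image) auto
  then obtain C where C: "C > 0" "\<And>x. x \<in> {-t..1} \<Longrightarrow> cmod (deriv \<Phi> (of_real x)) \<le> C"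
    by (auto dest!: compact_imp_bounded simp: bounded_pos)
  have "C-lipschitz_on (Lam g) w"
  proof (rule lipschitz_onI)
    fix x y assume xy: "x \<in> Lam g" "y \<in> Lam g"
    have "norm (u x - u y) \<le> C * norm (x - y)"
    proof (rule field_differentiable_bound[of "{-t..1}" u "\<lambda>x. Re (deriv \<Phi> (of_real x))"])
      fix x assume x: "x \<in> {-t..1}"
      show "(u has_real_derivative Re (deriv \<Phi> (of_real x))) (at x within {-t..1})"
        unfolding u_def
        by (rule has_field_derivative_at_within[OF has_real_derivative_of_holomorphic[OF hol open_\<Omega> J_\<Omega>[OF x]]])
      show "norm (Re (deriv \<Phi> (of_real x))) \<le> C"
        using abs_Re_le_cmod C(2)[OF x] by (auto intro: order_trans)
    qed (use xy Lam_subset in auto)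
    then show "dist (w x) (w y) \<le> C * dist x y" using uw xy by (simp add: dist_norm)
  qed (use C in simp)
  then show "is_eigenvalue (Lam g) (V_lipschitz (Lam g)) (transfer_op g (phi g)) \<mu>"
    unfolding is_eigenvalue_def is_eigenvector_def V_lipschitz_def using w1 w_eq by blast
qed

end

theorem mainTheorem2:
  fixes g :: "real \<Rightarrow> real" and G S :: "complex \<Rightarrow> complex" and U \<Omega> \<Omega>0 \<Omega>1 :: "complex set"
  assumes fixed_point: "period_doubling_fixed_point g G U"
    and Omega: "\<Omega> = G ` U" "bounded \<Omega>"
    and extension: "expanding_extension g \<Omega> \<Omega>0 \<Omega>1 S"
    and operator: "\<And>v. v \<in> V_analytic (intJ g) \<Omega> \<Longrightarrow>
                     transfer_op g (phi g) v \<in> V_analytic (intJ g) \<Omega>"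
    and concave: "concave_on {-1..1} g"
  shows "\<exists>(lam :: nat \<Rightarrow> real) (v :: nat \<Rightarrow> real \<Rightarrow> real).
      (\<forall>n\<ge>1. lam n > 1 \<and>
         is_eigenvector (Lam g) (V_bounded (Lam g)) (transfer_op g (phi_n g n)) (lam n) (v n) \<and>
         positive_step_vector g n (v n)) \<and>
      (\<exists>(r :: nat \<Rightarrow> nat) (\<mu> :: real) (w :: real \<Rightarrow> real).
         strict_mono r \<and> (\<forall>i. r i \<ge> 1) \<and>
         (\<lambda>i. lam (r i)) \<longlonglongrightarrow> \<mu> \<and> \<mu> > 1 \<and>
         uniform_limit (Lam g) (\<lambda>i. v (r i)) w sequentially \<and>
         is_eigenvector (Lam g) (V_bounded (Lam g)) (transfer_op g (phi g)) \<mu> w \<and>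
         is_eigenvalue (Lam g) (V_lipschitz (Lam g)) (transfer_op g (phi g)) \<mu> \<and>
         is_eigenvalue (intJ g) (V_analytic (intJ g) \<Omega>) (transfer_op g (phi g)) \<mu>)"
proof -
  interpret feigenbaum g G U by unfold_locales (fact fixed_point concave)+
  obtain F Y where "analytic_branches g G U \<Omega> F Y"
    using expanding_extension_branches[OF Omega(2) extension operator] by blast
  then interpret analytic_branches g G U \<Omega> F Y .
  obtain lam v r \<mu> w where se: "\<And>n. n \<ge> 1 \<Longrightarrow> step_eigen n (lam n) (v n)" and r: "strict_mono (r :: nat \<Rightarrow> nat)" "\<And>i. r i \<ge> 1"
    and lim: "(\<lambda>i. lam (r i)) \<longlonglongrightarrow> \<mu>" "uniform_limit (Lam g) (\<lambda>i. v (r i)) w sequentially" and w: "limit_eigen \<mu> w"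
    using limit_eigen_exists by metis
  show ?thesis
  proof (intro exI conjI allI impI)
    fix n :: nat assume n: "1 \<le> n"
    note s = se[OF n]
    have "rate \<le> lam n" using s by (simp add: step_eigen_def)
    then show "lam n > 1" using rate_gt_2 by linarith
    show "is_eigenvector (Lam g) (V_bounded (Lam g)) (transfer_op g (phi_n g n)) (lam n) (v n)"
      by (rule step_eigen_vector[OF n s])
    show "positive_step_vector g n (v n)" using s by (simp add: step_eigen_def)
  next
    show "strict_mono r" "r i \<ge> 1" for i by (rule r)+
    have "rate \<le> \<mu>" using w by (simp add: limit_eigen_def)
    then show "\<mu> > 1" using rate_gt_2 by linarith
  qed (rule lim limit_eigen_vector[OF w])+
qed

end
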